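(* Consider a sharp theory with purification. Let $S$ be a system, $E$ an environment system, $H_E\in\mathsf{Eff}_{\mathbb R}(E)$ the energy observable of the environment, and suppose that the system and the environment are initially in the product state $\rho_{SE}=\rho_S\otimes\gamma_{E,\beta}$, where $\rho_S$ is a normalised state of $S$ and $\gamma_{E,\beta}$ is the Gibbs state of $E$ (for the observable $H_E$) at inverse temperature $\beta=\frac{1}{kT}$. Let $\mathcal U$ be a reversible channel on $SE$, let $\rho'_{SE}:=\mathcal U\rho_{SE}$, and let $\rho'_S,\rho'_E$ be its marginals. Then $$\langle H_E\rangle'-\langle H_E\rangle=kT\Big(S(\rho_S)-S(\rho'_S)+I(S;E)_{\rho'_{SE}}+S(\rho'_E\parallel\gamma_{E,\beta})\Big),$$ where $\langle H_E\rangle=(H_E|\gamma_{E,\beta})$ and $\langle H_E\rangle'=(H_E|\rho'_E)$.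
   Context: Framework. A causal operational probabilistic theory (OPT) has systems $A,B,\dots$ (including a trivial system $I$), with associative composites $AB$ ($AI=IA=A$; $AB$ and $BA$ related by a reversible swap), and tests. A test from $A$ to $B$ is a finite family $\{\mathcal C_i\}_{i\in X}$ of transformations from $A$ to $B$. Tests are closed under sequential composition, parallel composition $\otimes$ and coarse-graining (summing transformations over the blocks of a partition of $X$); identities $\mathcal I_A$ and swaps are one-outcome tests; systems and transformations form a strict symmetric monoidal category. Tests on $I$ are probability distributions, numbers compose by multiplication, and all probabilities in $[0,1]$ are available. A state of $A$ is a transformation $I\to A$, an effect is a transformation $A\to I$, $(a|\rho)\in[0,1]$ is their composition, extended bilinearly to the real spans $\mathsf{Eff}_{\mathbb R}(A),\mathsf{St}_{\mathbb R}(A)$; tests $A\to I$ are observation-tests. States (effects) are equal iff they have the same pairing with all effects (states); transformations $\mathcal C,\mathcal C'$ from $A$ to $B$ are equal iff $(\mathcal C\otimes\mathcal I_R)\rho=(\mathcal C'\otimes\mathcal I_R)\rho$ for every system $R$ and state $\rho$ of $AR$. The spanned real vector spaces are finite-dimensional; the sets of states, effects and transformations are closed (hence compact). Every test $\{\mathcal A_i\}$ from $A$ to $B$ has the form $\mathcal A_i=(\mathcal I_B\otimes e_i)\mathcal A$ with $\mathcal A$ a deterministic transformation from $A$ to some $BX$ and $\{e_i\}$ an observation-test on $X$. A channel is a deterministic (one-outcome-test) transformation; it is reversible if it has an inverse channel. A transformation $\mathcal T$ is pure if whenever $\mathcal T=\sum_{i\in X_0}\mathcal D_i$ with $X_0\subseteq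 X$ and $\{\mathcal D_i\}_{i\in X}$ a test, every $\mathcal D_i$, $i\in X_0$, is a multiple of $\mathcal T$. Causality: every system has a unique deterministic effect $u_A$; the marginal on $A$ of a state of $AB$ is obtained by applying $u_B$. A state is normalised if $(u|\rho)=1$; an effect $a$ is normalised if $\sup_\rho(a|\rho)=1$ over states. Tests may be chosen conditionally on earlier outcomes and randomised, so normalised states form a convex set; every nonzero state is a multiple of a normalised one. A sharp theory with purification is a causal OPT satisfying: Purity Preservation (sequential and parallel compositions of pure transformations are pure); Pure Sharpness (for every system there is a pure effect $a$ and a state $\rho$ with $(a|\rho)=1$); Purification (every normalised state $\rho$ of $A$ is the marginal of a normalised pure state of some composite $AB$, and if two normalised pure states $\Psi,\Psi'$ of $AB$ have the same marginal on $A$ then $\Psi'=(\mathcal I_A\otimes\mathcal U)\Psi$ for a reversible channel $\mathcal U$ on $B$). Normalised states $\{\rho_i\}$ are perfectly distinguishable if there is an observation-test $\{a_i\}$ with $(a_i|\rho_j)=\delta_{ij}$. A pure maximal set is a set of perfectly distinguishable normalised pure states to which no state can be added keeping perfect distinguishability. Facts fixing notation in sharp theories with purification: every normalised pure state $\alpha$ has a unique normalised pure effect $\alpha^\dagger$ with $(\alpha^\dagger|\alpha)=1$ (a bijection); all pure maximal sets of a system have the same cardinality $d$; every normalised state has a diagonalisation $\rho=\sum_{i=1}^dp_i\alpha_i$ with $\{\alpha_i\}_{i=1}^d$ a pure maximal set and $\{p_i\}$ a probability distribution unique up to order (its spectrum); every $X\in\mathsf{Eff}_{\mathbb R}(A)$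 (an observable) can be written $X=\sum_{i=1}^dx_i\alpha_i^\dagger$ with $x_i\in\mathbb R$ and $\{\alpha_i\}$ a pure maximal set. Put $\rho^\dagger:=\sum_ip_i\alpha_i^\dagger$ and, for a function $f$, $f(\rho^\dagger):=\sum_if(p_i)\alpha_i^\dagger$; these are well defined. Gibbs state: if $H=\sum_{i=1}^dE_i\varphi_i^\dagger$ with $\{\varphi_i\}$ a pure maximal set, $\gamma_\beta:=\frac1Z\sum_{i=1}^d\mathrm e^{-\beta E_i}\varphi_i$, $Z:=\sum_{i=1}^d\mathrm e^{-\beta E_i}$. Temperature $T$ is positive and finite, $k>0$ is Boltzmann's constant. Entropies use the natural logarithm: $S(\rho):=-\sum_ip_i\ln p_i=(-\ln\rho^\dagger|\rho)$ (with $0\ln0=0$); $S(\rho\parallel\sigma):=(\ln\rho^\dagger-\ln\sigma^\dagger|\rho)$ (relative entropy); $I(A;B)_{\rho_{AB}}:=S(\rho_A)+S(\rho_B)-S(\rho_{AB})$ with $\rho_A,\rho_B$ the marginals of $\rho_{AB}$. *)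

theory Defs
  imports "HOL-Analysis.Analysis"
begin

text \<open>
  Operational probabilistic theories. All transformations of a theory live in one normed space
  \<^typ>\<open>'t\<close>, e.g. the direct sum of the real spans of the transformations from \<open>A\<close> to \<open>B\<close>, so that
  sums of transformations, the spans \<open>Eff\<^sub>\<real>(A)\<close>, \<open>St\<^sub>\<real>(A)\<close> and closedness are the library notions.
  The norm serves only to provide a topology, and it is unique on the finite-dimensional spans.
  Sequential and parallel composition are the bilinear extensions of the physical ones; their
  values on arguments of non-matching types are irrelevant.

  A test is a list, i.e. a family indexed by \<open>{..<n}\<close>; the transformations from \<open>A\<close> to \<open>B\<close> are the
  members of the tests from \<open>A\<close> to \<open>B\<close>.
\<close>

record ('s, 't) opt =
  triv :: "'s" ("\<one>\<index>")
  composite :: "'s \<Rightarrow> 's \<Rightarrow> 's" (infixr "\<star>\<index>" 75)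
  tests :: "'s \<Rightarrow> 's \<Rightarrow> 't list set"
  seq :: "'t \<Rightarrow> 't \<Rightarrow> 't" (infixr "\<odot>\<index>" 70)
  par :: "'t \<Rightarrow> 't \<Rightarrow> 't" (infixr "\<otimes>\<index>" 75)
  ident :: "'s \<Rightarrow> 't"
  swp :: "'s \<Rightarrow> 's \<Rightarrow> 't"

definition transf :: "('s, 't) opt \<Rightarrow> 's \<Rightarrow> 's \<Rightarrow> 't set" where
  "transf \<Theta> A B = (\<Union>Cs\<in>tests \<Theta> A B. set Cs)"

definition states :: "('s, 't) opt \<Rightarrow> 's \<Rightarrow> 't set" where
  "states \<Theta> A = transf \<Theta> \<one>\<^bsub>\<Theta>\<^esub> A"

definition effects :: "('s, 't) opt \<Rightarrow> 's \<Rightarrow> 't set" where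
  "effects \<Theta> A = transf \<Theta> A \<one>\<^bsub>\<Theta>\<^esub>"

definition channel :: "('s, 't) opt \<Rightarrow> 's \<Rightarrow> 's \<Rightarrow> 't \<Rightarrow> bool" where
  "channel \<Theta> A B C \<longleftrightarrow> [C] \<in> tests \<Theta> A B"

text \<open>The number \<open>r\<close> is identified with the multiple \<open>r\<close> of the identity of the trivial system.\<close>

definition pairing :: "('s, 't::real_normed_vector) opt \<Rightarrow> 't \<Rightarrow> 't \<Rightarrow> real" where
  "pairing \<Theta> X x = (THE r. X \<odot>\<^bsub>\<Theta>\<^esub> x = r *\<^sub>R ident \<Theta> \<one>\<^bsub>\<Theta>\<^esub>)"

definition observables :: "('s, 't::real_normed_vector) opt \<Rightarrow> 's \<Rightarrow> 't set" where
  "observables \<Theta> A = span (effects \<Theta> A)"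

definition discard :: "('s, 't) opt \<Rightarrow> 's \<Rightarrow> 't" where
  "discard \<Theta> A = (THE u. channel \<Theta> A \<one>\<^bsub>\<Theta>\<^esub> u)"

definition normalised_state :: "('s, 't::real_normed_vector) opt \<Rightarrow> 's \<Rightarrow> 't \<Rightarrow> bool" where
  "normalised_state \<Theta> A \<rho> \<longleftrightarrow> \<rho> \<in> states \<Theta> A \<and> pairing \<Theta> (discard \<Theta> A) \<rho> = 1"

definition normalised_effect :: "('s, 't::real_normed_vector) opt \<Rightarrow> 's \<Rightarrow> 't \<Rightarrow> bool" where
  "normalised_effect \<Theta> A a \<longleftrightarrow> a \<in> effects \<Theta> A \<and> (SUP \<rho>\<in>states \<Theta> A. pairing \<Theta> a \<rho>) = 1"

definition marginal1 :: "('s, 't) opt \<Rightarrow> 's \<Rightarrow> 's \<Rightarrow> 't \<Rightarrow> 't" where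
  "marginal1 \<Theta> A B \<rho> = (ident \<Theta> A \<otimes>\<^bsub>\<Theta>\<^esub> discard \<Theta> B) \<odot>\<^bsub>\<Theta>\<^esub> \<rho>"

definition marginal2 :: "('s, 't) opt \<Rightarrow> 's \<Rightarrow> 's \<Rightarrow> 't \<Rightarrow> 't" where
  "marginal2 \<Theta> A B \<rho> = (discard \<Theta> A \<otimes>\<^bsub>\<Theta>\<^esub> ident \<Theta> B) \<odot>\<^bsub>\<Theta>\<^esub> \<rho>"

definition reversible :: "('s, 't) opt \<Rightarrow> 's \<Rightarrow> 's \<Rightarrow> 't \<Rightarrow> bool" where
  "reversible \<Theta> A B U \<longleftrightarrow> channel \<Theta> A B U \<and>
     (\<exists>V. channel \<Theta> B A V \<and> V \<odot>\<^bsub>\<Theta>\<^esub> U = ident \<Theta> A \<and> U \<odot>\<^bsub>\<Theta>\<^esub> V = ident \<Theta> B)"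

definition pure :: "('s, 't::real_normed_vector) opt \<Rightarrow> 's \<Rightarrow> 's \<Rightarrow> 't \<Rightarrow> bool" where
  "pure \<Theta> A B C \<longleftrightarrow> C \<in> transf \<Theta> A B \<and>
     (\<forall>Ds\<in>tests \<Theta> A B. \<forall>X\<^sub>0\<subseteq>{..<length Ds}. C = (\<Sum>i\<in>X\<^sub>0. Ds ! i) \<longrightarrow>
        (\<forall>i\<in>X\<^sub>0. \<exists>c. Ds ! i = c *\<^sub>R C))"

definition pure_state :: "('s, 't::real_normed_vector) opt \<Rightarrow> 's \<Rightarrow> 't \<Rightarrow> bool" where
  "pure_state \<Theta> A \<psi> \<longleftrightarrow> normalised_state \<Theta> A \<psi> \<and> pure \<Theta> \<one>\<^bsub>\<Theta>\<^esub> A \<psi>"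

text \<open>
  In \<open>conditional\<close>, the test \<open>Dss ! i\<close> is performed after outcome \<open>i\<close> of \<open>Cs\<close>; equal entries give
  sequential composition, and a test \<open>Cs\<close> of the form \<open>[p\<^sub>i *\<^sub>R ident A]\<close>, which is the parallel
  composition of a probability distribution with the identity, gives randomisation.
  In \<open>coarse_graining\<close>, the blocks of the partition are the fibres of \<open>q\<close>; with bijective \<open>q\<close> the
  axiom also allows the outcomes of a test to be relabelled.
\<close>

locale causal_opt =
  fixes \<Theta> :: "('s, 't::real_normed_vector) opt" (structure)
  assumes composite_assoc: "(A \<star> B) \<star> C = A \<star> (B \<star> C)"
    and composite_unit: "A \<star> \<one> = A" "\<one> \<star> A = A"
    and seq_bilinear: "bilinear (seq \<Theta>)"
    and par_bilinear: "bilinear (par \<Theta>)"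
    and seq_assoc: "\<lbrakk>f \<in> transf \<Theta> A B; g \<in> transf \<Theta> B C; h \<in> transf \<Theta> C D\<rbrakk> \<Longrightarrow>
          (h \<odot> g) \<odot> f = h \<odot> (g \<odot> f)"
    and seq_ident: "f \<in> transf \<Theta> A B \<Longrightarrow> f \<odot> ident \<Theta> A = f"
          "f \<in> transf \<Theta> A B \<Longrightarrow> ident \<Theta> B \<odot> f = f"
    and par_assoc: "\<lbrakk>f \<in> transf \<Theta> A A'; g \<in> transf \<Theta> B B'; h \<in> transf \<Theta> C C'\<rbrakk> \<Longrightarrow>
          (f \<otimes> g) \<otimes> h = f \<otimes> (g \<otimes> h)"
    and par_unit: "f \<in> transf \<Theta> A B \<Longrightarrow> f \<otimes> ident \<Theta> \<one> = f"
          "f \<in> transf \<Theta> A B \<Longrightarrow> ident \<Theta> \<one> \<otimes> f = f"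
    and par_ident: "ident \<Theta> A \<otimes> ident \<Theta> B = ident \<Theta> (A \<star> B)"
    and interchange: "\<lbrakk>f \<in> transf \<Theta> A B; g \<in> transf \<Theta> B C; f' \<in> transf \<Theta> A' B'; g' \<in> transf \<Theta> B' C'\<rbrakk> \<Longrightarrow>
          (g \<odot> f) \<otimes> (g' \<odot> f') = (g \<otimes> g') \<odot> (f \<otimes> f')"
    and swap_natural: "\<lbrakk>f \<in> transf \<Theta> A A'; g \<in> transf \<Theta> B B'\<rbrakk> \<Longrightarrow>
          swp \<Theta> A' B' \<odot> (f \<otimes> g) = (g \<otimes> f) \<odot> swp \<Theta> A B"
    and swap_swap: "swp \<Theta> B A \<odot> swp \<Theta> A B = ident \<Theta> (A \<star> B)"
    and swap_composite: "swp \<Theta> A (B \<star> C) =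
          (ident \<Theta> B \<otimes> swp \<Theta> A C) \<odot> (swp \<Theta> A B \<otimes> ident \<Theta> C)"
    and ident_test: "[ident \<Theta> A] \<in> tests \<Theta> A A"
    and swap_test: "[swp \<Theta> A B] \<in> tests \<Theta> (A \<star> B) (B \<star> A)"
    and conditional: "\<lbrakk>Cs \<in> tests \<Theta> A B; length Dss = length Cs; \<forall>Ds\<in>set Dss. Ds \<in> tests \<Theta> B C\<rbrakk> \<Longrightarrow>
          concat (map2 (\<lambda>C Ds. map (\<lambda>D. D \<odot> C) Ds) Cs Dss) \<in> tests \<Theta> A C"
    and parallel: "\<lbrakk>Cs \<in> tests \<Theta> A B; Ds \<in> tests \<Theta> A' B'\<rbrakk> \<Longrightarrow>
          [C \<otimes> D. C \<leftarrow> Cs, D \<leftarrow> Ds] \<in> tests \<Theta> (A \<star> A') (B \<star> B')"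
    and coarse_graining: "\<lbrakk>Cs \<in> tests \<Theta> A B; q ` {..<length Cs} = {..<m}\<rbrakk> \<Longrightarrow>
          map (\<lambda>j. \<Sum>i | i < length Cs \<and> q i = j. Cs ! i) [0..<m] \<in> tests \<Theta> A B"
    and scalar_nontrivial: "ident \<Theta> \<one> \<noteq> 0"
    and scalar_tests: "tests \<Theta> \<one> \<one> =
          {map (\<lambda>p. p *\<^sub>R ident \<Theta> \<one>) ps | ps. (\<forall>p\<in>set ps. 0 \<le> p) \<and> sum_list ps = 1}"
    and dilation: "Cs \<in> tests \<Theta> A B \<Longrightarrow>
          \<exists>X T es. channel \<Theta> A (B \<star> X) T \<and> es \<in> tests \<Theta> X \<one> \<and>
            Cs = map (\<lambda>e. (ident \<Theta> B \<otimes> e) \<odot> T) es"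
    and state_eqI: "\<lbrakk>\<rho> \<in> states \<Theta> A; \<sigma> \<in> states \<Theta> A;
          \<And>a. a \<in> effects \<Theta> A \<Longrightarrow> pairing \<Theta> a \<rho> = pairing \<Theta> a \<sigma>\<rbrakk> \<Longrightarrow> \<rho> = \<sigma>"
    and effect_eqI: "\<lbrakk>a \<in> effects \<Theta> A; b \<in> effects \<Theta> A;
          \<And>\<rho>. \<rho> \<in> states \<Theta> A \<Longrightarrow> pairing \<Theta> a \<rho> = pairing \<Theta> b \<rho>\<rbrakk> \<Longrightarrow> a = b"
    and transf_eqI: "\<lbrakk>f \<in> transf \<Theta> A B; g \<in> transf \<Theta> A B;
          \<And>R \<rho>. \<rho> \<in> states \<Theta> (A \<star> R) \<Longrightarrow>
            (f \<otimes> ident \<Theta> R) \<odot> \<rho> = (g \<otimes> ident \<Theta> R) \<odot> \<rho>\<rbrakk> \<Longrightarrow> f = g"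
    and finite_dimensional: "\<exists>F. finite F \<and> transf \<Theta> A B \<subseteq> span F"
    and closed_transf: "closed (transf \<Theta> A B)"
    and causality: "\<exists>!u. channel \<Theta> A \<one> u"
    and normalisable: "\<lbrakk>\<rho> \<in> states \<Theta> A; \<rho> \<noteq> 0\<rbrakk> \<Longrightarrow>
          \<exists>c \<sigma>. normalised_state \<Theta> A \<sigma> \<and> \<rho> = c *\<^sub>R \<sigma>"

locale sharp_theory_with_purification = causal_opt +
  assumes purity_preservation_seq: "\<lbrakk>pure \<Theta> A B f; pure \<Theta> B C g\<rbrakk> \<Longrightarrow> pure \<Theta> A C (g \<odot> f)"
    and purity_preservation_par: "\<lbrakk>pure \<Theta> A B f; pure \<Theta> A' B' g\<rbrakk> \<Longrightarrow>
          pure \<Theta> (A \<star> A') (B \<star> B') (f \<otimes> g)"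
    and pure_sharpness: "\<exists>a \<rho>. pure \<Theta> A \<one> a \<and> \<rho> \<in> states \<Theta> A \<and> pairing \<Theta> a \<rho> = 1"
    and purification_exists: "normalised_state \<Theta> A \<rho> \<Longrightarrow>
          \<exists>B \<Psi>. pure_state \<Theta> (A \<star> B) \<Psi> \<and> marginal1 \<Theta> A B \<Psi> = \<rho>"
    and purification_unique: "\<lbrakk>pure_state \<Theta> (A \<star> B) \<Psi>; pure_state \<Theta> (A \<star> B) \<Psi>';
          marginal1 \<Theta> A B \<Psi> = marginal1 \<Theta> A B \<Psi>'\<rbrakk> \<Longrightarrow>
          \<exists>U. reversible \<Theta> B B U \<and> \<Psi>' = (ident \<Theta> A \<otimes> U) \<odot> \<Psi>"

definition perfectly_distinguishable ::
    "('s, 't::real_normed_vector) opt \<Rightarrow> 's \<Rightarrow> 't list \<Rightarrow> bool" where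
  "perfectly_distinguishable \<Theta> A \<rho>s \<longleftrightarrow> (\<forall>\<rho>\<in>set \<rho>s. normalised_state \<Theta> A \<rho>) \<and>
     (\<exists>as\<in>tests \<Theta> A \<one>\<^bsub>\<Theta>\<^esub>. length as = length \<rho>s \<and>
        (\<forall>i<length \<rho>s. \<forall>j<length \<rho>s. pairing \<Theta> (as ! i) (\<rho>s ! j) = (if i = j then 1 else 0)))"

definition pure_maximal :: "('s, 't::real_normed_vector) opt \<Rightarrow> 's \<Rightarrow> 't list \<Rightarrow> bool" where
  "pure_maximal \<Theta> A \<alpha>s \<longleftrightarrow> perfectly_distinguishable \<Theta> A \<alpha>s \<and>
     (\<forall>\<alpha>\<in>set \<alpha>s. pure_state \<Theta> A \<alpha>) \<and>
     (\<nexists>\<rho>. perfectly_distinguishable \<Theta> A (\<alpha>s @ [\<rho>]))"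

definition dagger :: "('s, 't::real_normed_vector) opt \<Rightarrow> 's \<Rightarrow> 't \<Rightarrow> 't" where
  "dagger \<Theta> A \<alpha> =
     (THE a. pure \<Theta> A \<one>\<^bsub>\<Theta>\<^esub> a \<and> normalised_effect \<Theta> A a \<and> pairing \<Theta> a \<alpha> = 1)"

definition diagonalisation ::
    "('s, 't::real_normed_vector) opt \<Rightarrow> 's \<Rightarrow> 't \<Rightarrow> real list \<Rightarrow> 't list \<Rightarrow> bool" where
  "diagonalisation \<Theta> A \<rho> ps \<alpha>s \<longleftrightarrow> pure_maximal \<Theta> A \<alpha>s \<and> length ps = length \<alpha>s \<and>
     (\<forall>p\<in>set ps. 0 \<le> p) \<and> sum_list ps = 1 \<and>
     \<rho> = (\<Sum>i<length \<alpha>s. ps ! i *\<^sub>R \<alpha>s ! i)"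

text \<open>
  In a sharp theory with purification every normalised state has a diagonalisation, and the notions
  below do not depend on the one that is chosen here; \<open>fun_dagger \<Theta> A f \<rho>\<close> is \<open>f(\<rho>\<^sup>\<dagger>)\<close>.
\<close>

definition some_diagonalisation ::
    "('s, 't::real_normed_vector) opt \<Rightarrow> 's \<Rightarrow> 't \<Rightarrow> real list \<times> 't list" where
  "some_diagonalisation \<Theta> A \<rho> = (SOME (ps, \<alpha>s). diagonalisation \<Theta> A \<rho> ps \<alpha>s)"

definition spectrum :: "('s, 't::real_normed_vector) opt \<Rightarrow> 's \<Rightarrow> 't \<Rightarrow> real list" where
  "spectrum \<Theta> A \<rho> = fst (some_diagonalisation \<Theta> A \<rho>)"

definition eigenstates :: "('s, 't::real_normed_vector) opt \<Rightarrow> 's \<Rightarrow> 't \<Rightarrow> 't list" where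
  "eigenstates \<Theta> A \<rho> = snd (some_diagonalisation \<Theta> A \<rho>)"

definition fun_dagger ::
    "('s, 't::real_normed_vector) opt \<Rightarrow> 's \<Rightarrow> (real \<Rightarrow> real) \<Rightarrow> 't \<Rightarrow> 't" where
  "fun_dagger \<Theta> A f \<rho> = (\<Sum>i<length (eigenstates \<Theta> A \<rho>).
     f (spectrum \<Theta> A \<rho> ! i) *\<^sub>R dagger \<Theta> A (eigenstates \<Theta> A \<rho> ! i))"

text \<open>
  The library convention \<open>ln 0 = 0\<close> implements \<open>0 ln 0 = 0\<close> for the eigenvalues of \<open>\<rho>\<close>. For the second
  argument \<open>\<sigma>\<close> of the relative entropy it is the right convention only if the support of \<open>\<rho>\<close> lies in
  that of \<open>\<sigma>\<close> (the value would otherwise be \<open>\<infinity>\<close>), in particular if \<open>\<sigma>\<close> is a Gibbs state, all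
  eigenvalues of which are positive.
\<close>

definition entropy :: "('s, 't::real_normed_vector) opt \<Rightarrow> 's \<Rightarrow> 't \<Rightarrow> real" where
  "entropy \<Theta> A \<rho> = - (\<Sum>p\<leftarrow>spectrum \<Theta> A \<rho>. p * ln p)"

definition relative_entropy ::
    "('s, 't::real_normed_vector) opt \<Rightarrow> 's \<Rightarrow> 't \<Rightarrow> 't \<Rightarrow> real" where
  "relative_entropy \<Theta> A \<rho> \<sigma> = pairing \<Theta> (fun_dagger \<Theta> A ln \<rho> - fun_dagger \<Theta> A ln \<sigma>) \<rho>"

definition mutual_information ::
    "('s, 't::real_normed_vector) opt \<Rightarrow> 's \<Rightarrow> 's \<Rightarrow> 't \<Rightarrow> real" where
  "mutual_information \<Theta> A B \<rho> = entropy \<Theta> A (marginal1 \<Theta> A B \<rho>) +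
     entropy \<Theta> B (marginal2 \<Theta> A B \<rho>) - entropy \<Theta> (A \<star>\<^bsub>\<Theta>\<^esub> B) \<rho>"

definition gibbs_state ::
    "('s, 't::real_normed_vector) opt \<Rightarrow> 's \<Rightarrow> 't \<Rightarrow> real \<Rightarrow> 't \<Rightarrow> bool" where
  "gibbs_state \<Theta> A H \<beta> \<gamma> \<longleftrightarrow> (\<exists>Es \<phi>s. pure_maximal \<Theta> A \<phi>s \<and> length Es = length \<phi>s \<and>
     H = (\<Sum>i<length \<phi>s. Es ! i *\<^sub>R dagger \<Theta> A (\<phi>s ! i)) \<and>
     (let Z = (\<Sum>i<length \<phi>s. exp (- \<beta> * Es ! i)) in
        \<gamma> = (1 / Z) *\<^sub>R (\<Sum>i<length \<phi>s. exp (- \<beta> * Es ! i) *\<^sub>R \<phi>s ! i)))"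

end

theory Submission
  imports Defs
begin

text \<open>
  The entropic terms collapse to a statement about \<open>\<gamma>\<close> alone: entropy is invariant under \<open>U\<close> and additive on
  products, and \<open>ln \<gamma>\<^sup>\<dagger> = - \<beta> H\<^sub>E - (ln Z) u\<close>. This needs the spectral theory of sharp theories with purification.

  Steering a purification back and forth shows that the largest value on \<open>\<rho>\<close> of a pure effect of
  norm one is also the weight of a pure state in \<open>\<rho>\<close>; splitting off such states one at a time
  diagonalises \<open>\<rho>\<close>, and the same argument gives the uniqueness of \<open>\<alpha>\<^sup>\<dagger>\<close>. The eigenstates are jointly distinguishable
  because an effect that is certain on some states can be measured without disturbing them. A state invariant under
  all reversible channels has the same value \<open>1 / d\<close> for all \<open>\<alpha>\<^sup>\<dagger>\<close>, so pure maximal sets have \<open>d\<close>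
  elements and the matrix \<open>(\<alpha>\<^sub>i\<^sup>\<dagger>|\<delta>\<^sub>j)\<close> between two of them is doubly stochastic. For two diagonalisations
  of one state, equality in the resulting convexity inequality shows that the matrix only connects equal eigenvalues.
\<close>

subsection \<open>Finite-dimensional subspaces\<close>

text \<open>\<open>dagger\<close>, \<open>spectrum\<close> and \<open>fun_dagger\<close> are defined
  by choice, and no spectral fact is among the axioms, so even their being well defined has to come
  out of purity preservation, pure sharpness and purification. Two obstacles shape the argument.
  First, symmetry of the transition probabilities \<open>(\<alpha>\<^sup>\<dagger>|\<delta>)\<close>
  is not established. Normalisation alone makes the columns of a transition matrix sum to one; that
  the rows do so too comes from the invariant state, which is the uniform mixture of every pure
  maximal set. Second, the norm of the ambient space is arbitrary. Boundedness of the
  transformations, and with it compactness, is drawn from experiments, which separate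
  transformations and have values between 0 and 1; extreme points are found with a sum of squares of
  such values in place of the norm. In the final identity the constant \<open>ln Z\<close> occurs
  once in the entropy of \<gamma> and once in the relative entropy, and drops out because both
  environment states are normalised.\<close>

lemma compact_combinations:
  fixes v :: "'i \<Rightarrow> 'a::real_normed_vector"
  assumes "finite I"
  shows "compact {\<Sum>i\<in>I. c i *\<^sub>R v i |c. \<forall>i\<in>I. \<bar>c i\<bar> \<le> K}"
  using assms
proof (induction I)
  case empty
  then show ?case by simp
next
  case (insert j I)
  have c: "compact ((\<lambda>t. t *\<^sub>R v j) ` {-K..K})"
    by (intro compact_continuous_image continuous_intros compact_Icc)
  have "{\<Sum>i\<in>insert j I. c i *\<^sub>R v i |c. \<forall>i\<in>insert j I. \<bar>c i\<bar> \<le> K} =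
      {x + y |x y. x \<in> (\<lambda>t. t *\<^sub>R v j) ` {-K..K} \<and> y \<in> {\<Sum>i\<in>I. c i *\<^sub>R v i |c. \<forall>i\<in>I. \<bar>c i\<bar> \<le> K}}"
    (is "?L = ?R")
  proof
    show "?L \<subseteq> ?R"
    proof
      fix z assume "z \<in> ?L"
      then obtain c where c: "\<forall>i\<in>insert j I. \<bar>c i\<bar> \<le> K" "z = (\<Sum>i\<in>insert j I. c i *\<^sub>R v i)"
        by blast
      then have "c j \<in> {-K..K}" "z = c j *\<^sub>R v j + (\<Sum>i\<in>I. c i *\<^sub>R v i)"
        using insert.hyps by (auto simp: abs_le_iff)
      then show "z \<in> ?R" using c(1) by blast
    qed
    show "?R \<subseteq> ?L"
    proof
      fix z assume "z \<in> ?R"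
      then obtain t c where "t \<in> {-K..K}" and c: "\<forall>i\<in>I. \<bar>c i\<bar> \<le> K"
        and z: "z = t *\<^sub>R v j + (\<Sum>i\<in>I. c i *\<^sub>R v i)" by blast
      then have t: "\<bar>t\<bar> \<le> K" by (simp add: abs_le_iff)
      have "(\<Sum>i\<in>I. c i *\<^sub>R v i) = (\<Sum>i\<in>I. (c(j := t)) i *\<^sub>R v i)"
        using insert.hyps by (intro sum.cong) auto
      then have "z = (\<Sum>i\<in>insert j I. (c(j := t)) i *\<^sub>R v i)"
        using insert.hyps z by simp
      moreover have "\<forall>i\<in>insert j I. \<bar>(c(j := t)) i\<bar> \<le> K" using t c by auto
      ultimately show "z \<in> ?L" by blast
    qed
  qed
  then show ?case using compact_sums[OF c insert.IH] by simp
qed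

text \<open>A convergent sequence is bounded, so by the coefficient bound all its terms lie in one
  compact set of combinations, which then contains the limit.\<close>

lemma span_finite_closed:
  fixes F :: "'a::real_normed_vector set"
  assumes "finite F" and C: "\<And>c b. b \<in> F \<Longrightarrow> \<bar>c b\<bar> \<le> C * norm (\<Sum>b\<in>F. c b *\<^sub>R b)" and "C \<ge> 0"
  shows "closed (span F)"
proof -
  have "l \<in> span F" if x: "\<And>n. x n \<in> span F" and l: "x \<longlonglongrightarrow> l" for x l
  proof -
    obtain M where M: "\<And>n. norm (x n) \<le> M"
      using l by (metis BseqE convergentI convergent_imp_Bseq)
    let ?K = "{\<Sum>b\<in>F. c b *\<^sub>R b |c. \<forall>b\<in>F. \<bar>c b\<bar> \<le> C * M}"
    have "x n \<in> ?K" for n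
    proof -
      obtain c where c: "x n = (\<Sum>b\<in>F. c b *\<^sub>R b)"
        using x[of n] by (auto simp: span_finite[OF \<open>finite F\<close>])
      have "\<bar>c b\<bar> \<le> C * M" if "b \<in> F" for b
        using C[OF that, of c] M[of n] c mult_left_mono[OF M[of n] \<open>C \<ge> 0\<close>] by simp
      then show ?thesis using c by blast
    qed
    moreover have "closed ?K"
      using compact_imp_closed compact_combinations[OF \<open>finite F\<close>, of "\<lambda>b. b"] by blast
    ultimately have "l \<in> ?K" using closed_sequentially l by blast
    then show ?thesis by (auto intro: span_sum span_scale span_base)
  qed
  then show ?thesis unfolding closed_sequential_limits by blast
qed

text \<open>The bound and the closedness of the span are obtained by a joint induction: the span of
  the old vectors is closed by the bound already available, so the new vector \<open>a\<close> has a
  positive distance \<delta> from it, and this distance controls the coefficient of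
  \<open>a\<close>.\<close>

lemma independent_coefficients_bounded:
  fixes F :: "'a::real_normed_vector set"
  assumes "finite F" "independent F"
  shows "\<exists>C\<ge>0. \<forall>c. \<forall>b\<in>F. \<bar>c b\<bar> \<le> C * norm (\<Sum>b\<in>F. c b *\<^sub>R b)"
  using assms
proof (induction F)
  case empty
  then show ?case by auto
next
  case (insert a F)
  then have aF: "a \<notin> span F" and iF: "independent F" by (simp_all add: independent_insert)
  obtain C where C: "C \<ge> 0" "\<And>c b. b \<in> F \<Longrightarrow> \<bar>c b\<bar> \<le> C * norm (\<Sum>b\<in>F. c b *\<^sub>R b)"
    using insert.IH[OF iF] by blast
  have "closed (span F)" by (rule span_finite_closed[OF insert.hyps(1) C(2) C(1)])
  then obtain \<delta> where "\<delta> > 0" and "ball a \<delta> \<subseteq> - span F"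
    using aF open_contains_ball[of "- span F"] by (auto simp: open_Compl)
  then have \<delta>: "\<delta> > 0" "\<And>y. y \<in> span F \<Longrightarrow> \<delta> \<le> dist a y"
    by (auto simp: subset_iff not_less[symmetric])
  \<comment> \<open>Removing the multiple of \<open>a\<close> from a vector enlarges its norm at
    most by the factor \<open>1 + norm a / \<delta>\<close>, and \<open>C\<close> bounds the
    coefficients of what remains.\<close>
  define D where "D = C * (1 + norm a / \<delta>)"
  have "D \<ge> 0" using C(1) \<delta>(1) by (simp add: D_def)
  have "\<bar>c b\<bar> \<le> (1 / \<delta> + D) * norm (\<Sum>b\<in>insert a F. c b *\<^sub>R b)" if b: "b \<in> insert a F" for c b
  proof -
    let ?y = "\<Sum>b\<in>F. c b *\<^sub>R b"
    let ?x = "\<Sum>b\<in>insert a F. c b *\<^sub>R b"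
    have x: "?x = c a *\<^sub>R a + ?y" using insert.hyps by simp
    have y: "?y \<in> span F" by (auto intro: span_sum span_scale span_base)
    have ca: "\<bar>c a\<bar> * \<delta> \<le> norm ?x"
    proof (cases "c a = 0")
      case False
      have "\<delta> \<le> norm (a + (1 / c a) *\<^sub>R ?y)"
        using \<delta>(2)[of "- (1 / c a) *\<^sub>R ?y"] y by (simp add: dist_norm span_neg span_scale)
      then have "\<bar>c a\<bar> * \<delta> \<le> norm (c a *\<^sub>R (a + (1 / c a) *\<^sub>R ?y))"
        by (simp add: mult_left_mono)
      also have "c a *\<^sub>R (a + (1 / c a) *\<^sub>R ?y) = ?x"
        using False by (simp add: x scaleR_add_right)
      finally show ?thesis .
    qed simp
    then have ca': "\<bar>c a\<bar> \<le> norm ?x / \<delta>" using \<delta>(1) by (simp add: field_simps)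
    have "norm ?y = norm (?x - c a *\<^sub>R a)" using x by simp
    also have "\<dots> \<le> norm ?x + \<bar>c a\<bar> * norm a" by (metis norm_scaleR norm_triangle_ineq4)
    also have "\<dots> \<le> norm ?x + norm ?x / \<delta> * norm a" using mult_right_mono[OF ca', of "norm a"] by simp
    finally have ny: "norm ?y \<le> (1 + norm a / \<delta>) * norm ?x" by (simp add: algebra_simps)
    show ?thesis
    proof (cases "b = a")
      case True
      then show ?thesis using ca' \<open>D \<ge> 0\<close> by (simp add: distrib_right add_increasing2)
    next
      case False
      then have "\<bar>c b\<bar> \<le> C * norm ?y" using C(2) b by blast
      also have "\<dots> \<le> D * norm ?x" using ny C(1) by (simp add: D_def mult_left_mono mult.assoc)
      also have "\<dots> \<le> (1 / \<delta> + D) * norm ?x" using \<delta>(1) by (simp add: mult_right_mono)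
      finally show ?thesis .
    qed
  qed
  moreover have "1 / \<delta> + D \<ge> 0" using \<open>D \<ge> 0\<close> \<delta>(1) by simp
  ultimately show ?case by blast
qed

text \<open>A linear map on the whole space may be discontinuous there, as may the functional
  \<open>scal\<close> obtained below from a basis extension. Bounded coefficients make it Lipschitz
  on every finite-dimensional span, where all transformations of given type lie.\<close>

lemma linear_continuous_on_span_finite:
  fixes \<phi> :: "'a::real_normed_vector \<Rightarrow> 'b::real_normed_vector"
  assumes "finite F" "linear \<phi>"
  shows "continuous_on (span F) \<phi>"
proof -
  obtain B where B: "B \<subseteq> F" "independent B" "F \<subseteq> span B"
    using maximal_independent_subset by blast
  have fB: "finite B" using B(1) assms(1) by (rule finite_subset)
  have sB: "span F = span B" unfolding span_eq using B by (auto intro: span_base)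
  obtain C where C: "C \<ge> 0" "\<And>c b. b \<in> B \<Longrightarrow> \<bar>c b\<bar> \<le> C * norm (\<Sum>b\<in>B. c b *\<^sub>R b)"
    using independent_coefficients_bounded[OF fB B(2)] by blast
  define D where "D = (\<Sum>b\<in>B. C * norm (\<phi> b))"
  have bound: "norm (\<phi> x) \<le> D * norm x" if "x \<in> span F" for x
  proof -
    have "x \<in> range (\<lambda>c. \<Sum>b\<in>B. c b *\<^sub>R b)"
      using that unfolding sB span_finite[OF fB] .
    then obtain c where c: "x = (\<Sum>b\<in>B. c b *\<^sub>R b)" by (rule rangeE) (rule that)
    have "norm (\<phi> x) = norm (\<Sum>b\<in>B. c b *\<^sub>R \<phi> b)"
      by (simp add: c linear_sum[OF assms(2)] linear_cmul[OF assms(2)])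
    also have "\<dots> \<le> (\<Sum>b\<in>B. \<bar>c b\<bar> * norm (\<phi> b))" by (simp add: sum_norm_le)
    also have "\<dots> \<le> (\<Sum>b\<in>B. C * norm x * norm (\<phi> b))"
      using C(2) c by (intro sum_mono mult_right_mono) auto
    also have "\<dots> = D * norm x" by (simp add: D_def sum_distrib_right sum_distrib_left algebra_simps)
    finally show ?thesis .
  qed
  have "D \<ge> 0" unfolding D_def using C(1) by (simp add: sum_nonneg)
  then have "D-lipschitz_on (span F) \<phi>"
  proof (intro lipschitz_onI)
    fix x y assume "x \<in> span F" "y \<in> span F"
    then show "dist (\<phi> x) (\<phi> y) \<le> D * dist x y"
      using bound[of "x - y"] by (simp add: dist_norm span_diff linear_diff[OF assms(2)])
  qed
  then show ?thesis by (rule lipschitz_on_continuous_on)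
qed

text \<open>Each chosen functional cuts \<open>V\<close> down to its kernel, on which the remaining
  ones still separate; a basis of the kernel can be enlarged by a vector outside it, so the
  dimension drops. The point is that the coordinates are themselves members of \<Phi> and inherit
  whatever bounds hold there.\<close>

lemma expansion_by_separating_functionals:
  fixes V :: "'a::real_vector set" and \<Phi> :: "('a \<Rightarrow> real) set"
  assumes "subspace V" "finite F" "V \<subseteq> span F" "\<And>\<phi>. \<phi> \<in> \<Phi> \<Longrightarrow> linear \<phi>"
    and "\<And>x. x \<in> V \<Longrightarrow> (\<And>\<phi>. \<phi> \<in> \<Phi> \<Longrightarrow> \<phi> x = 0) \<Longrightarrow> x = 0"
  shows "\<exists>(n::nat) \<phi> v. (\<forall>i<n. \<phi> i \<in> \<Phi>) \<and> (\<forall>x\<in>V. x = (\<Sum>i<n. \<phi> i x *\<^sub>R v i))"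
  using assms
proof (induction "card F" arbitrary: V F rule: less_induct)
  case less
  show ?case
  proof (cases "V \<subseteq> {0}")
    case True
    then show ?thesis by (intro exI[of _ 0]) auto
  next
    case False
    then obtain a \<psi> where a: "a \<in> V" and \<psi>: "\<psi> \<in> \<Phi>" "\<psi> a \<noteq> 0" using less.prems(5) by blast
    define b where "b = (1 / \<psi> a) *\<^sub>R a"
    have lin: "linear \<psi>" using less.prems(4) \<psi>(1) by blast
    have b: "b \<in> V" "\<psi> b = 1"
      using a less.prems(1) \<psi>(2) by (simp_all add: b_def subspace_scale linear_cmul[OF lin])
    let ?V = "{x \<in> V. \<psi> x = 0}"
    have sub: "subspace ?V"
      using less.prems(1) lin
      by (auto simp: subspace_def linear_0 linear_add linear_cmul)
    obtain B where B: "B \<subseteq> ?V" "independent B" "?V \<subseteq> span B"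
      using maximal_independent_subset by blast
    have "span B \<subseteq> ?V" using B(1) sub by (simp add: span_minimal)
    then have "b \<notin> span B" using b(2) by auto
    then have ib: "independent (insert b B)" and nb: "b \<notin> B"
      using B(2) by (auto simp: independent_insert span_base)
    have "insert b B \<subseteq> span F" using B(1) b(1) less.prems(3) by auto
    then have fin: "finite (insert b B) \<and> card (insert b B) \<le> card F"
      by (rule independent_span_bound[OF less.prems(2) ib])
    then have "card B < card F" using fin nb by (auto simp: card_insert_if)
    have "\<exists>(n::nat) \<phi> v. (\<forall>i<n. \<phi> i \<in> \<Phi>) \<and> (\<forall>x\<in>?V. x = (\<Sum>i<n. \<phi> i x *\<^sub>R v i))"
    proof (rule less.hyps[OF \<open>card B < card F\<close> sub _ B(3) less.prems(4)])
      show "finite B" using fin by simp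
      show "x = 0" if "x \<in> ?V" "\<And>\<phi>. \<phi> \<in> \<Phi> \<Longrightarrow> \<phi> x = 0" for x
        using less.prems(5)[of x] that by simp
    qed
    then obtain n :: nat and \<phi> v where n: "\<And>i. i < n \<Longrightarrow> \<phi> i \<in> \<Phi>"
        "\<And>x. x \<in> ?V \<Longrightarrow> x = (\<Sum>i<n. \<phi> i x *\<^sub>R v i)"
      by metis
    \<comment> \<open>The expansion on the kernel is applied to
      \<open>x - \<psi> x *\<^sub>R b\<close>; this is the vector that multiplies
      \<open>\<psi> x\<close> once the terms are collected.\<close>
    define b' where "b' = b - (\<Sum>i<n. \<phi> i b *\<^sub>R v i)"
    have "x = (\<Sum>i<Suc n. (\<phi>(n := \<psi>)) i x *\<^sub>R (v(n := b')) i)" if "x \<in> V" for x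
    proof -
      have "x - \<psi> x *\<^sub>R b \<in> ?V"
        using that b less.prems(1)
        by (auto simp: subspace_diff subspace_scale linear_diff[OF lin] linear_cmul[OF lin])
      then have "x - \<psi> x *\<^sub>R b = (\<Sum>i<n. \<phi> i (x - \<psi> x *\<^sub>R b) *\<^sub>R v i)" by (rule n(2))
      also have "\<dots> = (\<Sum>i<n. \<phi> i x *\<^sub>R v i - \<psi> x *\<^sub>R (\<phi> i b *\<^sub>R v i))"
        using n(1) less.prems(4)
        by (intro sum.cong) (auto simp: linear_diff linear_cmul scaleR_diff_left)
      finally have "x = \<psi> x *\<^sub>R b' + (\<Sum>i<n. \<phi> i x *\<^sub>R v i)"
        by (simp add: b'_def sum_subtractf scaleR_diff_right scaleR_sum_right algebra_simps)
      moreover have "(\<Sum>i<Suc n. (\<phi>(n := \<psi>)) i x *\<^sub>R (v(n := b')) i) = \<psi> x *\<^sub>R b' + (\<Sum>i<n. \<phi> i x *\<^sub>R v i)"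
        by simp
      ultimately show ?thesis by (rule trans[OF _ sym])
    qed
    moreover have "\<forall>i<Suc n. (\<phi>(n := \<psi>)) i \<in> \<Phi>" using n(1) \<psi>(1) by (simp add: less_Suc_eq)
    ultimately show ?thesis by blast
  qed
qed

text \<open>Neither matrix needs to be the transpose of the other: \<open>p = M q\<close> gives \<open>\<Sum> p\<^sup>2 \<le> \<Sum> q\<^sup>2\<close>, the
  difference being the sum below, and \<open>q = M' p\<close> gives the reverse inequality.\<close>

lemma doubly_stochastic_variance:
  fixes M :: "nat \<Rightarrow> nat \<Rightarrow> real"
  assumes "\<And>i. i < n \<Longrightarrow> (\<Sum>j<n. M i j) = 1" "\<And>j. j < n \<Longrightarrow> (\<Sum>i<n. M i j) = 1"
    and "\<And>i. i < n \<Longrightarrow> p i = (\<Sum>j<n. M i j * q j)"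
  shows "(\<Sum>i<n. \<Sum>j<n. M i j * (q j - p i)\<^sup>2) = (\<Sum>j<n. (q j)\<^sup>2) - (\<Sum>i<n. (p i)\<^sup>2)"
proof -
  have "(\<Sum>j<n. M i j * (q j - p i)\<^sup>2) = (\<Sum>j<n. M i j * (q j)\<^sup>2) - (p i)\<^sup>2" if i: "i < n" for i
  proof -
    have "(\<Sum>j<n. M i j * (q j - p i)\<^sup>2) =
        (\<Sum>j<n. M i j * (q j)\<^sup>2 - 2 * p i * (M i j * q j) + (p i)\<^sup>2 * M i j)"
      by (intro sum.cong refl) (simp add: power2_eq_square algebra_simps)
    also have "\<dots> = (\<Sum>j<n. M i j * (q j)\<^sup>2) - 2 * p i * (\<Sum>j<n. M i j * q j) + (p i)\<^sup>2 * (\<Sum>j<n. M i j)"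
      by (simp add: sum.distrib sum_subtractf sum_distrib_left)
    also have "\<dots> = (\<Sum>j<n. M i j * (q j)\<^sup>2) - (p i)\<^sup>2"
      using assms(1)[OF i] assms(3)[OF i] by (simp add: power2_eq_square)
    finally show ?thesis .
  qed
  then have "(\<Sum>i<n. \<Sum>j<n. M i j * (q j - p i)\<^sup>2) = (\<Sum>i<n. \<Sum>j<n. M i j * (q j)\<^sup>2) - (\<Sum>i<n. (p i)\<^sup>2)"
    by (simp add: sum_subtractf)
  also have "(\<Sum>i<n. \<Sum>j<n. M i j * (q j)\<^sup>2) = (\<Sum>j<n. (\<Sum>i<n. M i j) * (q j)\<^sup>2)"
    by (subst sum.swap) (simp add: sum_distrib_right)
  also have "\<dots> = (\<Sum>j<n. (q j)\<^sup>2)" using assms(2) by simp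
  finally show ?thesis .
qed

section \<open>Composition of transformations, tests and channels\<close>

context causal_opt
begin

abbreviation idn ("\<I>") where "\<I> \<equiv> ident \<Theta>"
abbreviation "Tests \<equiv> tests \<Theta>"
abbreviation "Tr \<equiv> transf \<Theta>"
abbreviation "St \<equiv> states \<Theta>"
abbreviation "Eff \<equiv> effects \<Theta>"
abbreviation "u \<equiv> discard \<Theta>"
abbreviation "normal \<equiv> normalised_state \<Theta>"

lemma seq_linear_right: "linear (seq \<Theta> f)" and seq_linear_left: "linear (\<lambda>f. f \<odot> g)"
  using seq_bilinear by (simp_all add: bilinear_def)

lemma par_linear_right: "linear (par \<Theta> f)" and par_linear_left: "linear (\<lambda>f. f \<otimes> g)"
  using par_bilinear by (simp_all add: bilinear_def)

lemmas seq_scale [simp] = linear_cmul[OF seq_linear_right] linear_cmul[OF seq_linear_left]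
lemmas par_scale [simp] = linear_cmul[OF par_linear_right] linear_cmul[OF par_linear_left]
lemmas seq_zero [simp] = linear_0[OF seq_linear_right] linear_0[OF seq_linear_left]
lemmas par_zero [simp] = linear_0[OF par_linear_right] linear_0[OF par_linear_left]
lemmas seq_add = linear_add[OF seq_linear_right] linear_add[OF seq_linear_left]
lemmas par_add = linear_add[OF par_linear_right] linear_add[OF par_linear_left]
lemmas seq_diff = linear_diff[OF seq_linear_right] linear_diff[OF seq_linear_left]
lemmas par_diff = linear_diff[OF par_linear_right] linear_diff[OF par_linear_left]
lemmas seq_sum = linear_sum[OF seq_linear_right] linear_sum[OF seq_linear_left]
lemma transfI: "Cs \<in> Tests A B \<Longrightarrow> C \<in> set Cs \<Longrightarrow> C \<in> Tr A B"
  by (auto simp: transf_def)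

lemma transfE:
  assumes "C \<in> Tr A B"
  obtains Cs where "Cs \<in> Tests A B" "C \<in> set Cs"
  using assms by (auto simp: transf_def)

lemma ident_transf [simp]: "\<I> A \<in> Tr A A"
  using transfI[OF ident_test] by simp

lemma swap_transf [simp]: "swp \<Theta> A B \<in> Tr (A \<star> B) (B \<star> A)"
  using transfI[OF swap_test] by simp

lemma tests_seq:
  assumes "Cs \<in> Tests A B" "Ds \<in> Tests B C"
  shows "concat (map (\<lambda>C. map (\<lambda>D. D \<odot> C) Ds) Cs) \<in> Tests A C"
proof -
  have "map2 (\<lambda>C Ds. map (\<lambda>D. D \<odot> C) Ds) Cs (replicate (length Cs) Ds) = map (\<lambda>C. map (\<lambda>D. D \<odot> C) Ds) Cs"
    by (induction Cs) auto
  then show ?thesis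
    using conditional[OF assms(1), of "replicate (length Cs) Ds"] assms(2) by simp
qed

lemma transf_seq: "f \<in> Tr A B \<Longrightarrow> g \<in> Tr B C \<Longrightarrow> g \<odot> f \<in> Tr A C"
  by (elim transfE, rule transfI[OF tests_seq]) auto

lemma transf_par: "f \<in> Tr A B \<Longrightarrow> g \<in> Tr A' B' \<Longrightarrow> f \<otimes> g \<in> Tr (A \<star> A') (B \<star> B')"
  by (elim transfE, rule transfI[OF parallel]) auto

lemma tests_post: "Ds \<in> Tests A B \<Longrightarrow> [V] \<in> Tests B C \<Longrightarrow> map (\<lambda>D. V \<odot> D) Ds \<in> Tests A C"
  using tests_seq[of Ds A B "[V]" C] by (simp add: concat_map_singleton)

lemma tests_pre: "[V] \<in> Tests A B \<Longrightarrow> Ds \<in> Tests B C \<Longrightarrow> map (\<lambda>D. D \<odot> V) Ds \<in> Tests A C"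
  using tests_seq[of "[V]" A B Ds C] by simp

lemma tests_par_right: "Ds \<in> Tests A B \<Longrightarrow> map (\<lambda>D. D \<otimes> \<I> R) Ds \<in> Tests (A \<star> R) (B \<star> R)"
  using parallel[of Ds A B, OF _ ident_test, of R] by (simp add: concat_map_singleton)

lemma channel_transf: "channel \<Theta> A B f \<Longrightarrow> f \<in> Tr A B"
  by (auto simp: channel_def intro: transfI)

lemma channel_seq: "channel \<Theta> A B f \<Longrightarrow> channel \<Theta> B C g \<Longrightarrow> channel \<Theta> A C (g \<odot> f)"
  unfolding channel_def using tests_post[of "[f]"] by simp

lemma channel_par: "channel \<Theta> A B f \<Longrightarrow> channel \<Theta> A' B' g \<Longrightarrow> channel \<Theta> (A \<star> A') (B \<star> B') (f \<otimes> g)"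
  unfolding channel_def using parallel[of "[f]" A B "[g]"] by simp

lemma channel_ident [simp]: "channel \<Theta> A A (\<I> A)" and channel_swap [simp]: "channel \<Theta> (A \<star> B) (B \<star> A) (swp \<Theta> A B)"
  by (simp_all add: channel_def ident_test swap_test)

subsection \<open>Scalars and the pairing\<close>

lemma scalar_transf_iff: "x \<in> Tr \<one> \<one> \<longleftrightarrow> (\<exists>p\<in>{0..1}. x = p *\<^sub>R \<I> \<one>)"
proof
  assume "x \<in> Tr \<one> \<one>"
  then obtain ps p where p: "\<forall>p\<in>set ps. 0 \<le> p" "sum_list ps = 1" "p \<in> set ps" "x = p *\<^sub>R \<I> \<one>"
    by (auto simp: transf_def scalar_tests)
  have "p \<le> sum_list ps" using p(1,3) by (intro member_le_sum_list) auto
  then show "\<exists>p\<in>{0..1}. x = p *\<^sub>R \<I> \<one>" using p by auto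
next
  assume "\<exists>p\<in>{0..1}. x = p *\<^sub>R \<I> \<one>"
  then obtain p where p: "0 \<le> p" "p \<le> 1" "x = p *\<^sub>R \<I> \<one>" by auto
  have "map (\<lambda>p. p *\<^sub>R \<I> \<one>) [p, 1 - p] \<in> Tests \<one> \<one>"
    unfolding scalar_tests using p by (intro CollectI exI[of _ "[p, 1 - p]"]) auto
  then show "x \<in> Tr \<one> \<one>" by (rule transfI) (simp add: p)
qed

text \<open>A linear extension of the identification of scalars with numbers to all of \<^typ>\<open>'t\<close>, so that
  \<open>ev\<close> below is bilinear without side conditions.\<close>

definition scal :: "'t \<Rightarrow> real" where
  "scal = (SOME \<phi>. linear \<phi> \<and> \<phi> (\<I> \<one>) = 1)"

lemma scal: "linear scal" "scal (\<I> \<one>) = 1"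
proof -
  have "independent {\<I> \<one>}" using scalar_nontrivial by simp
  then have "\<exists>\<phi>::'t \<Rightarrow> real. linear \<phi> \<and> (\<forall>x\<in>{\<I> \<one>}. \<phi> x = 1)"
    by (rule linear_independent_extend)
  then have "\<exists>\<phi>::'t \<Rightarrow> real. linear \<phi> \<and> \<phi> (\<I> \<one>) = 1" by simp
  from someI_ex[OF this] show "linear scal" "scal (\<I> \<one>) = 1" unfolding scal_def by blast+
qed

definition ev :: "'t \<Rightarrow> 't \<Rightarrow> real" where
  "ev a x = scal (a \<odot> x)"

lemma ev_linear_right: "linear (ev a)"
  unfolding ev_def using linear_compose[OF seq_linear_right scal(1)] by (simp add: o_def)

lemma ev_linear_left: "linear (\<lambda>a. ev a x)"
  unfolding ev_def using linear_compose[OF seq_linear_left scal(1)] by (simp add: o_def)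

lemmas ev_scale [simp] = linear_cmul[OF ev_linear_right] linear_cmul[OF ev_linear_left]
lemmas ev_zero [simp] = linear_0[OF ev_linear_right] linear_0[OF ev_linear_left]
lemmas ev_add = linear_add[OF ev_linear_right] linear_add[OF ev_linear_left]
lemmas ev_diff = linear_diff[OF ev_linear_right] linear_diff[OF ev_linear_left]
lemmas ev_sum = linear_sum[OF ev_linear_right] linear_sum[OF ev_linear_left]

lemma seq_eq_ev:
  assumes "a \<in> Eff A" "x \<in> St A"
  shows "a \<odot> x = ev a x *\<^sub>R \<I> \<one>"
proof -
  have "a \<odot> x \<in> Tr \<one> \<one>" using assms transf_seq by (simp add: states_def effects_def)
  then obtain p where "a \<odot> x = p *\<^sub>R \<I> \<one>" using scalar_transf_iff by blast
  then show ?thesis by (simp add: ev_def linear_cmul[OF scal(1)] scal(2))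
qed

lemma ev_bounds:
  assumes "a \<in> Eff A" "x \<in> St A"
  shows "0 \<le> ev a x" "ev a x \<le> 1"
proof -
  have "a \<odot> x \<in> Tr \<one> \<one>" using assms transf_seq by (simp add: states_def effects_def)
  then obtain p where "p \<in> {0..1}" "a \<odot> x = p *\<^sub>R \<I> \<one>" using scalar_transf_iff by blast
  then show "0 \<le> ev a x" "ev a x \<le> 1" by (simp_all add: ev_def linear_cmul[OF scal(1)] scal(2))
qed

text \<open>\<open>pairing\<close> is a definite description, whereas \<open>ev\<close> is bilinear
  without side conditions; the two are identified along the span, so that all later computations can
  use \<open>ev\<close>.\<close>

lemma pairing_eq_ev:
  assumes "a \<in> span (Eff A)" "x \<in> St A"
  shows "pairing \<Theta> a x = ev a x"
proof -
  have "a \<odot> x = ev a x *\<^sub>R \<I> \<one>"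
    using assms(1)
  proof (induction a rule: span_induct_alt)
    case base
    then show ?case by simp
  next
    case (step c b y)
    then show ?case using assms(2) by (simp add: seq_add ev_add seq_eq_ev algebra_simps)
  qed
  then show ?thesis
    unfolding pairing_def using scalar_nontrivial by (intro the_equality) auto
qed

lemma pairing_effect: "a \<in> Eff A \<Longrightarrow> x \<in> St A \<Longrightarrow> pairing \<Theta> a x = ev a x"
  by (rule pairing_eq_ev) (auto intro: span_base)

subsection \<open>Randomisation and coarse-graining\<close>

lemma tests_scaled_ident:
  assumes "\<And>p. p \<in> set ps \<Longrightarrow> 0 \<le> p" "sum_list ps = 1"
  shows "map (\<lambda>p. p *\<^sub>R \<I> A) ps \<in> Tests A A"
proof -
  have "map (\<lambda>p. p *\<^sub>R \<I> \<one>) ps \<in> Tests \<one> \<one>" unfolding scalar_tests using assms by blast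
  from tests_par_right[OF this, of A]
  show ?thesis by (simp add: o_def par_unit(2)[OF ident_transf] composite_unit)
qed

lemma tests_randomised:
  assumes "\<And>p. p \<in> set ps \<Longrightarrow> 0 \<le> p" "sum_list ps = 1" "length Dss = length ps"
    and "\<And>Ds. Ds \<in> set Dss \<Longrightarrow> Ds \<in> Tests A B"
  shows "concat (map2 (\<lambda>p. map (\<lambda>D. p *\<^sub>R D)) ps Dss) \<in> Tests A B"
proof -
  have "concat (map2 (\<lambda>C. map (\<lambda>D. D \<odot> C)) (map (\<lambda>p. p *\<^sub>R \<I> A) ps) Dss) \<in> Tests A B"
    using assms by (intro conditional[OF tests_scaled_ident]) auto
  moreover have "map2 (\<lambda>C. map (\<lambda>D. D \<odot> C)) (map (\<lambda>p. p *\<^sub>R \<I> A) ps) Dss = map2 (\<lambda>p. map (\<lambda>D. p *\<^sub>R D)) ps Dss"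
  proof -
    have "D \<odot> \<I> A = D" if "i < length ps" "D \<in> set (Dss ! i)" for i D
      using seq_ident(1)[OF transfI, of "Dss ! i" A B D] assms(3,4) that by simp
    then show ?thesis using assms(3) by (auto simp: list_eq_iff_nth_eq)
  qed
  ultimately show ?thesis by simp
qed

text \<open>Randomising between the test with probability one and \<open>m\<close> further copies
  with probability zero appends outcomes that never occur.\<close>

lemma tests_pad:
  assumes "Cs \<in> Tests A B"
  shows "Cs @ replicate (m * length Cs) 0 \<in> Tests A B"
proof -
  have "concat (map2 (\<lambda>p. map (\<lambda>D. p *\<^sub>R D)) (1 # replicate m 0) (replicate (Suc m) Cs)) \<in> Tests A B"
    using assms by (intro tests_randomised) (auto simp: sum_list_replicate)
  moreover have "concat (map2 (\<lambda>p. map (\<lambda>D. p *\<^sub>R D)) (replicate m 0) (replicate m Cs)) = replicate (m * length Cs) 0"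
  proof -
    have "map ((*\<^sub>R) 0) Cs = replicate (length Cs) (0::'t)" by (induction Cs) auto
    then show ?thesis by (induction m) (auto simp: replicate_add)
  qed
  moreover have "map ((*\<^sub>R) 1) Cs = Cs" by (simp add: map_idI)
  ultimately show ?thesis by simp
qed

text \<open>In the axiom the map \<open>q\<close> has to be onto, so blocks cannot be empty. Padding
  by outcomes that never occur provides members for the empty blocks without changing any
  sum.\<close>

lemma coarse_grain:
  assumes Cs: "Cs \<in> Tests A B" "Cs \<noteq> []" and q: "\<And>i. i < length Cs \<Longrightarrow> q i < m"
  shows "map (\<lambda>j. \<Sum>i | i < length Cs \<and> q i = j. Cs ! i) [0..<m] \<in> Tests A B"
proof -
  let ?n = "length Cs" and ?Ds = "Cs @ replicate (m * length Cs) 0"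
  \<comment> \<open>The padding is spread cyclically over the labels; it has at least
    \<open>m\<close> members because \<open>Cs\<close> is nonempty, so every label is hit.\<close>
  define r where "r i = (if i < ?n then q i else (i - ?n) mod m)" for i
  have "m > 0" using q[of 0] Cs(2) by (cases m) auto
  have len: "length ?Ds = ?n + m * ?n" by simp
  have "m \<le> m * ?n" using Cs(2) by (cases Cs) auto
  have "r ` {..<length ?Ds} = {..<m}"
  proof
    show "r ` {..<length ?Ds} \<subseteq> {..<m}" using q \<open>m > 0\<close> by (auto simp: r_def)
    show "{..<m} \<subseteq> r ` {..<length ?Ds}"
    proof
      fix j assume "j \<in> {..<m}"
      then have "r (?n + j) = j" by (auto simp: r_def)
      moreover have "?n + j < length ?Ds"
        unfolding len using \<open>j \<in> {..<m}\<close> \<open>m \<le> m * ?n\<close> by (simp only: lessThan_iff)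
      ultimately show "j \<in> r ` {..<length ?Ds}" by (metis imageI lessThan_iff)
    qed
  qed
  from coarse_graining[OF tests_pad[OF Cs(1)] this]
  have "map (\<lambda>j. \<Sum>i | i < length ?Ds \<and> r i = j. ?Ds ! i) [0..<m] \<in> Tests A B" .
  moreover have "(\<Sum>i | i < length ?Ds \<and> r i = j. ?Ds ! i) = (\<Sum>i | i < ?n \<and> q i = j. Cs ! i)" for j
    by (rule sum.mono_neutral_cong_right) (auto simp: r_def nth_append)
  ultimately show ?thesis by simp
qed

text \<open>The three outcomes are one member of a decomposition, the rest of the decomposition, and
  everything outside it. Purity can therefore be tested on three-outcome tests alone.\<close>

lemma coarse_grain3:
  assumes Cs: "Cs \<in> Tests A B" and X: "X \<subseteq> {..<length Cs}" "i \<in> X"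
  shows "[Cs ! i, \<Sum>j\<in>X - {i}. Cs ! j, \<Sum>j\<in>{..<length Cs} - X. Cs ! j] \<in> Tests A B"
proof -
  define q :: "nat \<Rightarrow> nat" where "q j = (if j = i then 0 else if j \<in> X then 1 else 2)" for j
  have "Cs \<noteq> []" using X by auto
  then have "map (\<lambda>j. \<Sum>i | i < length Cs \<and> q i = j. Cs ! i) [0..<3] \<in> Tests A B"
    by (intro coarse_grain[OF Cs]) (auto simp: q_def)
  moreover have "{j. j < length Cs \<and> q j = 0} = {i}" "{j. j < length Cs \<and> q j = 1} = X - {i}"
      "{j. j < length Cs \<and> q j = 2} = {..<length Cs} - X"
    using X by (auto simp: q_def)
  ultimately show ?thesis by (simp add: upt_rec numeral_3_eq_3 numeral_2_eq_2)
qed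

lemma coarse_grain_total:
  assumes "Cs \<in> Tests A B" "Cs \<noteq> []"
  shows "[sum_list Cs] \<in> Tests A B"
  using coarse_grain[OF assms, of "\<lambda>_. 0" 1]
  by (simp add: sum_list_sum_nth atLeast0LessThan lessThan_def)

lemma coarse_grain_last:
  assumes "Cs @ [a, b] \<in> Tests A B"
  shows "Cs @ [a + b] \<in> Tests A B"
proof -
  let ?n = "length Cs"
  have "map (\<lambda>j. \<Sum>i | i < length (Cs @ [a, b]) \<and> min i ?n = j. (Cs @ [a, b]) ! i) [0..<Suc ?n] \<in> Tests A B"
    by (rule coarse_grain[OF assms]) auto
  moreover have "map (\<lambda>j. \<Sum>i | i < length (Cs @ [a, b]) \<and> min i ?n = j. (Cs @ [a, b]) ! i) [0..<?n] = Cs"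
  proof (rule nth_equalityI)
    fix j assume "j < length (map (\<lambda>j. \<Sum>i | i < length (Cs @ [a, b]) \<and> min i ?n = j. (Cs @ [a, b]) ! i) [0..<?n])"
    then have j: "j < ?n" by simp
    then have "{i. i < length (Cs @ [a, b]) \<and> min i ?n = j} = {j}" by auto
    then show "map (\<lambda>j. \<Sum>i | i < length (Cs @ [a, b]) \<and> min i ?n = j. (Cs @ [a, b]) ! i) [0..<?n] ! j = Cs ! j"
      using j by (simp add: nth_append)
  qed simp
  moreover have "{i. i < length (Cs @ [a, b]) \<and> min i ?n = ?n} = {?n, Suc ?n}" by auto
  ultimately show ?thesis by (simp add: nth_append)
qed

lemma transf_test3:
  assumes "C \<in> Tr A B"
  obtains E where "[C, 0, E] \<in> Tests A B"
proof -
  obtain Cs i where "Cs \<in> Tests A B" "i < length Cs" "C = Cs ! i"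
    using assms by (auto simp: in_set_conv_nth elim!: transfE)
  then show thesis using coarse_grain3[of Cs A B "{i}" i] that by simp
qed

lemma transf_test2:
  assumes "C \<in> Tr A B"
  obtains E where "[C, E] \<in> Tests A B"
proof -
  obtain E where "[C, 0, E] \<in> Tests A B" using transf_test3[OF assms] .
  then show thesis using coarse_grain_last[of "[C]" 0 E A B] that by simp
qed

lemma transf_scale:
  assumes "f \<in> Tr A B" "0 \<le> p" "p \<le> 1"
  shows "p *\<^sub>R f \<in> Tr A B"
proof -
  have "map (\<lambda>p. p *\<^sub>R \<I> A) [p, 1 - p] \<in> Tests A A" using assms by (intro tests_scaled_ident) auto
  then have "p *\<^sub>R \<I> A \<in> Tr A A" by (rule transfI) simp
  from transf_seq[OF this assms(1)] show ?thesis by (simp add: seq_ident(1)[OF assms(1)])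
qed

lemma transf_convex:
  assumes "f \<in> Tr A B" "g \<in> Tr A B" "0 \<le> p" "p \<le> 1"
  shows "p *\<^sub>R f + (1 - p) *\<^sub>R g \<in> Tr A B"
proof -
  obtain f' g' where "[f, f'] \<in> Tests A B" "[g, g'] \<in> Tests A B"
    using assms transf_test2 by meson
  then have "concat (map2 (\<lambda>p. map (\<lambda>D. p *\<^sub>R D)) [p, 1 - p] [[f, f'], [g, g']]) \<in> Tests A B"
    using assms by (intro tests_randomised) auto
  then have t: "[p *\<^sub>R f, p *\<^sub>R f', (1 - p) *\<^sub>R g, (1 - p) *\<^sub>R g'] \<in> Tests A B" (is "?Cs \<in> _") by simp
  \<comment> \<open>Outcomes 0 and 2 are the weighted copies of \<open>f\<close> and
    \<open>g\<close>; merging them gives the mixture.\<close>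
  define q :: "nat \<Rightarrow> nat" where "q j = (if j = 0 \<or> j = 2 then 0 else 1)" for j
  have "map (\<lambda>j. \<Sum>i | i < length ?Cs \<and> q i = j. ?Cs ! i) [0..<2] \<in> Tests A B"
    by (rule coarse_grain[OF t]) (auto simp: q_def)
  then have "(\<Sum>i | i < length ?Cs \<and> q i = 0. ?Cs ! i) \<in> Tr A B" by (rule transfI) auto
  moreover have "{i. i < length ?Cs \<and> q i = 0} = {0, 2}" by (auto simp: q_def)
  ultimately show ?thesis by simp
qed

lemma pure_iff:
  "pure \<Theta> A B C \<longleftrightarrow> C \<in> Tr A B \<and> (\<forall>D E G. [D, E, G] \<in> Tests A B \<longrightarrow> C = D + E \<longrightarrow> (\<exists>c. D = c *\<^sub>R C))"
proof
  assume p: "pure \<Theta> A B C"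
  have "\<exists>c. D = c *\<^sub>R C" if t: "[D, E, G] \<in> Tests A B" "C = D + E" for D E G
  proof -
    have "C = (\<Sum>i\<in>{0, 1}. [D, E, G] ! i)" using t by simp
    then have "\<forall>i\<in>{0, 1}. \<exists>c. [D, E, G] ! i = c *\<^sub>R C"
      using p t(1) unfolding pure_def by (metis (no_types, lifting) One_nat_def Suc_leI insert_subset
          lessThan_iff length_Cons less_Suc_eq_0_disj empty_subsetI)
    then show ?thesis by auto
  qed
  then show "C \<in> Tr A B \<and> (\<forall>D E G. [D, E, G] \<in> Tests A B \<longrightarrow> C = D + E \<longrightarrow> (\<exists>c. D = c *\<^sub>R C))"
    using p by (simp add: pure_def)
next
  assume C: "C \<in> Tr A B \<and> (\<forall>D E G. [D, E, G] \<in> Tests A B \<longrightarrow> C = D + E \<longrightarrow> (\<exists>c. D = c *\<^sub>R C))"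
  have "\<exists>c. Ds ! i = c *\<^sub>R C"
    if "Ds \<in> Tests A B" "X \<subseteq> {..<length Ds}" "C = (\<Sum>i\<in>X. Ds ! i)" "i \<in> X" for Ds X i
  proof -
    have "finite X" using that(2) finite_subset by blast
    then have "C = Ds ! i + (\<Sum>j\<in>X - {i}. Ds ! j)" using that(3,4) by (simp add: sum.remove)
    then show ?thesis using coarse_grain3[OF that(1,2,4)] C by blast
  qed
  then show "pure \<Theta> A B C" using C by (auto simp: pure_def)
qed

lemma pure_transf: "pure \<Theta> A B C \<Longrightarrow> C \<in> Tr A B"
  by (simp add: pure_iff)

subsection \<open>Causality\<close>

lemma discard_channel [simp]: "channel \<Theta> A \<one> (u A)"
  unfolding discard_def using theI'[OF causality[of A]] .

lemma discard_unique: "channel \<Theta> A \<one> a \<Longrightarrow> a = u A"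
  using causality[of A] discard_channel[of A] by blast

lemma discard_effect [simp]: "u A \<in> Eff A"
  unfolding effects_def using channel_transf[OF discard_channel] .

lemma discard_transf [simp]: "u A \<in> Tr A \<one>"
  using channel_transf[OF discard_channel] .

lemma discard_unit [simp]: "u \<one> = \<I> \<one>"
  using discard_unique[OF channel_ident] by simp

lemma discard_seq: "channel \<Theta> A B f \<Longrightarrow> u B \<odot> f = u A"
  by (intro discard_unique channel_seq[OF _ discard_channel])

lemma discard_par: "u A \<otimes> u B = u (A \<star> B)"
  using discard_unique[of "A \<star> B"] channel_par[OF discard_channel discard_channel, of A B]
  by (simp add: composite_unit)

lemma observation_test_sum: "as \<in> Tests A \<one> \<Longrightarrow> as \<noteq> [] \<Longrightarrow> sum_list as = u A"
  using coarse_grain_total discard_unique by (simp add: channel_def)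

lemma states_test_norm:
  assumes "Cs \<in> Tests \<one> A"
  shows "(\<Sum>C\<leftarrow>Cs. ev (u A) C) = 1"
proof -
  have "map (\<lambda>C. u A \<odot> C) Cs \<in> Tests \<one> \<one>"
    using tests_post[OF assms] discard_channel by (simp add: channel_def)
  then obtain ps where ps: "map (\<lambda>C. u A \<odot> C) Cs = map (\<lambda>p. p *\<^sub>R \<I> \<one>) ps" "sum_list ps = 1"
    by (auto simp: scalar_tests)
  have "map (ev (u A)) Cs = map scal (map (\<lambda>C. u A \<odot> C) Cs)" by (simp add: ev_def)
  also have "\<dots> = ps" by (simp add: ps(1) o_def linear_cmul[OF scal(1)] scal(2))
  finally show ?thesis using ps(2) by simp
qed

lemma normalised_iff: "normal A \<rho> \<longleftrightarrow> \<rho> \<in> St A \<and> ev (u A) \<rho> = 1"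
  using pairing_effect[OF discard_effect] by (auto simp: normalised_state_def)

lemma normalised_St: "normal A \<rho> \<Longrightarrow> \<rho> \<in> St A"
  by (simp add: normalised_iff)

lemma state_zero_norm:
  assumes "x \<in> St A" "ev (u A) x = 0"
  shows "x = 0"
proof (rule ccontr)
  assume "x \<noteq> 0"
  then obtain c \<sigma> where "normal A \<sigma>" "x = c *\<^sub>R \<sigma>" using normalisable assms(1) by blast
  then show False using assms(2) \<open>x \<noteq> 0\<close> by (simp add: normalised_iff)
qed

lemma state_normalise:
  assumes "x \<in> St A" "x \<noteq> 0"
  obtains \<sigma> where "normal A \<sigma>" "x = ev (u A) x *\<^sub>R \<sigma>" "0 < ev (u A) x" "ev (u A) x \<le> 1"
proof -
  obtain c \<sigma> where s: "normal A \<sigma>" "x = c *\<^sub>R \<sigma>" using normalisable assms by blast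
  then have "ev (u A) x = c" by (simp add: normalised_iff)
  moreover have "ev (u A) x > 0"
    using ev_bounds[OF discard_effect assms(1)] state_zero_norm[OF assms(1)] assms(2) by fastforce
  ultimately show thesis using that s ev_bounds[OF discard_effect assms(1)] by blast
qed

text \<open>A normalised state is a priori only a member of some test. The other outcomes have total
  norm zero, hence vanish, and the state can be prepared deterministically.\<close>

lemma normalised_test:
  assumes "normal A \<rho>"
  shows "[\<rho>] \<in> Tests \<one> A"
proof -
  have "\<rho> \<in> Tr \<one> A" using assms by (simp add: normalised_iff states_def)
  then obtain E where E: "[\<rho>, E] \<in> Tests \<one> A" by (rule transf_test2)
  then have "E \<in> St A" by (auto simp: states_def intro: transfI)
  moreover have "ev (u A) E = 0" using states_test_norm[OF E] assms by (simp add: normalised_iff)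
  ultimately have "E = 0" by (rule state_zero_norm)
  then show ?thesis using coarse_grain_last[of "[]" \<rho> E] E by simp
qed

lemma normalised_iff_channel: "normal A \<rho> \<longleftrightarrow> channel \<Theta> \<one> A \<rho>"
proof
  assume "channel \<Theta> \<one> A \<rho>"
  then have "[\<rho>] \<in> Tests \<one> A" by (simp add: channel_def)
  then show "normal A \<rho>" using states_test_norm[of "[\<rho>]" A]
    by (auto simp: normalised_iff states_def intro: transfI)
qed (simp add: channel_def normalised_test)

lemma ev_seq: "f \<in> Tr A B \<Longrightarrow> a \<in> Eff B \<Longrightarrow> x \<in> St A \<Longrightarrow> ev a (f \<odot> x) = ev (a \<odot> f) x"
  unfolding ev_def by (subst seq_assoc[of x \<one> A f B a \<one>]) (simp_all add: states_def effects_def)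

lemma state_seq: "x \<in> St A \<Longrightarrow> f \<in> Tr A B \<Longrightarrow> f \<odot> x \<in> St B"
  unfolding states_def by (rule transf_seq)

lemma effect_seq: "a \<in> Eff B \<Longrightarrow> f \<in> Tr A B \<Longrightarrow> a \<odot> f \<in> Eff A"
  unfolding effects_def by (rule transf_seq)

lemma normalised_seq: "normal A x \<Longrightarrow> channel \<Theta> A B f \<Longrightarrow> normal B (f \<odot> x)"
  unfolding normalised_iff_channel by (rule channel_seq)

lemma normalised_par: "normal A x \<Longrightarrow> normal B y \<Longrightarrow> normal (A \<star> B) (x \<otimes> y)"
  unfolding normalised_iff_channel using channel_par[of \<one> A x \<one> B y] by (simp add: composite_unit)

text \<open>The list is the randomisation of deterministic preparations of its normalised members,
  with the norms as probabilities. For a zero entry any normalised state can be prepared, with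
  probability zero.\<close>

lemma ensemble_test:
  assumes "\<And>x. x \<in> set xs \<Longrightarrow> x \<in> St A" "(\<Sum>x\<leftarrow>xs. ev (u A) x) = 1"
  shows "xs \<in> Tests \<one> A"
proof -
  have "\<exists>x\<in>set xs. x \<noteq> 0"
  proof (rule ccontr)
    assume "\<not> (\<exists>x\<in>set xs. x \<noteq> 0)"
    then have "(\<Sum>x\<leftarrow>xs. ev (u A) x) = (\<Sum>x\<leftarrow>xs. 0)"
      by (intro arg_cong[where f = sum_list] map_cong) auto
    then show False using assms(2) by (metis sum_list_0 zero_neq_one)
  qed
  then obtain \<tau> where \<tau>: "normal A \<tau>" by (metis state_normalise assms(1))
  have "\<exists>\<sigma>. normal A \<sigma> \<and> x = ev (u A) x *\<^sub>R \<sigma>" if "x \<in> set xs" for x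
  proof (cases "x = 0")
    case False
    then show ?thesis using state_normalise[OF assms(1)[OF that]] by metis
  qed (use \<tau> in auto)
  then obtain \<sigma> where \<sigma>: "\<And>x. x \<in> set xs \<Longrightarrow> normal A (\<sigma> x)"
      "\<And>x. x \<in> set xs \<Longrightarrow> ev (u A) x *\<^sub>R \<sigma> x = x" by metis
  have "concat (map2 (\<lambda>p. map (\<lambda>D. p *\<^sub>R D)) (map (ev (u A)) xs) (map (\<lambda>x. [\<sigma> x]) xs)) \<in> Tests \<one> A"
    using assms \<sigma> normalised_test ev_bounds[OF discard_effect] by (intro tests_randomised) auto
  moreover have "concat (map2 (\<lambda>p. map (\<lambda>D. p *\<^sub>R D)) (map (ev (u A)) ys) (map (\<lambda>x. [\<sigma> x]) ys)) = ys"
    if "set ys \<subseteq> set xs" for ys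
    using that by (induction ys) (auto simp: \<sigma>(2))
  ultimately show ?thesis by simp
qed

text \<open>The factor may exceed one: the result is also a multiple, by its own norm, of the
  normalised state behind \<open>x\<close>, and that multiple only scales down.\<close>

lemma scaled_state:
  assumes "x \<in> St A" "0 \<le> c" "ev (u A) (c *\<^sub>R x) \<le> 1"
  shows "c *\<^sub>R x \<in> St A"
proof (cases "x = 0")
  case False
  then obtain \<sigma> where \<sigma>: "normal A \<sigma>" "x = ev (u A) x *\<^sub>R \<sigma>" "0 < ev (u A) x"
    using state_normalise assms(1) by metis
  have "c *\<^sub>R x = ev (u A) (c *\<^sub>R x) *\<^sub>R \<sigma>" by (subst (1) \<sigma>(2)) simp
  moreover have "0 \<le> ev (u A) (c *\<^sub>R x)" using \<sigma>(3) assms(2) by simp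
  then have "ev (u A) (c *\<^sub>R x) *\<^sub>R \<sigma> \<in> St A"
    unfolding states_def using \<sigma>(1) assms(3) by (intro transf_scale) (auto simp: normalised_iff states_def)
  ultimately show ?thesis by metis
qed (use assms in simp)

text \<open>Half of the sum is a mixture of the two states, and doubling it is allowed by the bound
  on the norm.\<close>

lemma state_sum:
  assumes "x \<in> St A" "y \<in> St A" "ev (u A) (x + y) \<le> 1"
  shows "x + y \<in> St A"
proof -
  have b: "0 \<le> ev (u A) x" "0 \<le> ev (u A) y" using ev_bounds(1)[OF discard_effect] assms by auto
  have "(1/2) *\<^sub>R x + (1 - 1/2) *\<^sub>R y \<in> St A"
    using assms(1,2) unfolding states_def by (intro transf_convex) auto
  then have "2 *\<^sub>R ((1/2) *\<^sub>R x + (1 - 1/2) *\<^sub>R y) \<in> St A"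
    using assms(3) by (intro scaled_state) (auto simp: ev_add algebra_simps)
  then show ?thesis by (simp add: scaleR_add_right)
qed

lemma zero_state [simp]: "x \<in> St A \<Longrightarrow> 0 \<in> St A"
  using scaled_state[of x A 0] by simp

lemma state_combination:
  assumes "finite I" "I \<noteq> {}" "\<And>i. i \<in> I \<Longrightarrow> x i \<in> St A" "\<And>i. i \<in> I \<Longrightarrow> 0 \<le> c i"
    and "ev (u A) (\<Sum>i\<in>I. c i *\<^sub>R x i) \<le> 1"
  shows "(\<Sum>i\<in>I. c i *\<^sub>R x i) \<in> St A"
  using assms
proof (induction I rule: finite_ne_induct)
  case (singleton i)
  then show ?case using scaled_state[of "x i" A "c i"] by simp
next
  case (insert i I)
  have nn: "0 \<le> ev (u A) (x j)" if "j \<in> insert i I" for j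
    using ev_bounds(1)[OF discard_effect insert.prems(1)[OF that]] .
  have "0 \<le> ev (u A) (\<Sum>i\<in>I. c i *\<^sub>R x i)" "0 \<le> ev (u A) (c i *\<^sub>R x i)"
    using nn insert.prems(2) by (auto simp: ev_sum intro!: sum_nonneg)
  then have le: "ev (u A) (\<Sum>i\<in>I. c i *\<^sub>R x i) \<le> 1" "ev (u A) (c i *\<^sub>R x i) \<le> 1"
    using insert.prems(3) insert.hyps by (auto simp: ev_add)
  have "c i *\<^sub>R x i + (\<Sum>i\<in>I. c i *\<^sub>R x i) \<in> St A"
    using insert le by (intro state_sum scaled_state insert.IH) auto
  then show ?case using insert.hyps by simp
qed

lemma effect_complement:
  assumes "e \<in> Eff A"
  shows "[e, u A - e] \<in> Tests A \<one>" "u A - e \<in> Eff A"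
proof -
  obtain e' where e': "[e, e'] \<in> Tests A \<one>"
    using assms transf_test2 unfolding effects_def by blast
  then have "e' = u A - e" using observation_test_sum[OF e'] by (simp add: algebra_simps)
  then show "[e, u A - e] \<in> Tests A \<one>" using e' by simp
  then show "u A - e \<in> Eff A" unfolding effects_def by (rule transfI) simp
qed

subsection \<open>Compactness\<close>

text \<open>The separation axioms compare transformations only; this form carries them over to
  linear combinations. Dividing by \<open>C\<close> turns the coefficients \<open>c\<close> and
  \<open>\<bar>k\<bar>\<close> into probabilities, and the sign of \<open>k\<close> decides which of
  the two terms absorbs the mixture.\<close>

lemma span_transf:
  assumes "x \<in> span (Tr A B)" "Tr A B \<noteq> {}"
  shows "\<exists>c>0. \<exists>f\<in>Tr A B. \<exists>g\<in>Tr A B. x = c *\<^sub>R (f - g)"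
  using assms(1)
proof (induction x rule: span_induct_alt)
  case base
  obtain f where "f \<in> Tr A B" using assms(2) by blast
  then show ?case by (intro exI[of _ 1]) (auto intro!: bexI[of _ f])
next
  case (step k b y)
  then obtain c f g where c: "c > 0" and f: "f \<in> Tr A B" and g: "g \<in> Tr A B" and y: "y = c *\<^sub>R (f - g)" by blast
  define C where "C = \<bar>k\<bar> + c"
  have C: "C > 0" "c / C \<ge> 0" "c / C \<le> 1" "1 - c / C = \<bar>k\<bar> / C" using c by (auto simp: C_def field_simps)
  define h where "h z = (c / C) *\<^sub>R z + (\<bar>k\<bar> / C) *\<^sub>R b" for z
  have h: "h z \<in> Tr A B" if "z \<in> Tr A B" for z
    using transf_convex[OF that step(1) C(2,3)] by (simp add: h_def C(4))
  have s: "(c / C) *\<^sub>R z \<in> Tr A B" if "z \<in> Tr A B" for z using transf_scale[OF that C(2,3)] .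
  show ?case
  proof (cases "k \<ge> 0")
    case True
    have "k *\<^sub>R b + y = C *\<^sub>R (h f - (c / C) *\<^sub>R g)"
      using C(1) True by (simp add: y h_def algebra_simps)
    then show ?thesis using C(1) h[OF f] s[OF g] by blast
  next
    case False
    have "k *\<^sub>R b + y = C *\<^sub>R ((c / C) *\<^sub>R f - h g)"
      using C(1) False by (simp add: y h_def algebra_simps)
    then show ?thesis using C(1) h[OF g] s[OF f] by blast
  qed
qed

text \<open>Experiments with an arbitrary reference system \<open>R\<close>: by the axioms on
  equality these are the functionals that tell transformations apart, and on transformations their
  values are probabilities.\<close>

definition test_funs :: "'s \<Rightarrow> 's \<Rightarrow> ('t \<Rightarrow> real) set" where
  "test_funs A B = {\<lambda>x. ev e ((x \<otimes> \<I> R) \<odot> \<rho>) |e R \<rho>. e \<in> Eff (B \<star> R) \<and> \<rho> \<in> St (A \<star> R)}"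

lemma test_funs_linear: "\<phi> \<in> test_funs A B \<Longrightarrow> linear \<phi>"
  by (auto simp: test_funs_def seq_add par_add ev_add intro!: linearI)

lemma test_funs_bounds: "\<phi> \<in> test_funs A B \<Longrightarrow> f \<in> Tr A B \<Longrightarrow> 0 \<le> \<phi> f \<and> \<phi> f \<le> 1"
  unfolding test_funs_def using ev_bounds state_seq transf_par[OF _ ident_transf] by blast

lemma test_funs_separate:
  assumes "x \<in> span (Tr A B)" "\<And>\<phi>. \<phi> \<in> test_funs A B \<Longrightarrow> \<phi> x = 0"
  shows "x = 0"
proof (cases "Tr A B = {}")
  case True
  then show ?thesis using assms(1) by simp
next
  case False
  then obtain c f g where c: "c > 0" and f: "f \<in> Tr A B" and g: "g \<in> Tr A B" and x: "x = c *\<^sub>R (f - g)"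
    using span_transf[OF assms(1)] by blast
  have "f = g"
  proof (rule transf_eqI[OF f g])
    fix R \<rho> assume \<rho>: "\<rho> \<in> St (A \<star> R)"
    have st: "(h \<otimes> \<I> R) \<odot> \<rho> \<in> St (B \<star> R)" if "h \<in> Tr A B" for h
      using state_seq[OF \<rho> transf_par[OF that ident_transf]] .
    show "(f \<otimes> \<I> R) \<odot> \<rho> = (g \<otimes> \<I> R) \<odot> \<rho>"
    proof (rule state_eqI[OF st[OF f] st[OF g]])
      fix e assume e: "e \<in> Eff (B \<star> R)"
      have "ev e ((x \<otimes> \<I> R) \<odot> \<rho>) = 0"
        by (rule assms(2)) (use e \<rho> in \<open>auto simp: test_funs_def\<close>)
      then have "ev e ((f \<otimes> \<I> R) \<odot> \<rho>) = ev e ((g \<otimes> \<I> R) \<odot> \<rho>)"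
        using c by (simp add: x par_diff seq_diff ev_diff)
      then show "pairing \<Theta> e ((f \<otimes> \<I> R) \<odot> \<rho>) = pairing \<Theta> e ((g \<otimes> \<I> R) \<odot> \<rho>)"
        using pairing_effect[OF e] st f g by simp
    qed
  qed
  then show ?thesis by (simp add: x)
qed

text \<open>Finitely many experiments serve as coordinates, and in these coordinates the
  transformations lie in a cube.\<close>

lemma transf_expansion:
  "\<exists>(n::nat) \<phi> v. (\<forall>i<n. linear (\<phi> i) \<and> (\<forall>f\<in>Tr A B. \<bar>\<phi> i f\<bar> \<le> (1::real))) \<and>
    (\<forall>x\<in>span (Tr A B). x = (\<Sum>i<n. \<phi> i x *\<^sub>R v i))"
proof -
  obtain F where F: "finite F" "Tr A B \<subseteq> span F" using finite_dimensional by blast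
  have "span (Tr A B) \<subseteq> span F" using F(2) by (simp add: span_minimal)
  have "\<exists>(n::nat) \<phi> v. (\<forall>i<n. \<phi> i \<in> test_funs A B) \<and> (\<forall>x\<in>span (Tr A B). x = (\<Sum>i<n. \<phi> i x *\<^sub>R v i))"
    by (rule expansion_by_separating_functionals[OF subspace_span F(1) \<open>span (Tr A B) \<subseteq> span F\<close>])
      (auto intro: test_funs_linear test_funs_separate)
  then obtain n :: nat and \<phi> v where "(\<forall>i<n. \<phi> i \<in> test_funs A B) \<and>
      (\<forall>x\<in>span (Tr A B). x = (\<Sum>i<n. \<phi> i x *\<^sub>R v i))" by (elim exE) (rule that)
  moreover from this have "\<forall>i<n. linear (\<phi> i) \<and> (\<forall>f\<in>Tr A B. \<bar>\<phi> i f\<bar> \<le> 1)"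
    using test_funs_linear test_funs_bounds by (fastforce simp: abs_le_iff)
  ultimately show ?thesis by (intro exI[of _ n] exI[of _ \<phi>] exI[of _ v]) blast
qed

text \<open>Closedness is an axiom; boundedness comes from the coordinates being
  probabilities.\<close>

lemma compact_transf: "compact (Tr A B)"
proof -
  obtain n :: nat and \<phi> v where "(\<forall>i<n. linear (\<phi> i) \<and> (\<forall>f\<in>Tr A B. \<bar>\<phi> i f\<bar> \<le> (1::real))) \<and>
      (\<forall>x\<in>span (Tr A B). x = (\<Sum>i<n. \<phi> i x *\<^sub>R v i))"
    using transf_expansion[of A B] by (elim exE) (rule that)
  then have n: "\<And>i. i < n \<Longrightarrow> linear (\<phi> i)" "\<And>i f. i < n \<Longrightarrow> f \<in> Tr A B \<Longrightarrow> \<bar>\<phi> i f\<bar> \<le> 1"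
    "\<And>x. x \<in> span (Tr A B) \<Longrightarrow> x = (\<Sum>i<n. \<phi> i x *\<^sub>R v i)" by blast+
  let ?K = "{\<Sum>i<n. c i *\<^sub>R v i |c. \<forall>i\<in>{..<n}. \<bar>c i\<bar> \<le> (1::real)}"
  have "compact ?K" by (rule compact_combinations) simp
  moreover have "Tr A B \<subseteq> ?K"
  proof
    fix f assume f: "f \<in> Tr A B"
    show "f \<in> ?K"
      using n(2)[OF _ f] by (intro CollectI exI[of _ "\<lambda>i. \<phi> i f"] conjI n(3)[OF span_base[OF f]]) simp
  qed
  ultimately show ?thesis using compact_Int_closed[OF _ closed_transf[of A B], of ?K] by (simp add: Int_absorb1)
qed

lemma linear_continuous_transf:
  fixes \<phi> :: "'t \<Rightarrow> 'b::real_normed_vector"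
  assumes "linear \<phi>"
  shows "continuous_on (Tr A B) \<phi>"
proof -
  obtain F where "finite F" "Tr A B \<subseteq> span F" using finite_dimensional by blast
  then show ?thesis using linear_continuous_on_span_finite[OF _ assms] continuous_on_subset by blast
qed

text \<open>Expanding the first factor in its coordinates leaves a finite sum of products of
  functions that are linear in one factor each, so joint continuity follows from continuity in each
  factor.\<close>

lemma seq_continuous: "continuous_on (Tr A B \<times> Tr B C) (\<lambda>(f, g). g \<odot> f)"
proof -
  obtain n :: nat and \<phi> v where "(\<forall>i<n. linear (\<phi> i) \<and> (\<forall>f\<in>Tr A B. \<bar>\<phi> i f\<bar> \<le> (1::real))) \<and>
      (\<forall>x\<in>span (Tr A B). x = (\<Sum>i<n. \<phi> i x *\<^sub>R v i))"
    using transf_expansion[of A B] by (elim exE) (rule that)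
  then have n: "\<And>i. i < n \<Longrightarrow> linear (\<phi> i)" "\<And>i f. i < n \<Longrightarrow> f \<in> Tr A B \<Longrightarrow> \<bar>\<phi> i f\<bar> \<le> 1"
    "\<And>x. x \<in> span (Tr A B) \<Longrightarrow> x = (\<Sum>i<n. \<phi> i x *\<^sub>R v i)" by blast+
  have "continuous_on (Tr A B \<times> Tr B C) (\<lambda>z. \<Sum>i<n. \<phi> i (fst z) *\<^sub>R (snd z \<odot> v i))"
  proof (intro continuous_on_sum continuous_on_scaleR)
    fix i assume "i \<in> {..<n}"
    then have "continuous_on (Tr A B) (\<phi> i)" using n(1) linear_continuous_transf by blast
    then show "continuous_on (Tr A B \<times> Tr B C) (\<lambda>z. \<phi> i (fst z))"
      by (rule continuous_on_compose2) (auto intro: continuous_on_fst continuous_on_id)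
    have "continuous_on (Tr B C) (\<lambda>g. g \<odot> v i)" using seq_linear_left linear_continuous_transf by blast
    then show "continuous_on (Tr A B \<times> Tr B C) (\<lambda>z. snd z \<odot> v i)"
      by (rule continuous_on_compose2) (auto intro: continuous_on_snd continuous_on_id)
  qed
  moreover have "(\<Sum>i<n. \<phi> i (fst z) *\<^sub>R (snd z \<odot> v i)) = (case z of (f, g) \<Rightarrow> g \<odot> f)"
    if "z \<in> Tr A B \<times> Tr B C" for z
  proof -
    have "fst z = (\<Sum>i<n. \<phi> i (fst z) *\<^sub>R v i)" by (rule n(3)) (use that in \<open>auto intro: span_base\<close>)
    then have "snd z \<odot> fst z = snd z \<odot> (\<Sum>i<n. \<phi> i (fst z) *\<^sub>R v i)" by (rule arg_cong)
    then show ?thesis by (simp add: seq_sum case_prod_beta)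
  qed
  ultimately show ?thesis by (simp cong: continuous_on_cong)
qed

lemma compact_normalised: "compact {\<rho>. normal A \<rho>}"
proof -
  have "closed {\<rho> \<in> Tr \<one> A. ev (u A) \<rho> = 1}"
    by (intro continuous_closed_preimage_constant linear_continuous_transf ev_linear_right closed_transf)
  from compact_Int_closed[OF compact_transf[of \<one> A] this] show ?thesis
    by (simp add: normalised_iff states_def Int_absorb1 subset_iff)
qed

lemma linear_continuous_normalised:
  fixes \<phi> :: "'t \<Rightarrow> 'b::real_normed_vector"
  shows "linear \<phi> \<Longrightarrow> continuous_on {\<rho>. normal A \<rho>} \<phi>"
  by (rule continuous_on_subset[OF linear_continuous_transf[of \<phi> \<one> A]]) (auto simp: normalised_iff states_def)

lemma normalised_convex:
  assumes "normal A \<sigma>" "normal A \<tau>" "0 \<le> p" "p \<le> 1"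
  shows "normal A (p *\<^sub>R \<sigma> + (1 - p) *\<^sub>R \<tau>)"
  using assms transf_convex[of \<sigma> \<one> A \<tau> p] by (simp add: normalised_iff states_def ev_add)

lemma strictly_convex_function:
  "\<exists>g::'t \<Rightarrow> real. (\<forall>B C f. linear f \<longrightarrow> continuous_on (Tr B C) (\<lambda>x. g (f x))) \<and>
    (\<forall>x y d. g (d *\<^sub>R x + (1 - d) *\<^sub>R y) = d * g x + (1 - d) * g y - d * (1 - d) * g (x - y)) \<and>
    (\<forall>x\<in>span (St A). g x \<le> 0 \<longrightarrow> x = 0) \<and> (\<exists>K. \<forall>x\<in>St A. 0 \<le> g x \<and> g x \<le> K)"
proof -
  obtain n :: nat and \<phi> v where "(\<forall>i<n. linear (\<phi> i) \<and> (\<forall>f\<in>St A. \<bar>\<phi> i f\<bar> \<le> (1::real))) \<and>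
      (\<forall>x\<in>span (St A). x = (\<Sum>i<n. \<phi> i x *\<^sub>R v i))"
    using transf_expansion[of \<one> A, folded states_def] by (elim exE) (rule that)
  then have n: "\<And>i. i < n \<Longrightarrow> linear (\<phi> i)" "\<And>i f. i < n \<Longrightarrow> f \<in> St A \<Longrightarrow> \<bar>\<phi> i f\<bar> \<le> 1"
    "\<And>x. x \<in> span (St A) \<Longrightarrow> x = (\<Sum>i<n. \<phi> i x *\<^sub>R v i)" by blast+
  define g where "g x = (\<Sum>i<n. (\<phi> i x)\<^sup>2)" for x
  show ?thesis
  proof (intro exI[of _ g] conjI allI ballI impI)
    show "continuous_on (Tr B C) (\<lambda>x. g (f x))" if "linear f" for B C f
      unfolding g_def
      using linear_compose[OF that n(1)]
      by (intro continuous_on_sum continuous_on_power linear_continuous_transf) (auto simp: o_def)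
    show "g (d *\<^sub>R x + (1 - d) *\<^sub>R y) = d * g x + (1 - d) * g y - d * (1 - d) * g (x - y)" for x y d
    proof -
      have sq: "(\<phi> i (d *\<^sub>R x + (1 - d) *\<^sub>R y))\<^sup>2 =
          d * (\<phi> i x)\<^sup>2 + (1 - d) * (\<phi> i y)\<^sup>2 - d * (1 - d) * (\<phi> i (x - y))\<^sup>2" if "i < n" for i
        using n(1)[OF that]
        by (simp add: linear_add linear_diff linear_cmul power2_eq_square algebra_simps)
      show ?thesis
        by (simp add: g_def sum_distrib_left sq flip: sum.distrib sum_subtractf)
    qed
    show "x = 0" if "x \<in> span (St A)" "g x \<le> 0" for x
    proof -
      have "g x = 0" using that(2) by (simp add: g_def antisym sum_nonneg)
      then have "\<forall>i<n. \<phi> i x = 0" by (simp add: g_def sum_nonneg_eq_0_iff)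
      then have "(\<Sum>i<n. \<phi> i x *\<^sub>R v i) = 0" by simp
      then show ?thesis using n(3)[OF that(1)] by (rule trans[rotated])
    qed
    have "0 \<le> g x \<and> g x \<le> (\<Sum>i<n. 1)" if "x \<in> St A" for x
      unfolding g_def using n(2)[OF _ that]
      by (intro conjI sum_nonneg sum_mono) (simp_all add: abs_square_le_1)
    then show "\<exists>K. \<forall>x\<in>St A. 0 \<le> g x \<and> g x \<le> K" by blast
  qed
qed

text \<open>A maximiser of a strictly convex function on the face is an extreme point of it.\<close>

lemma pure_state_in_face:
  assumes "\<And>f. f \<in> \<Phi> \<Longrightarrow> linear f" "\<And>f \<rho>. f \<in> \<Phi> \<Longrightarrow> normal A \<rho> \<Longrightarrow> f \<rho> \<le> (0::real)"
    and "normal A \<rho>\<^sub>0" "\<And>f. f \<in> \<Phi> \<Longrightarrow> f \<rho>\<^sub>0 = 0"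
  obtains \<alpha> where "pure_state \<Theta> A \<alpha>" "\<And>f. f \<in> \<Phi> \<Longrightarrow> f \<alpha> = 0"
proof -
  obtain g :: "'t \<Rightarrow> real" where g: "\<And>B C f. linear f \<Longrightarrow> continuous_on (Tr B C) (\<lambda>x. g (f x))"
    "\<And>x y d. g (d *\<^sub>R x + (1 - d) *\<^sub>R y) = d * g x + (1 - d) * g y - d * (1 - d) * g (x - y)"
    "\<And>x. x \<in> span (St A) \<Longrightarrow> g x \<le> 0 \<Longrightarrow> x = 0"
    using strictly_convex_function[of A] by blast
  define N where "N = {\<rho>. normal A \<rho>} \<inter> (\<Inter>f\<in>\<Phi>. {\<rho> \<in> {\<rho>. normal A \<rho>}. f \<rho> = 0})"
  have "closed (\<Inter>f\<in>\<Phi>. {\<rho> \<in> {\<rho>. normal A \<rho>}. f \<rho> = 0})"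
    using assms(1)
    by (intro closed_INT ballI continuous_closed_preimage_constant linear_continuous_normalised
        compact_imp_closed[OF compact_normalised]) auto
  then have "compact N" unfolding N_def by (rule compact_Int_closed[OF compact_normalised])
  moreover have "N \<noteq> {}" using assms(3,4) by (auto simp: N_def)
  moreover have "continuous_on N g"
  proof (rule continuous_on_subset)
    show "continuous_on (Tr \<one> A) g" using g(1)[OF linear_id] by simp
    show "N \<subseteq> Tr \<one> A" by (auto simp: N_def normalised_iff states_def)
  qed
  ultimately obtain \<alpha> where \<alpha>: "\<alpha> \<in> N" "\<And>\<rho>. \<rho> \<in> N \<Longrightarrow> g \<rho> \<le> g \<alpha>" using continuous_attains_sup by metis
  have n\<alpha>: "normal A \<alpha>" using \<alpha>(1) by (simp add: N_def)
  have "\<exists>c. D = c *\<^sub>R \<alpha>" if t: "[D, E, G] \<in> Tests \<one> A" and DE: "\<alpha> = D + E" for D E G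
  proof -
    have D: "D \<in> St A" "E \<in> St A" using t by (auto simp: states_def intro: transfI)
    consider "D = 0" | "E = 0" | "D \<noteq> 0" "E \<noteq> 0" by blast
    then show ?thesis
    proof cases
      case 1
      then show ?thesis by (intro exI[of _ 0]) simp
    next
      case 2
      then show ?thesis using DE by (intro exI[of _ 1]) simp
    next
      case 3
      obtain \<sigma> where \<sigma>: "normal A \<sigma>" "D = ev (u A) D *\<^sub>R \<sigma>" "0 < ev (u A) D"
        using state_normalise[OF D(1) 3(1)] by metis
      obtain \<tau> where \<tau>: "normal A \<tau>" "E = ev (u A) E *\<^sub>R \<tau>" "0 < ev (u A) E"
        using state_normalise[OF D(2) 3(2)] by metis
      define d where "d = ev (u A) D"
      have e: "ev (u A) E = 1 - d" using n\<alpha> DE by (simp add: normalised_iff ev_add d_def)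
      have d: "0 < d" "d < 1" using \<sigma>(3) \<tau>(3) e by (simp_all add: d_def)
      have \<alpha>': "\<alpha> = d *\<^sub>R \<sigma> + (1 - d) *\<^sub>R \<tau>" using DE \<sigma>(2) \<tau>(2) e by (simp add: d_def)
      \<comment> \<open>No functional is positive on a normalised state, so a mixture with positive
        weights on which it vanishes has both components in the face.\<close>
      have "f \<sigma> = 0 \<and> f \<tau> = 0" if f: "f \<in> \<Phi>" for f
      proof -
        have "d * f \<sigma> + (1 - d) * f \<tau> = 0"
          using \<alpha>(1) f by (simp add: N_def \<alpha>' linear_add[OF assms(1)] linear_cmul[OF assms(1)])
        moreover have "f \<sigma> \<le> 0" "f \<tau> \<le> 0" using assms(2)[OF f] \<sigma>(1) \<tau>(1) by auto
        then have "d * f \<sigma> \<le> 0" "(1 - d) * f \<tau> \<le> 0" using d by (auto simp: mult_le_0_iff)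
        ultimately have "d * f \<sigma> = 0" "(1 - d) * f \<tau> = 0" by linarith+
        then show ?thesis using d by simp
      qed
      then have "\<sigma> \<in> N" "\<tau> \<in> N" using \<sigma>(1) \<tau>(1) by (auto simp: N_def)
      \<comment> \<open>As \<alpha> maximises \<open>g\<close> on the face, the convexity defect
        \<open>d * (1 - d) * g (\<sigma> - \<tau>)\<close> cannot be positive, which makes the two
        components equal.\<close>
      then have "d * g \<sigma> \<le> d * g \<alpha>" "(1 - d) * g \<tau> \<le> (1 - d) * g \<alpha>" using \<alpha>(2) d by auto
      moreover have "g \<alpha> = d * g \<sigma> + (1 - d) * g \<tau> - d * (1 - d) * g (\<sigma> - \<tau>)" unfolding \<alpha>' by (rule g(2))
      ultimately have "d * (1 - d) * g (\<sigma> - \<tau>) \<le> 0" by (simp add: algebra_simps)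
      moreover have "d * (1 - d) > 0" using d by simp
      ultimately have "g (\<sigma> - \<tau>) \<le> 0" by (metis mult_le_cancel_left_pos mult_zero_right)
      then have "\<sigma> - \<tau> = 0" using \<sigma>(1) \<tau>(1) by (intro g(3)) (auto simp: normalised_iff span_base span_diff)
      then have "\<sigma> = \<alpha>" by (simp add: \<alpha>' algebra_simps)
      then show ?thesis using \<sigma>(2) by blast
    qed
  qed
  then have "pure_state \<Theta> A \<alpha>"
    using n\<alpha> by (auto simp: pure_state_def pure_iff normalised_iff states_def)
  moreover have "f \<alpha> = 0" if "f \<in> \<Phi>" for f using \<alpha>(1) that by (simp add: N_def)
  ultimately show thesis by (rule that)
qed

lemma pure_state_maximising:
  assumes "linear f" "normal A \<rho>\<^sub>0"
  obtains \<alpha> where "pure_state \<Theta> A \<alpha>" "\<And>\<rho>. normal A \<rho> \<Longrightarrow> f \<rho> \<le> (f \<alpha> :: real)"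
proof -
  have "\<exists>x\<in>{\<rho>. normal A \<rho>}. \<forall>y\<in>{\<rho>. normal A \<rho>}. f y \<le> f x"
    by (rule continuous_attains_sup[OF compact_normalised _ linear_continuous_normalised[OF assms(1)]])
      (use assms(2) in blast)
  then obtain \<rho>\<^sub>1 where \<rho>\<^sub>1: "normal A \<rho>\<^sub>1" "\<And>\<rho>. normal A \<rho> \<Longrightarrow> f \<rho> \<le> f \<rho>\<^sub>1" by blast
  \<comment> \<open>Subtracting the maximum as a multiple of the deterministic effect keeps the
    functional linear and turns the set of maximisers into its zero set.\<close>
  define h where "h \<rho> = f \<rho> - f \<rho>\<^sub>1 * ev (u A) \<rho>" for \<rho>
  have lin: "linear h"
    by (intro linearI) (simp_all add: h_def linear_add[OF assms(1)] linear_cmul[OF assms(1)] ev_add algebra_simps)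
  obtain \<alpha> where "pure_state \<Theta> A \<alpha>" "h \<alpha> = 0"
    using pure_state_in_face[of "{h}" A \<rho>\<^sub>1] lin \<rho>\<^sub>1 by (auto simp: h_def normalised_iff)
  then show thesis using that[of \<alpha>] \<rho>\<^sub>1 by (auto simp: h_def pure_state_def normalised_iff)
qed

subsection \<open>Bipartite calculus\<close>

lemma St_transf: "x \<in> St A \<Longrightarrow> x \<in> Tr \<one> A" and Eff_transf: "e \<in> Eff A \<Longrightarrow> e \<in> Tr A \<one>"
  by (simp_all add: states_def effects_def)

lemma seq_act: "x \<in> St A \<Longrightarrow> f \<in> Tr A B \<Longrightarrow> g \<in> Tr B C \<Longrightarrow> g \<odot> (f \<odot> x) = (g \<odot> f) \<odot> x"
  using seq_assoc[OF St_transf] by metis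

lemma par_act:
  assumes "\<Psi> \<in> St (A \<star> A')" "f \<in> Tr A B" "f' \<in> Tr B C" "g \<in> Tr A' B'" "g' \<in> Tr B' C'"
  shows "(f' \<otimes> g') \<odot> ((f \<otimes> g) \<odot> \<Psi>) = ((f' \<odot> f) \<otimes> (g' \<odot> g)) \<odot> \<Psi>"
  using seq_act[OF assms(1) transf_par[OF assms(2,4)] transf_par[OF assms(3,5)]]
  by (simp add: interchange[OF assms(2,3,4,5)])

lemma act_right_right:
  assumes "\<Psi> \<in> St (A \<star> B)" "g \<in> Tr B C" "h \<in> Tr C D"
  shows "(\<I> A \<otimes> h) \<odot> ((\<I> A \<otimes> g) \<odot> \<Psi>) = (\<I> A \<otimes> (h \<odot> g)) \<odot> \<Psi>"
  using par_act[OF assms(1) ident_transf ident_transf assms(2,3)] by (simp add: seq_ident[OF ident_transf])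

lemma act_left_left:
  assumes "\<Psi> \<in> St (A \<star> B)" "g \<in> Tr A C" "h \<in> Tr C D"
  shows "(h \<otimes> \<I> B) \<odot> ((g \<otimes> \<I> B) \<odot> \<Psi>) = ((h \<odot> g) \<otimes> \<I> B) \<odot> \<Psi>"
  using par_act[OF assms(1,2,3) ident_transf ident_transf] by (simp add: seq_ident[OF ident_transf])

lemma act_left_right:
  assumes "\<Psi> \<in> St (A \<star> B)" "f \<in> Tr A C" "g \<in> Tr B D"
  shows "(f \<otimes> \<I> D) \<odot> ((\<I> A \<otimes> g) \<odot> \<Psi>) = (f \<otimes> g) \<odot> \<Psi>"
  using par_act[OF assms(1) ident_transf assms(2,3) ident_transf] by (simp add: seq_ident[OF assms(2)] seq_ident[OF assms(3)])

lemma act_right_left: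
  assumes "\<Psi> \<in> St (A \<star> B)" "f \<in> Tr A C" "g \<in> Tr B D"
  shows "(\<I> C \<otimes> g) \<odot> ((f \<otimes> \<I> B) \<odot> \<Psi>) = (f \<otimes> g) \<odot> \<Psi>"
  using par_act[OF assms(1,2) ident_transf ident_transf assms(3)] by (simp add: seq_ident[OF assms(2)] seq_ident[OF assms(3)])

lemma state_act_left: "\<Psi> \<in> St (A \<star> B) \<Longrightarrow> f \<in> Tr A C \<Longrightarrow> (f \<otimes> \<I> B) \<odot> \<Psi> \<in> St (C \<star> B)"
  by (rule state_seq[OF _ transf_par[OF _ ident_transf]])

lemma state_act_right: "\<Psi> \<in> St (A \<star> B) \<Longrightarrow> g \<in> Tr B C \<Longrightarrow> (\<I> A \<otimes> g) \<odot> \<Psi> \<in> St (A \<star> C)"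
  by (rule state_seq[OF _ transf_par[OF ident_transf]])

lemma act_ident: "\<Psi> \<in> St (A \<star> B) \<Longrightarrow> (\<I> A \<otimes> \<I> B) \<odot> \<Psi> = \<Psi>"
  by (simp add: par_ident seq_ident(2)[OF St_transf])

lemma reduce_left: "\<Psi> \<in> St (A \<star> B) \<Longrightarrow> a \<in> Eff A \<Longrightarrow> (a \<otimes> \<I> B) \<odot> \<Psi> \<in> St B"
  using state_act_left[OF _ Eff_transf] by (simp add: composite_unit)

lemma reduce_right: "\<Psi> \<in> St (A \<star> B) \<Longrightarrow> b \<in> Eff B \<Longrightarrow> (\<I> A \<otimes> b) \<odot> \<Psi> \<in> St A"
  using state_act_right[OF _ Eff_transf] by (simp add: composite_unit)

lemma state_par: "x \<in> St A \<Longrightarrow> y \<in> St B \<Longrightarrow> x \<otimes> y \<in> St (A \<star> B)"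
  using transf_par[of x \<one> A y \<one> B] by (simp add: states_def composite_unit)

lemma ev_reduce_left:
  assumes "\<Psi> \<in> St (A \<star> B)" "a \<in> Eff A" "b \<in> Eff B"
  shows "ev b ((a \<otimes> \<I> B) \<odot> \<Psi>) = ev (a \<otimes> b) \<Psi>"
  using act_right_left[OF assms(1) Eff_transf[OF assms(2)] Eff_transf[OF assms(3)]]
  by (simp add: ev_def par_unit(2)[OF Eff_transf[OF assms(3)]])

lemma ev_reduce_right:
  assumes "\<Psi> \<in> St (A \<star> B)" "a \<in> Eff A" "b \<in> Eff B"
  shows "ev a ((\<I> A \<otimes> b) \<odot> \<Psi>) = ev (a \<otimes> b) \<Psi>"
  using act_left_right[OF assms(1) Eff_transf[OF assms(2)] Eff_transf[OF assms(3)]]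
  by (simp add: ev_def par_unit(1)[OF Eff_transf[OF assms(2)]])

lemma act_product:
  assumes "x \<in> St A" "y \<in> St B" "f \<in> Tr A C" "g \<in> Tr B D"
  shows "(f \<otimes> g) \<odot> (x \<otimes> y) = (f \<odot> x) \<otimes> (g \<odot> y)"
  using interchange[OF St_transf[OF assms(1)] assms(3) St_transf[OF assms(2)] assms(4)] by simp

lemma reduce_product_left:
  assumes "x \<in> St A" "y \<in> St B" "a \<in> Eff A"
  shows "(a \<otimes> \<I> B) \<odot> (x \<otimes> y) = ev a x *\<^sub>R y"
  using act_product[OF assms(1,2) Eff_transf[OF assms(3)] ident_transf]
  by (simp add: seq_eq_ev[OF assms(3,1)] seq_ident[OF St_transf[OF assms(2)]] par_unit[OF St_transf[OF assms(2)]])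

lemma reduce_product_right:
  assumes "x \<in> St A" "y \<in> St B" "b \<in> Eff B"
  shows "(\<I> A \<otimes> b) \<odot> (x \<otimes> y) = ev b y *\<^sub>R x"
  using act_product[OF assms(1,2) ident_transf Eff_transf[OF assms(3)]]
  by (simp add: seq_eq_ev[OF assms(3,2)] seq_ident[OF St_transf[OF assms(1)]] par_unit[OF St_transf[OF assms(1)]])

lemma ev_product:
  assumes "x \<in> St A" "y \<in> St B" "a \<in> Eff A" "b \<in> Eff B"
  shows "ev (a \<otimes> b) (x \<otimes> y) = ev a x * ev b y"
  using ev_reduce_left[OF state_par[OF assms(1,2)] assms(3,4)] reduce_product_left[OF assms(1,2,3)] by simp

lemma marginal1_state: "\<Psi> \<in> St (A \<star> B) \<Longrightarrow> marginal1 \<Theta> A B \<Psi> \<in> St A"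
  unfolding marginal1_def by (rule reduce_right) auto

lemma marginal2_state: "\<Psi> \<in> St (A \<star> B) \<Longrightarrow> marginal2 \<Theta> A B \<Psi> \<in> St B"
  unfolding marginal2_def by (rule reduce_left) auto

lemma ev_discard_reduce:
  assumes "\<Psi> \<in> St (A \<star> B)"
  shows "a \<in> Eff A \<Longrightarrow> ev (u B) ((a \<otimes> \<I> B) \<odot> \<Psi>) = ev a (marginal1 \<Theta> A B \<Psi>)"
    and "b \<in> Eff B \<Longrightarrow> ev (u A) ((\<I> A \<otimes> b) \<odot> \<Psi>) = ev b (marginal2 \<Theta> A B \<Psi>)"
  using assms by (simp_all add: ev_reduce_left ev_reduce_right marginal1_def marginal2_def)

lemma ev_discard_marginal:
  assumes "\<Psi> \<in> St (A \<star> B)"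
  shows "ev (u A) (marginal1 \<Theta> A B \<Psi>) = ev (u (A \<star> B)) \<Psi>"
    and "ev (u B) (marginal2 \<Theta> A B \<Psi>) = ev (u (A \<star> B)) \<Psi>"
  using assms by (simp_all add: marginal1_def marginal2_def ev_reduce_left ev_reduce_right discard_par)

lemma normalised_marginal:
  assumes "normal (A \<star> B) \<Psi>"
  shows "normal A (marginal1 \<Theta> A B \<Psi>)" "normal B (marginal2 \<Theta> A B \<Psi>)"
  using assms ev_discard_marginal marginal1_state marginal2_state by (auto simp: normalised_iff)

text \<open>The composition rule for swaps, taken at trivial systems, makes this swap idempotent;
  being invertible, it is the identity.\<close>

lemma swap_unit: "swp \<Theta> A \<one> = \<I> A" "swp \<Theta> \<one> A = \<I> A"
proof -
  have t: "swp \<Theta> A \<one> \<in> Tr A A" "swp \<Theta> \<one> A \<in> Tr A A"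
    using swap_transf[of A \<one>] swap_transf[of \<one> A] by (simp_all add: composite_unit)
  have inv: "swp \<Theta> \<one> A \<odot> swp \<Theta> A \<one> = \<I> A" using swap_swap[of \<one> A] by (simp add: composite_unit)
  have "swp \<Theta> A \<one> = swp \<Theta> A \<one> \<odot> swp \<Theta> A \<one>"
    using swap_composite[of A \<one> \<one>] t par_unit by (simp add: composite_unit)
  then have "swp \<Theta> \<one> A \<odot> swp \<Theta> A \<one> = (swp \<Theta> \<one> A \<odot> swp \<Theta> A \<one>) \<odot> swp \<Theta> A \<one>"
    using seq_assoc[OF t(1,1,2)] by simp
  then show "swp \<Theta> A \<one> = \<I> A" using inv t seq_ident by simp
  then show "swp \<Theta> \<one> A = \<I> A" using inv t seq_ident by simp
qed

lemma swap_act: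
  assumes "\<Psi> \<in> St (A \<star> B)" "f \<in> Tr A C" "g \<in> Tr B D"
  shows "swp \<Theta> C D \<odot> ((f \<otimes> g) \<odot> \<Psi>) = (g \<otimes> f) \<odot> (swp \<Theta> A B \<odot> \<Psi>)"
  using seq_act[OF assms(1) transf_par[OF assms(2,3)] swap_transf]
    seq_act[OF assms(1) swap_transf transf_par[OF assms(3,2)]]
  by (simp add: swap_natural[OF assms(2,3)])

lemma swap_swap_act: "\<Psi> \<in> St (A \<star> B) \<Longrightarrow> swp \<Theta> B A \<odot> (swp \<Theta> A B \<odot> \<Psi>) = \<Psi>"
  using seq_act[OF _ swap_transf swap_transf] by (simp add: swap_swap seq_ident[OF St_transf])

lemma swap_reduce:
  assumes "\<Psi> \<in> St (A \<star> B)"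
  shows "a \<in> Eff A \<Longrightarrow> (\<I> B \<otimes> a) \<odot> (swp \<Theta> A B \<odot> \<Psi>) = (a \<otimes> \<I> B) \<odot> \<Psi>"
    and "b \<in> Eff B \<Longrightarrow> (b \<otimes> \<I> A) \<odot> (swp \<Theta> A B \<odot> \<Psi>) = (\<I> A \<otimes> b) \<odot> \<Psi>"
  using swap_act[OF assms Eff_transf ident_transf, of a] swap_act[OF assms ident_transf Eff_transf, of b]
    reduce_left[OF assms, of a] reduce_right[OF assms, of b]
  by (simp_all add: swap_unit seq_ident[OF St_transf])

lemma marginal_swap:
  assumes "\<Psi> \<in> St (A \<star> B)"
  shows "marginal1 \<Theta> B A (swp \<Theta> A B \<odot> \<Psi>) = marginal2 \<Theta> A B \<Psi>"
    and "marginal2 \<Theta> B A (swp \<Theta> A B \<odot> \<Psi>) = marginal1 \<Theta> A B \<Psi>"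
  using swap_reduce[OF assms] by (simp_all add: marginal1_def marginal2_def)

lemma effect_le_discard:
  assumes "a \<in> Eff A" "x \<in> St A"
  shows "ev a x \<le> ev (u A) x"
  using ev_bounds(1)[OF effect_complement(2)[OF assms(1)] assms(2)] by (simp add: ev_diff)

section \<open>Reversible channels and their compactness\<close>

lemma reversible_channel: "reversible \<Theta> A B V \<Longrightarrow> channel \<Theta> A B V"
  by (simp add: reversible_def)

lemma reversible_transf: "reversible \<Theta> A B V \<Longrightarrow> V \<in> Tr A B"
  using reversible_channel channel_transf by blast

lemma reversible_swap: "reversible \<Theta> (A \<star> B) (B \<star> A) (swp \<Theta> A B)"
  unfolding reversible_def using swap_swap channel_swap by blast

lemma reversible_ident: "reversible \<Theta> A A (\<I> A)"
  unfolding reversible_def using seq_ident[OF ident_transf] channel_ident by blast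

lemma reversible_par:
  assumes "reversible \<Theta> A B V" "reversible \<Theta> A' B' V'"
  shows "reversible \<Theta> (A \<star> A') (B \<star> B') (V \<otimes> V')"
proof -
  obtain W W' where W: "channel \<Theta> B A W" "W \<odot> V = \<I> A" "V \<odot> W = \<I> B"
      "channel \<Theta> B' A' W'" "W' \<odot> V' = \<I> A'" "V' \<odot> W' = \<I> B'"
    using assms unfolding reversible_def by blast
  have "(W \<otimes> W') \<odot> (V \<otimes> V') = \<I> (A \<star> A')" "(V \<otimes> V') \<odot> (W \<otimes> W') = \<I> (B \<star> B')"
    using interchange[of V A B W A V' A' B' W' A'] interchange[of W B A V B W' B' A' V' B'] W assms
    by (simp_all add: reversible_transf channel_transf par_ident)
  then show ?thesis
    unfolding reversible_def using channel_par W assms reversible_channel by blast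
qed

lemma ev_discard_seq_le: "f \<in> Tr A B \<Longrightarrow> x \<in> St A \<Longrightarrow> ev (u B) (f \<odot> x) \<le> ev (u A) x"
  using ev_seq[OF _ discard_effect] effect_le_discard[OF effect_seq[OF discard_effect]] by metis

text \<open>The complementary outcome \<open>E\<close> never occurs, not even in the presence of a
  reference system, so it sends every state to zero and is itself zero.\<close>

lemma channelI:
  assumes f: "f \<in> Tr A B" and uf: "u B \<odot> f = u A"
  shows "channel \<Theta> A B f"
proof -
  obtain E where t: "[f, E] \<in> Tests A B" using transf_test2[OF f] .
  have E: "E \<in> Tr A B" using t by (rule transfI) simp
  have "[u B \<odot> f, u B \<odot> E] \<in> Tests A \<one>" using tests_post[OF t] discard_channel by (simp add: channel_def)
  then have uE: "u B \<odot> E = 0" using observation_test_sum[of "[u B \<odot> f, u B \<odot> E]" A] uf by simp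
  have z: "0 \<in> Tr A B" using transf_scale[OF f, of 0] by simp
  have "E = 0"
  proof (rule transf_eqI[OF E z])
    fix R \<rho> assume \<rho>: "\<rho> \<in> St (A \<star> R)"
    have "ev (u (B \<star> R)) ((E \<otimes> \<I> R) \<odot> \<rho>) = ev (u B) (marginal1 \<Theta> B R ((E \<otimes> \<I> R) \<odot> \<rho>))"
      using ev_discard_marginal(1)[OF state_act_left[OF \<rho> E]] by simp
    also have "\<dots> = ev (u R) ((u B \<otimes> \<I> R) \<odot> ((E \<otimes> \<I> R) \<odot> \<rho>))"
      using ev_discard_reduce(1)[OF state_act_left[OF \<rho> E] discard_effect] by simp
    also have "\<dots> = 0" using act_left_left[OF \<rho> E discard_transf] by (simp add: uE)
    finally show "(E \<otimes> \<I> R) \<odot> \<rho> = (0 \<otimes> \<I> R) \<odot> \<rho>"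
      using state_zero_norm[OF state_act_left[OF \<rho> E]] by simp
  qed
  then show ?thesis using coarse_grain_total[OF t] by (simp add: channel_def)
qed

text \<open>The norm of a state increases neither under \<open>V\<close> nor under its inverse, so
  both preserve it and are deterministic. Reversibility thereby becomes a system of continuous
  equations between transformations.\<close>

lemma reversible_iff:
  "reversible \<Theta> A B V \<longleftrightarrow> V \<in> Tr A B \<and> (\<exists>W\<in>Tr B A. W \<odot> V = \<I> A \<and> V \<odot> W = \<I> B)"
proof
  have ch: "channel \<Theta> A B V" if V: "V \<in> Tr A B" and W: "W \<in> Tr B A" "W \<odot> V = \<I> A" for V W A B
  proof (rule channelI[OF V], rule effect_eqI)
    fix \<rho> assume \<rho>: "\<rho> \<in> St A"
    have "ev (u A) (W \<odot> (V \<odot> \<rho>)) = ev (u A) \<rho>"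
      using seq_act[OF \<rho> V W(1)] W(2) seq_ident(2)[OF St_transf[OF \<rho>]] by simp
    then have "ev (u B) (V \<odot> \<rho>) = ev (u A) \<rho>"
      using ev_discard_seq_le[OF V \<rho>] ev_discard_seq_le[OF W(1) state_seq[OF \<rho> V]] by simp
    then show "pairing \<Theta> (u B \<odot> V) \<rho> = pairing \<Theta> (u A) \<rho>"
      using ev_seq[OF V discard_effect \<rho>] pairing_effect[OF effect_seq[OF discard_effect V] \<rho>]
        pairing_effect[OF discard_effect \<rho>] by simp
  qed (use effect_seq[OF discard_effect V] in auto)
  show "reversible \<Theta> A B V" if "V \<in> Tr A B \<and> (\<exists>W\<in>Tr B A. W \<odot> V = \<I> A \<and> V \<odot> W = \<I> B)"
    using that ch unfolding reversible_def by blast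
  show "V \<in> Tr A B \<and> (\<exists>W\<in>Tr B A. W \<odot> V = \<I> A \<and> V \<odot> W = \<I> B)" if "reversible \<Theta> A B V"
    using that channel_transf unfolding reversible_def by blast
qed

text \<open>Recording the inverse together with the channel makes the set closed without asking
  whether inversion is continuous.\<close>

definition mutual_inverses :: "'s \<Rightarrow> ('t \<times> 't) set" where
  "mutual_inverses A = {z \<in> Tr A A \<times> Tr A A. snd z \<odot> fst z = \<I> A \<and> fst z \<odot> snd z = \<I> A}"

lemma compact_mutual_inverses: "compact (mutual_inverses A)"
proof -
  let ?T = "Tr A A \<times> Tr A A"
  have c1: "continuous_on ?T (\<lambda>z. snd z \<odot> fst z)"
    using seq_continuous[of A A A] by (simp add: case_prod_beta)
  have "continuous_on ?T (\<lambda>z. (\<lambda>z. snd z \<odot> fst z) (snd z, fst z))"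
    by (rule continuous_on_compose2[OF c1]) (auto intro!: continuous_intros)
  then have c2: "continuous_on ?T (\<lambda>z. fst z \<odot> snd z)" by simp
  have cl: "closed ?T" using closed_transf closed_Times by blast
  have "closed ({z \<in> ?T. snd z \<odot> fst z = \<I> A} \<inter> {z \<in> ?T. fst z \<odot> snd z = \<I> A})"
    by (intro closed_Int continuous_closed_preimage_constant c1 c2 cl)
  from compact_Int_closed[OF compact_Times[OF compact_transf compact_transf] this]
  have "compact (?T \<inter> ({z \<in> ?T. snd z \<odot> fst z = \<I> A} \<inter> {z \<in> ?T. fst z \<odot> snd z = \<I> A}))" .
  moreover have "mutual_inverses A = ?T \<inter> ({z \<in> ?T. snd z \<odot> fst z = \<I> A} \<inter> {z \<in> ?T. fst z \<odot> snd z = \<I> A})"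
    by (auto simp: mutual_inverses_def)
  ultimately show ?thesis by simp
qed

lemma mutual_inverses_reversible: "reversible \<Theta> A A V \<longleftrightarrow> (\<exists>W. (V, W) \<in> mutual_inverses A)"
  by (auto simp: reversible_iff mutual_inverses_def)

text \<open>Finitely many elements of \<open>N\<close> span the others, and their average dominates all of them.\<close>

lemma internal_mixture:
  assumes "N \<noteq> {}" "\<And>\<sigma>. \<sigma> \<in> N \<Longrightarrow> normal A \<sigma>"
  obtains \<omega> where "normal A \<omega>" "\<And>\<sigma>. \<sigma> \<in> N \<Longrightarrow> \<exists>l>0. \<exists>\<tau>\<in>St A. \<omega> = l *\<^sub>R \<sigma> + \<tau>"
    "\<And>f c. linear f \<Longrightarrow> (\<And>\<sigma>. \<sigma> \<in> N \<Longrightarrow> f \<sigma> = (c::real)) \<Longrightarrow> f \<omega> = c"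
proof -
  obtain B where B: "B \<subseteq> N" "independent B" "N \<subseteq> span B" using maximal_independent_subset by blast
  obtain F where F: "finite F" "Tr \<one> A \<subseteq> span F" using finite_dimensional by blast
  have "B \<subseteq> span F" using B(1) F(2) assms(2) by (auto simp: normalised_iff states_def)
  then have fin: "finite B" using independent_span_bound[OF F(1) B(2)] by simp
  obtain \<sigma>\<^sub>0 where \<sigma>\<^sub>0: "\<sigma>\<^sub>0 \<in> N" using assms(1) by blast
  have "\<sigma>\<^sub>0 \<noteq> 0" using assms(2)[OF \<sigma>\<^sub>0] by (auto simp: normalised_iff)
  then have ne: "B \<noteq> {}" using B(3) \<sigma>\<^sub>0 by auto
  define n where "n = real (card B)"
  have n: "n > 0" using fin ne by (simp add: n_def card_gt_0_iff)
  have Bn: "normal A b" if "b \<in> B" for b using B(1) assms(2) that by blast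
  define \<omega> where "\<omega> = (\<Sum>b\<in>B. (1 / n) *\<^sub>R b)"
  have lin: "f \<omega> = c" if "linear f" "\<And>\<sigma>. \<sigma> \<in> N \<Longrightarrow> f \<sigma> = (c::real)" for f c
  proof -
    have "f \<omega> = (\<Sum>b\<in>B. (1 / n) * f b)" by (simp add: \<omega>_def linear_sum[OF that(1)] linear_cmul[OF that(1)])
    also have "\<dots> = (\<Sum>b\<in>B. (1 / n) * c)" using B(1) that(2) by (intro sum.cong) auto
    also have "\<dots> = c" using n by (simp add: n_def)
    finally show ?thesis .
  qed
  have u\<omega>: "ev (u A) \<omega> = 1" using assms(2) by (intro lin[OF ev_linear_right]) (simp add: normalised_iff)
  have "\<omega> \<in> St A"
    unfolding \<omega>_def using fin ne Bn n u\<omega>[unfolded \<omega>_def]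
    by (intro state_combination) (auto simp: normalised_iff)
  then have n\<omega>: "normal A \<omega>" using u\<omega> by (simp add: normalised_iff)
  have dom: "\<exists>l>0. \<exists>\<tau>\<in>St A. \<omega> = l *\<^sub>R \<sigma> + \<tau>" if \<sigma>: "\<sigma> \<in> N" for \<sigma>
  proof -
    have "\<sigma> \<in> range (\<lambda>c. \<Sum>b\<in>B. c b *\<^sub>R b)" using \<sigma> B(3) span_finite[OF fin] by blast
    then obtain c where c: "\<sigma> = (\<Sum>b\<in>B. c b *\<^sub>R b)" by (rule rangeE) (rule that)
    \<comment> \<open>Small enough that \<open>l * c b \<le> 1 / n\<close> for every
      \<open>b\<close>, so the remainder \<tau> has nonnegative coefficients; the summand 1 keeps
      the denominator positive.\<close>
    define l where "l = 1 / (n * (1 + (\<Sum>b\<in>B. \<bar>c b\<bar>)))"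
    have K: "1 + (\<Sum>b\<in>B. \<bar>c b\<bar>) > 0" by (simp add: add_pos_nonneg sum_nonneg)
    then have l: "l > 0" using n by (simp add: l_def)
    have le: "l * c b \<le> 1 / n" if "b \<in> B" for b
    proof -
      have "\<bar>c b\<bar> \<le> (\<Sum>b\<in>B. \<bar>c b\<bar>)" using fin that by (intro member_le_sum) auto
      then have "c b \<le> 1 + (\<Sum>b\<in>B. \<bar>c b\<bar>)" by linarith
      then have "l * c b \<le> l * (1 + (\<Sum>b\<in>B. \<bar>c b\<bar>))" using l by simp
      also have "\<dots> = 1 / n" using K n by (simp add: l_def)
      finally show ?thesis .
    qed
    define \<tau> where "\<tau> = (\<Sum>b\<in>B. (1 / n - l * c b) *\<^sub>R b)"
    have eq: "\<omega> = l *\<^sub>R \<sigma> + \<tau>"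
      by (simp add: \<omega>_def c \<tau>_def scaleR_sum_right scaleR_diff_left sum_subtractf)
    have "ev (u A) \<omega> = l + ev (u A) \<tau>" using assms(2)[OF \<sigma>] by (simp add: eq ev_add normalised_iff)
    then have "ev (u A) \<tau> \<le> 1" using u\<omega> l by simp
    then have "\<tau> \<in> St A"
      unfolding \<tau>_def using fin ne Bn le by (intro state_combination) (auto simp: normalised_iff)
    then show ?thesis using eq l by blast
  qed
  show thesis using that n\<omega> dom lin by blast
qed

end

context sharp_theory_with_purification
begin

subsection \<open>Purification\<close>

lemma ex_normalised: "\<exists>\<rho>. normal A \<rho>"
proof -
  obtain a \<rho> where "pure \<Theta> A \<one> a" "\<rho> \<in> St A" "pairing \<Theta> a \<rho> = 1" using pure_sharpness by blast
  moreover from this have "a \<in> Eff A" using pure_transf by (simp add: effects_def)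
  ultimately have "\<rho> \<noteq> 0" using pairing_effect by fastforce
  then show ?thesis using state_normalise[OF \<open>\<rho> \<in> St A\<close>] by blast
qed

lemma observation_sum: "as \<in> Tests A \<one> \<Longrightarrow> sum_list as = u A"
proof (rule observation_test_sum)
  assume as: "as \<in> Tests A \<one>"
  obtain \<rho> where "normal A \<rho>" using ex_normalised by blast
  then have "map (\<lambda>a. a \<odot> \<rho>) as \<in> Tests \<one> \<one>" using tests_pre[OF normalised_test as] by blast
  then show "as \<noteq> []" by (auto simp: scalar_tests)
qed

text \<open>Dilation writes the ensemble as a deterministic state of \<open>A \<star> X\<close>
  measured on \<open>X\<close>. After this state is purified with \<open>Y\<close>, the same
  ensemble arises by measuring \<open>X\<close> and discarding \<open>Y\<close>.\<close>

lemma ensemble_purification: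
  assumes "Cs \<in> Tests \<one> A"
  obtains B \<Psi> bs where "pure_state \<Theta> (A \<star> B) \<Psi>" "bs \<in> Tests B \<one>" "Cs = map (\<lambda>b. (\<I> A \<otimes> b) \<odot> \<Psi>) bs"
proof -
  obtain X T es where T: "channel \<Theta> \<one> (A \<star> X) T" "es \<in> Tests X \<one>" "Cs = map (\<lambda>e. (\<I> A \<otimes> e) \<odot> T) es"
    using dilation[OF assms] by blast
  then have "normal (A \<star> X) T" by (simp add: normalised_iff_channel)
  then obtain Y \<Psi> where \<Psi>: "pure_state \<Theta> ((A \<star> X) \<star> Y) \<Psi>" "marginal1 \<Theta> (A \<star> X) Y \<Psi> = T"
    using purification_exists by blast
  then have st: "\<Psi> \<in> St ((A \<star> X) \<star> Y)" by (simp add: pure_state_def normalised_iff)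
  let ?bs = "map (\<lambda>e. e \<otimes> u Y) es"
  have "?bs \<in> Tests (X \<star> Y) \<one>"
    using parallel[OF T(2), of "[u Y]" Y \<one>] discard_channel[of Y]
    by (simp add: channel_def composite_unit concat_map_singleton)
  moreover have "(\<I> A \<otimes> e) \<odot> T = (\<I> A \<otimes> (e \<otimes> u Y)) \<odot> \<Psi>" if "e \<in> set es" for e
  proof -
    have e: "e \<in> Tr X \<one>" using T(2) that by (rule transfI)
    have ie: "\<I> A \<otimes> e \<in> Tr (A \<star> X) A" using transf_par[OF ident_transf e] by (simp add: composite_unit)
    have "(\<I> A \<otimes> e) \<odot> T = ((\<I> A \<otimes> e) \<otimes> u Y) \<odot> \<Psi>"
      using act_left_right[OF st ie discard_transf] \<Psi>(2) by (simp add: marginal1_def par_unit[OF ie])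
    then show ?thesis using par_assoc[OF ident_transf e discard_transf] by simp
  qed
  then have "Cs = map (\<lambda>b. (\<I> A \<otimes> b) \<odot> \<Psi>) ?bs" using T(3) by simp
  ultimately show thesis using that[of "X \<star> Y" \<Psi> ?bs] \<Psi>(1) by (simp add: composite_assoc)
qed

lemma pure_state_normalised: "pure_state \<Theta> A \<alpha> \<Longrightarrow> normal A \<alpha>"
  by (simp add: pure_state_def)

lemma pure_state_St: "pure_state \<Theta> A \<alpha> \<Longrightarrow> \<alpha> \<in> St A"
  by (simp add: pure_state_def normalised_iff)

text \<open>After division by \<open>p\<close> the two summands form an ensemble of \<psi> itself,
  to which purity applies. If \<open>p\<close> is not positive, both summands have norm
  zero.\<close>

lemma pure_state_decompose:
  assumes "pure_state \<Theta> A \<psi>" "x \<in> St A" "y \<in> St A" "x + y = p *\<^sub>R \<psi>"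
  shows "x = ev (u A) x *\<^sub>R \<psi>"
proof (cases "p > 0")
  case True
  have n: "ev (u A) x + ev (u A) y = p"
    using assms(1,4) ev_add[of "u A"] by (simp add: pure_state_def normalised_iff flip: ev_add(1))
  have nn: "0 \<le> ev (u A) x" "0 \<le> ev (u A) y" using ev_bounds(1)[OF discard_effect] assms by auto
  let ?x = "(1 / p) *\<^sub>R x" and ?y = "(1 / p) *\<^sub>R y"
  have st: "?x \<in> St A" "?y \<in> St A" using assms True n nn by (auto intro!: scaled_state simp: divide_le_eq)
  have "[?x, ?y, 0] \<in> Tests \<one> A"
    using st True n zero_state[OF st(1)] by (intro ensemble_test) (auto simp: add_divide_distrib[symmetric])
  moreover have "\<psi> = ?x + ?y" using assms(4) True by (simp flip: scaleR_add_right)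
  ultimately obtain c where "?x = c *\<^sub>R \<psi>" using assms(1) unfolding pure_state_def pure_iff by blast
  then have x: "x = (p * c) *\<^sub>R \<psi>" using True by (metis divide_self_if less_irrefl scaleR_one scaleR_scaleR times_divide_eq_right mult.right_neutral)
  then have "ev (u A) x = p * c" using assms(1) by (simp add: pure_state_def normalised_iff)
  then show ?thesis using x by simp
next
  case False
  have "ev (u A) x + ev (u A) y = p"
    using assms(1,4) by (simp add: pure_state_def normalised_iff flip: ev_add(1))
  moreover have "0 \<le> ev (u A) x" "0 \<le> ev (u A) y" using ev_bounds(1)[OF discard_effect] assms by auto
  ultimately have "ev (u A) x = 0" using False by linarith
  then show ?thesis using state_zero_norm[OF assms(2)] by simp
qed

text \<open>Suppose \<open>D\<close> occurs in a decomposition of the identity. On a purification it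
  acts as a multiple, by purity. To see that the factor does not depend on the state, two states are
  put into one ensemble: \<open>D\<close> multiplies the purification of the ensemble by
  \<open>c\<close>, and measuring the purifying system gives the same \<open>c\<close> for
  both.\<close>

lemma pure_ident: "pure \<Theta> A A (\<I> A)"
  unfolding pure_iff
proof (intro conjI allI impI)
  fix D E G assume t: "[D, E, G] \<in> Tests A A" and DE: "\<I> A = D + E"
  have D: "D \<in> Tr A A" using t by (rule transfI) simp
  have same: "\<exists>c. (D \<otimes> \<I> R) \<odot> \<sigma> = c *\<^sub>R \<sigma> \<and> (D \<otimes> \<I> R) \<odot> \<tau> = c *\<^sub>R \<tau>"
    if \<sigma>: "normal (A \<star> R) \<sigma>" and \<tau>: "normal (A \<star> R) \<tau>" for R \<sigma> \<tau>
  proof -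
    let ?S = "A \<star> R" and ?D = "D \<otimes> \<I> R"
    have D': "?D \<in> Tr ?S ?S" using transf_par[OF D ident_transf] .
    have "[(1/2) *\<^sub>R \<sigma>, (1/2) *\<^sub>R \<tau>] \<in> Tests \<one> ?S"
      using \<sigma> \<tau> by (intro ensemble_test) (auto simp: normalised_iff intro!: scaled_state)
    then obtain B \<Psi> bs where \<Psi>: "pure_state \<Theta> (?S \<star> B) \<Psi>" "bs \<in> Tests B \<one>"
        "[(1/2) *\<^sub>R \<sigma>, (1/2) *\<^sub>R \<tau>] = map (\<lambda>b. (\<I> ?S \<otimes> b) \<odot> \<Psi>) bs"
      by (rule ensemble_purification)
    have st: "\<Psi> \<in> St (?S \<star> B)" using \<Psi>(1) by (rule pure_state_St)
    have tt: "[(D \<otimes> \<I> R) \<otimes> \<I> B, (E \<otimes> \<I> R) \<otimes> \<I> B, (G \<otimes> \<I> R) \<otimes> \<I> B] \<in> Tests (?S \<star> B) (?S \<star> B)"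
      using tests_par_right[OF tests_par_right[OF t]] by simp
    have mem: "X \<in> {D, E, G} \<Longrightarrow> ((X \<otimes> \<I> R) \<otimes> \<I> B) \<odot> \<Psi> \<in> St (?S \<star> B)" for X
      using state_seq[OF st transfI[OF tt]] by auto
    have "((D \<otimes> \<I> R) \<otimes> \<I> B) \<odot> \<Psi> + ((E \<otimes> \<I> R) \<otimes> \<I> B) \<odot> \<Psi> = (((D + E) \<otimes> \<I> R) \<otimes> \<I> B) \<odot> \<Psi>"
      by (simp add: par_add seq_add)
    also have "\<dots> = 1 *\<^sub>R \<Psi>" unfolding DE[symmetric] by (simp add: par_ident seq_ident(2)[OF St_transf[OF st]])
    finally obtain c where c: "((D \<otimes> \<I> R) \<otimes> \<I> B) \<odot> \<Psi> = c *\<^sub>R \<Psi>"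
      using pure_state_decompose[OF \<Psi>(1)] mem by blast
    have *: "?D \<odot> ((\<I> ?S \<otimes> b) \<odot> \<Psi>) = c *\<^sub>R ((\<I> ?S \<otimes> b) \<odot> \<Psi>)" if "b \<in> set bs" for b
    proof -
      have b: "b \<in> Tr B \<one>" using \<Psi>(2) that by (rule transfI)
      have "?D \<odot> ((\<I> ?S \<otimes> b) \<odot> \<Psi>) = (\<I> ?S \<otimes> b) \<odot> ((?D \<otimes> \<I> B) \<odot> \<Psi>)"
        using act_left_right[OF st D' b] act_right_left[OF st D' b] by (simp add: par_unit[OF D'])
      then show ?thesis by (simp add: c)
    qed
    obtain b1 b2 where bs: "bs = [b1, b2]" using \<Psi>(3) by (cases bs; cases "tl bs") auto
    have "?D \<odot> ((1/2) *\<^sub>R \<sigma>) = c *\<^sub>R ((1/2) *\<^sub>R \<sigma>)" "?D \<odot> ((1/2) *\<^sub>R \<tau>) = c *\<^sub>R ((1/2) *\<^sub>R \<tau>)"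
      using *[of b1] *[of b2] \<Psi>(3) by (simp_all add: bs)
    then have "(1/2) *\<^sub>R (?D \<odot> \<sigma>) = (1/2) *\<^sub>R (c *\<^sub>R \<sigma>)" "(1/2) *\<^sub>R (?D \<odot> \<tau>) = (1/2) *\<^sub>R (c *\<^sub>R \<tau>)"
      by simp_all
    then have "?D \<odot> \<sigma> = c *\<^sub>R \<sigma> \<and> ?D \<odot> \<tau> = c *\<^sub>R \<tau>"
      unfolding real_vector.scale_cancel_left by simp
    then show ?thesis by blast
  qed
  \<comment> \<open>The factor is fixed on one state \<alpha> without reference system; comparison
    with the product states \<open>\<alpha> \<otimes> r\<close> carries it to every reference
    system.\<close>
  obtain \<alpha> where \<alpha>: "normal A \<alpha>" using ex_normalised by blast
  obtain k where k: "(D \<otimes> \<I> \<one>) \<odot> \<alpha> = k *\<^sub>R \<alpha>" using same[of \<one> \<alpha> \<alpha>] \<alpha> by (auto simp: composite_unit)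
  then have k': "D \<odot> \<alpha> = k *\<^sub>R \<alpha>" by (simp add: par_unit[OF D])
  have "ev (u A) (D \<odot> \<alpha>) = k" using \<alpha> by (simp add: k' normalised_iff)
  then have k01: "0 \<le> k" "k \<le> 1"
    using ev_bounds[OF discard_effect state_seq[OF normalised_St[OF \<alpha>] D]] by auto
  have all: "(D \<otimes> \<I> R) \<odot> \<sigma> = k *\<^sub>R \<sigma>" if \<sigma>: "normal (A \<star> R) \<sigma>" for R \<sigma>
  proof -
    obtain r where r: "normal R r" using ex_normalised by blast
    obtain c where c: "(D \<otimes> \<I> R) \<odot> \<sigma> = c *\<^sub>R \<sigma>" "(D \<otimes> \<I> R) \<odot> (\<alpha> \<otimes> r) = c *\<^sub>R (\<alpha> \<otimes> r)"
      using same[OF \<sigma> normalised_par[OF \<alpha> r]] by blast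
    have "(D \<otimes> \<I> R) \<odot> (\<alpha> \<otimes> r) = k *\<^sub>R (\<alpha> \<otimes> r)"
      using act_product[OF normalised_St[OF \<alpha>] normalised_St[OF r] D ident_transf] k'
      by (simp add: seq_ident[OF St_transf[OF normalised_St[OF r]]])
    moreover have "\<alpha> \<otimes> r \<noteq> 0" using normalised_par[OF \<alpha> r] by (auto simp: normalised_iff)
    ultimately have "c = k" using c(2) by simp
    then show ?thesis using c(1) by simp
  qed
  have "D = k *\<^sub>R \<I> A"
  proof (rule transf_eqI[OF D transf_scale[OF ident_transf k01]])
    fix R \<rho> assume \<rho>: "\<rho> \<in> St (A \<star> R)"
    show "(D \<otimes> \<I> R) \<odot> \<rho> = ((k *\<^sub>R \<I> A) \<otimes> \<I> R) \<odot> \<rho>"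
    proof (cases "\<rho> = 0")
      case False
      then obtain \<sigma> c where "normal (A \<star> R) \<sigma>" "\<rho> = c *\<^sub>R \<sigma>" using state_normalise[OF \<rho>] by metis
      then show ?thesis using all by (simp add: act_ident normalised_iff)
    next
      case True
      then show ?thesis by simp
    qed
  qed
  then show "\<exists>c. D = c *\<^sub>R \<I> A" by blast
qed simp

lemma pure_reversible:
  assumes "reversible \<Theta> A B V"
  shows "pure \<Theta> A B V"
  unfolding pure_iff
proof (intro conjI allI impI)
  show "V \<in> Tr A B" using assms by (rule reversible_transf)
  obtain W where W: "channel \<Theta> B A W" "W \<odot> V = \<I> A" "V \<odot> W = \<I> B" using assms unfolding reversible_def by blast
  fix D E G assume t: "[D, E, G] \<in> Tests A B" and DE: "V = D + E"
  have D: "D \<in> Tr A B" using t by (rule transfI) simp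
  have "[W \<odot> D, W \<odot> E, W \<odot> G] \<in> Tests A A" using tests_post[OF t] W(1) by (simp add: channel_def)
  moreover have "\<I> A = W \<odot> D + W \<odot> E" using W(2) by (simp add: DE seq_add)
  ultimately obtain c where "W \<odot> D = c *\<^sub>R \<I> A" using pure_ident unfolding pure_iff by blast
  then have "V \<odot> (W \<odot> D) = c *\<^sub>R V" by (simp add: seq_ident[OF reversible_transf[OF assms]])
  moreover have "V \<odot> (W \<odot> D) = D"
    using seq_assoc[OF D channel_transf[OF W(1)] reversible_transf[OF assms]] W(3) seq_ident(2)[OF D] by simp
  ultimately show "\<exists>c. D = c *\<^sub>R V" by metis
qed

lemma pure_state_transf: "pure_state \<Theta> A \<alpha> \<Longrightarrow> pure \<Theta> \<one> A \<alpha>"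
  by (simp add: pure_state_def)

lemma pure_state_reversible: "pure_state \<Theta> A \<alpha> \<Longrightarrow> reversible \<Theta> A B V \<Longrightarrow> pure_state \<Theta> B (V \<odot> \<alpha>)"
  unfolding pure_state_def
  using purity_preservation_seq pure_reversible normalised_seq reversible_channel by blast

lemma pure_state_par: "pure_state \<Theta> A \<alpha> \<Longrightarrow> pure_state \<Theta> B \<beta> \<Longrightarrow> pure_state \<Theta> (A \<star> B) (\<alpha> \<otimes> \<beta>)"
  unfolding pure_state_def
  using purity_preservation_par[of \<one> A \<alpha> \<one> B \<beta>] normalised_par by (simp add: composite_unit)

lemma pure_reduce_left:
  assumes "pure \<Theta> A C f" "pure_state \<Theta> (A \<star> B) \<Psi>"
  shows "pure \<Theta> \<one> (C \<star> B) ((f \<otimes> \<I> B) \<odot> \<Psi>)"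
  using assms purity_preservation_seq purity_preservation_par pure_ident by (blast dest: pure_state_transf)

lemma ex_pure_state: "\<exists>\<alpha>. pure_state \<Theta> A \<alpha>"
proof -
  obtain \<rho> where "normal A \<rho>" using ex_normalised by blast
  then show ?thesis using pure_state_in_face[of "{}" A \<rho>] by blast
qed

lemma marginal_product:
  assumes "normal A x" "normal B y"
  shows "marginal1 \<Theta> A B (x \<otimes> y) = x" "marginal2 \<Theta> A B (x \<otimes> y) = y"
  using reduce_product_left[of x A y B "u A"] reduce_product_right[of x A y B "u B"] assms
  by (simp_all add: marginal1_def marginal2_def normalised_iff)

text \<open>All pure states of \<open>A\<close> are purifications of the number one on the trivial
  system, so uniqueness of purification relates them.\<close>

lemma pure_transitive:
  assumes "pure_state \<Theta> A \<alpha>" "pure_state \<Theta> A \<beta>"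
  obtains V where "reversible \<Theta> A A V" "\<beta> = V \<odot> \<alpha>"
proof -
  have m: "marginal1 \<Theta> \<one> A x = \<I> \<one>" if "pure_state \<Theta> A x" for x
    using that seq_eq_ev[OF discard_effect pure_state_St[OF that]]
    by (simp add: marginal1_def par_unit[OF discard_transf] pure_state_def normalised_iff)
  obtain V where V: "reversible \<Theta> A A V" "\<beta> = (\<I> \<one> \<otimes> V) \<odot> \<alpha>"
    using purification_unique[of \<one> A \<alpha> \<beta>] assms m by (auto simp: composite_unit)
  then show thesis using that par_unit(2)[OF reversible_transf[OF V(1)]] by simp
qed

text \<open>The effect steers a purification of \<rho> to a pure state \<beta> of \<open>B\<close>.
  Since its complement never occurs on \<rho>, this \<beta> is the whole marginal on
  \<open>B\<close>. Seen from \<open>B\<close>, the purification therefore has a pure marginal and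
  is equivalent to a product of pure states, which makes \<rho> pure.\<close>

lemma pure_effect_state:
  assumes a: "pure \<Theta> A \<one> a" and \<rho>: "\<rho> \<in> St A" "ev a \<rho> = 1"
  shows "pure_state \<Theta> A \<rho>"
proof -
  have ea: "a \<in> Eff A" using pure_transf[OF a] by (simp add: effects_def)
  have n: "normal A \<rho>"
    using effect_le_discard[OF ea \<rho>(1)] ev_bounds(2)[OF discard_effect \<rho>(1)] \<rho> by (simp add: normalised_iff)
  obtain B \<Psi> where \<Psi>: "pure_state \<Theta> (A \<star> B) \<Psi>" "marginal1 \<Theta> A B \<Psi> = \<rho>"
    using purification_exists[OF n] by blast
  have st: "\<Psi> \<in> St (A \<star> B)" using \<Psi>(1) by (rule pure_state_St)
  define \<beta> where "\<beta> = (a \<otimes> \<I> B) \<odot> \<Psi>"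
  have "pure \<Theta> \<one> B \<beta>" unfolding \<beta>_def using pure_reduce_left[OF a \<Psi>(1)] by (simp add: composite_unit)
  moreover have "ev (u B) \<beta> = 1" unfolding \<beta>_def using ev_discard_reduce(1)[OF st ea] \<Psi>(2) \<rho>(2) by simp
  ultimately have \<beta>: "pure_state \<Theta> B \<beta>"
    using reduce_left[OF st ea] by (simp add: pure_state_def normalised_iff \<beta>_def)
  let ?x = "((u A - a) \<otimes> \<I> B) \<odot> \<Psi>"
  have "ev (u B) ?x = 0"
    using ev_discard_reduce(1)[OF st effect_complement(2)[OF ea]] \<Psi>(2) \<rho>(2) n by (simp add: ev_diff normalised_iff)
  then have "?x = 0" using state_zero_norm reduce_left[OF st effect_complement(2)[OF ea]] by blast
  then have m2: "marginal2 \<Theta> A B \<Psi> = \<beta>" by (simp add: marginal2_def \<beta>_def par_diff seq_diff)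
  obtain \<alpha> where \<alpha>: "pure_state \<Theta> A \<alpha>" using ex_pure_state by blast
  have "pure_state \<Theta> (B \<star> A) (swp \<Theta> A B \<odot> \<Psi>)"
    using pure_state_reversible[OF \<Psi>(1) reversible_swap] .
  moreover have "marginal1 \<Theta> B A (swp \<Theta> A B \<odot> \<Psi>) = marginal1 \<Theta> B A (\<beta> \<otimes> \<alpha>)"
    using marginal_swap(1)[OF st] m2 marginal_product(1) \<alpha> \<beta> by (simp add: pure_state_def)
  ultimately obtain V where V: "reversible \<Theta> A A V" "swp \<Theta> A B \<odot> \<Psi> = (\<I> B \<otimes> V) \<odot> (\<beta> \<otimes> \<alpha>)"
    using purification_unique[of B A "\<beta> \<otimes> \<alpha>"] pure_state_par[OF \<beta> \<alpha>] by metis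
  have "swp \<Theta> A B \<odot> \<Psi> = \<beta> \<otimes> (V \<odot> \<alpha>)"
    using V act_product[OF pure_state_St[OF \<beta>] pure_state_St[OF \<alpha>] ident_transf reversible_transf[OF V(1)]]
    by (simp add: seq_ident[OF St_transf[OF pure_state_St[OF \<beta>]]])
  then have "\<rho> = V \<odot> \<alpha>"
    using marginal_swap(2)[OF st] \<Psi>(2) marginal_product(2)[of B \<beta> A "V \<odot> \<alpha>"] \<beta> pure_state_reversible[OF \<alpha> V(1)]
    by (simp add: pure_state_def)
  then show ?thesis using pure_state_reversible[OF \<alpha> V(1)] by simp
qed

text \<open>The equal mixture is again a state on which the effect is certain, hence pure, so its
  components coincide.\<close>

lemma pure_effect_state_unique:
  assumes a: "pure \<Theta> A \<one> a" and "normal A \<rho>" "normal A \<sigma>" "ev a \<rho> = 1" "ev a \<sigma> = 1"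
  shows "\<rho> = \<sigma>"
proof -
  let ?m = "(1/2) *\<^sub>R \<rho> + (1 - 1/2) *\<^sub>R \<sigma>"
  have "normal A ?m" using assms by (intro normalised_convex) auto
  then have "pure_state \<Theta> A ?m"
    using assms by (intro pure_effect_state[OF a]) (auto simp: normalised_iff ev_add)
  moreover have "(1/2) *\<^sub>R \<rho> \<in> St A" "(1 - 1/2) *\<^sub>R \<sigma> \<in> St A"
    using assms by (auto simp: normalised_iff intro!: scaled_state)
  ultimately have "(1/2) *\<^sub>R \<rho> = ev (u A) ((1/2) *\<^sub>R \<rho>) *\<^sub>R ?m"
    using pure_state_decompose[of A ?m "(1/2) *\<^sub>R \<rho>" "(1 - 1/2) *\<^sub>R \<sigma>" 1] by simp
  then have "(1/2) *\<^sub>R \<rho> = (1/2) *\<^sub>R ?m" using assms by (simp add: normalised_iff)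
  then have "\<rho> = ?m" by simp
  then have "(1/2) *\<^sub>R \<rho> = (1/2) *\<^sub>R \<sigma>"
    by (metis (no_types, lifting) add.commute add_diff_cancel_right' diff_add_cancel field_sum_of_halves scaleR_left_distrib scaleR_one add_left_cancel)
  then show ?thesis by simp
qed

text \<open>The relation between \<open>\<alpha>\<^sup>\<dagger>\<close> and \<alpha>, used as long
  as it is not known that only one effect is so related to a given state.\<close>

definition sharp :: "'a \<Rightarrow> 'b \<Rightarrow> 'b \<Rightarrow> bool" where
  "sharp A a \<alpha> \<longleftrightarrow> pure \<Theta> A \<one> a \<and> pure_state \<Theta> A \<alpha> \<and> ev a \<alpha> = 1"

lemma sharp_effect: "sharp A a \<alpha> \<Longrightarrow> a \<in> Eff A"
  using pure_transf by (simp add: sharp_def effects_def)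

lemma ex_sharp: "\<exists>a \<alpha>. sharp A a \<alpha>"
proof -
  obtain a \<rho> where a: "pure \<Theta> A \<one> a" "\<rho> \<in> St A" "pairing \<Theta> a \<rho> = 1" using pure_sharpness by blast
  moreover from this have "a \<in> Eff A" using pure_transf by (simp add: effects_def)
  ultimately have "ev a \<rho> = 1" using pairing_effect by metis
  then show ?thesis using a pure_effect_state unfolding sharp_def by blast
qed

text \<open>Prepare a pure state, apply the reversible channel of the purification axiom to the padded
  purifications, and discard the padding or project it onto its pure state.\<close>

lemma purification_connect:
  assumes \<Psi>: "pure_state \<Theta> (A \<star> B) \<Psi>" and \<Omega>: "pure_state \<Theta> (A \<star> C) \<Omega>"
    and m: "marginal1 \<Theta> A B \<Psi> = marginal1 \<Theta> A C \<Omega>"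
  shows "\<exists>F P. channel \<Theta> B C F \<and> (\<I> A \<otimes> F) \<odot> \<Psi> = \<Omega> \<and> pure \<Theta> B C P \<and> (\<I> A \<otimes> P) \<odot> \<Psi> = \<Omega>"
proof -
  obtain b \<beta> where b: "sharp B b \<beta>" using ex_sharp by blast
  obtain \<gamma> where \<gamma>: "pure_state \<Theta> C \<gamma>" using ex_pure_state by blast
  have \<beta>: "pure_state \<Theta> B \<beta>" "ev b \<beta> = 1" "b \<in> Eff B" using b sharp_effect by (auto simp: sharp_def)
  have st: "\<Psi> \<in> St (A \<star> B)" "\<Omega> \<in> St (A \<star> C)" "\<beta> \<in> St B" "\<gamma> \<in> St C"
    using \<Psi> \<Omega> \<beta> \<gamma> pure_state_St by auto
  have pad: "x \<otimes> y = (\<I> A \<otimes> (\<I> D \<otimes> y)) \<odot> x" if "x \<in> St (A \<star> D)" "y \<in> St E" for x y D E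
  proof -
    have "(\<I> A \<otimes> (\<I> D \<otimes> y)) \<odot> x = (\<I> (A \<star> D) \<otimes> y) \<odot> (x \<otimes> \<I> \<one>)"
      using par_assoc[OF ident_transf ident_transf St_transf[OF that(2)], of A D]
      by (simp add: par_ident par_unit[OF St_transf[OF that(1)]])
    also have "\<dots> = x \<otimes> y"
      using interchange[OF St_transf[OF that(1)] ident_transf ident_transf[of \<one>] St_transf[OF that(2)]]
      by (simp add: seq_ident[OF St_transf[OF that(1)]] seq_ident[OF St_transf[OF that(2)]])
    finally show ?thesis by simp
  qed
  have unpad: "(\<I> A \<otimes> (\<I> D \<otimes> e)) \<odot> (x \<otimes> y) = ev e y *\<^sub>R x" if "x \<in> St (A \<star> D)" "y \<in> St E" "e \<in> Eff E" for x y e D E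
    using reduce_product_right[OF that] par_assoc[OF ident_transf ident_transf Eff_transf[OF that(3)], of A D]
    by (simp add: par_ident)
  have mpad: "marginal1 \<Theta> A (D \<star> E) (x \<otimes> y) = marginal1 \<Theta> A D x" if "x \<in> St (A \<star> D)" "normal E y" for x y D E
  proof -
    have "\<I> A \<otimes> u (D \<star> E) = (\<I> A \<otimes> u D) \<otimes> u E"
      using par_assoc[OF ident_transf discard_transf discard_transf, of A D E] by (simp add: discard_par)
    then have "marginal1 \<Theta> A (D \<star> E) (x \<otimes> y) = ((\<I> A \<otimes> u D) \<otimes> u E) \<odot> (x \<otimes> y)" by (simp add: marginal1_def)
    also have "\<dots> = marginal1 \<Theta> A D x \<otimes> (u E \<odot> y)"
      unfolding marginal1_def
      by (rule act_product[OF that(1) normalised_St[OF that(2)] transf_par[OF ident_transf discard_transf] discard_transf])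
    also have "\<dots> = marginal1 \<Theta> A D x"
      using that(2) by (simp add: seq_eq_ev[OF discard_effect normalised_St[OF that(2)]] normalised_iff
          par_unit[OF St_transf[OF marginal1_state[OF that(1)]]])
    finally show ?thesis .
  qed
  define X where "X = \<Psi> \<otimes> \<gamma>"
  define Y where "Y = (\<I> A \<otimes> swp \<Theta> C B) \<odot> (\<Omega> \<otimes> \<beta>)"
  have X: "pure_state \<Theta> (A \<star> (B \<star> C)) X" unfolding X_def using pure_state_par[OF \<Psi> \<gamma>] by (simp add: composite_assoc)
  have \<Omega>\<beta>: "pure_state \<Theta> (A \<star> (C \<star> B)) (\<Omega> \<otimes> \<beta>)" using pure_state_par[OF \<Omega> \<beta>(1)] by (simp add: composite_assoc)
  have Y: "pure_state \<Theta> (A \<star> (B \<star> C)) Y"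
    unfolding Y_def by (rule pure_state_reversible[OF \<Omega>\<beta> reversible_par[OF reversible_ident reversible_swap]])
  have "marginal1 \<Theta> A (B \<star> C) Y = marginal1 \<Theta> A (C \<star> B) (\<Omega> \<otimes> \<beta>)"
    unfolding Y_def marginal1_def
    using act_right_right[OF pure_state_St[OF \<Omega>\<beta>] swap_transf discard_transf] discard_seq[OF channel_swap] by simp
  then have "marginal1 \<Theta> A (B \<star> C) X = marginal1 \<Theta> A (B \<star> C) Y"
    using mpad st \<gamma> \<beta>(1) m by (simp add: X_def pure_state_def)
  then obtain V where V: "reversible \<Theta> (B \<star> C) (B \<star> C) V" "Y = (\<I> A \<otimes> V) \<odot> X"
    using purification_unique[OF X Y] by blast
  have tV: "V \<in> Tr (B \<star> C) (B \<star> C)" using reversible_transf[OF V(1)] .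
  define W where "W = swp \<Theta> B C \<odot> (V \<odot> (\<I> B \<otimes> \<gamma>))"
  have ig: "\<I> B \<otimes> \<gamma> \<in> Tr B (B \<star> C)" using transf_par[OF ident_transf St_transf[OF st(4)], of B] by (simp add: composite_unit)
  have W: "W \<in> Tr B (C \<star> B)" unfolding W_def using ig tV swap_transf transf_seq by blast
  have chW: "channel \<Theta> B (C \<star> B) W"
    unfolding W_def using channel_par[OF channel_ident, of \<one> C \<gamma> B] \<gamma> reversible_channel[OF V(1)]
    by (intro channel_seq[OF _ channel_swap] channel_seq[OF _ reversible_channel[OF V(1)]])
      (simp add: composite_unit pure_state_def normalised_iff_channel)
  have puW: "pure \<Theta> B (C \<star> B) W"
    unfolding W_def using purity_preservation_par[OF pure_ident pure_state_transf[OF \<gamma>], of B]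
    by (intro purity_preservation_seq[OF _ pure_reversible[OF reversible_swap]]
        purity_preservation_seq[OF _ pure_reversible[OF V(1)]]) (simp add: composite_unit)
  have "\<Omega> \<otimes> \<beta> = (\<I> A \<otimes> swp \<Theta> B C) \<odot> Y"
    unfolding Y_def
    using act_right_right[OF pure_state_St[OF \<Omega>\<beta>] swap_transf swap_transf] act_ident[OF pure_state_St[OF \<Omega>\<beta>]]
    by (simp add: swap_swap)
  also have "\<dots> = (\<I> A \<otimes> swp \<Theta> B C) \<odot> ((\<I> A \<otimes> V) \<odot> ((\<I> A \<otimes> (\<I> B \<otimes> \<gamma>)) \<odot> \<Psi>))"
    using V(2) pad[OF st(1,4)] by (simp add: X_def)
  also have "\<dots> = (\<I> A \<otimes> W) \<odot> \<Psi>"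
    unfolding W_def using act_right_right[OF st(1) ig tV]
      act_right_right[OF st(1) transf_seq[OF ig tV] swap_transf] by simp
  finally have W\<Psi>: "\<Omega> \<otimes> \<beta> = (\<I> A \<otimes> W) \<odot> \<Psi>" .
  have conn: "(\<I> A \<otimes> ((\<I> C \<otimes> e) \<odot> W)) \<odot> \<Psi> = \<Omega>" if "e \<in> Eff B" "ev e \<beta> = 1" for e
  proof -
    have "\<I> C \<otimes> e \<in> Tr (C \<star> B) C" using transf_par[OF ident_transf Eff_transf[OF that(1)], of C] by (simp add: composite_unit)
    from act_right_right[OF st(1) W this] show ?thesis
      using unpad[OF st(2,3) that(1)] that(2) by (simp flip: W\<Psi>)
  qed
  have "channel \<Theta> B C ((\<I> C \<otimes> u B) \<odot> W)"
    using channel_seq[OF chW channel_par[OF channel_ident discard_channel]] by (simp add: composite_unit)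
  moreover have "pure \<Theta> B C ((\<I> C \<otimes> b) \<odot> W)"
    using purity_preservation_seq[OF puW purity_preservation_par[OF pure_ident, of B \<one> b C]] b
    by (simp add: composite_unit sharp_def)
  ultimately show ?thesis
    using conn[OF discard_effect] conn[OF \<beta>(3,2)] \<beta>(1) by (auto simp: pure_state_def normalised_iff)
qed

lemma purification_connect_left:
  assumes \<Psi>: "pure_state \<Theta> (A \<star> B) \<Psi>" and \<Omega>: "pure_state \<Theta> (C \<star> B) \<Omega>"
    and m: "marginal2 \<Theta> A B \<Psi> = marginal2 \<Theta> C B \<Omega>"
  shows "\<exists>F P. channel \<Theta> A C F \<and> (F \<otimes> \<I> B) \<odot> \<Psi> = \<Omega> \<and> pure \<Theta> A C P \<and> (P \<otimes> \<I> B) \<odot> \<Psi> = \<Omega>"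
proof -
  note st = pure_state_St[OF \<Psi>] pure_state_St[OF \<Omega>]
  obtain F P where FP: "channel \<Theta> A C F" "(\<I> B \<otimes> F) \<odot> (swp \<Theta> A B \<odot> \<Psi>) = swp \<Theta> C B \<odot> \<Omega>"
      "pure \<Theta> A C P" "(\<I> B \<otimes> P) \<odot> (swp \<Theta> A B \<odot> \<Psi>) = swp \<Theta> C B \<odot> \<Omega>"
    using purification_connect[OF pure_state_reversible[OF \<Psi> reversible_swap] pure_state_reversible[OF \<Omega> reversible_swap]]
      m marginal_swap(1)[OF st(1)] marginal_swap(1)[OF st(2)] by metis
  have "(G \<otimes> \<I> B) \<odot> \<Psi> = \<Omega>" if "G \<in> Tr A C" "(\<I> B \<otimes> G) \<odot> (swp \<Theta> A B \<odot> \<Psi>) = swp \<Theta> C B \<odot> \<Omega>" for G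
    using swap_act[OF st(1) that(1) ident_transf] that swap_swap_act[OF st(2)]
      swap_swap_act[OF state_act_left[OF st(1) that(1)]] by metis
  then show ?thesis using FP channel_transf pure_transf by blast
qed

lemma ensemble_purification_left:
  assumes "Cs \<in> Tests \<one> A"
  obtains B \<Psi> bs where "pure_state \<Theta> (B \<star> A) \<Psi>" "bs \<in> Tests B \<one>" "Cs = map (\<lambda>b. (b \<otimes> \<I> A) \<odot> \<Psi>) bs"
proof -
  obtain B \<Psi> bs where B: "pure_state \<Theta> (A \<star> B) \<Psi>" "bs \<in> Tests B \<one>" "Cs = map (\<lambda>b. (\<I> A \<otimes> b) \<odot> \<Psi>) bs"
    using ensemble_purification[OF assms] .
  have "(\<I> A \<otimes> b) \<odot> \<Psi> = (b \<otimes> \<I> A) \<odot> (swp \<Theta> A B \<odot> \<Psi>)" if "b \<in> set bs" for b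
    using swap_reduce(2)[OF pure_state_St[OF B(1)]] transfI[OF B(2) that] by (simp add: effects_def)
  then have "Cs = map (\<lambda>b. (b \<otimes> \<I> A) \<odot> (swp \<Theta> A B \<odot> \<Psi>)) bs" using B(3) by simp
  then show thesis using that pure_state_reversible[OF B(1) reversible_swap] B(2) by blast
qed

lemma ensemble_marginal:
  assumes "\<Psi> \<in> St (A \<star> B)" "bs \<in> Tests B \<one>"
  shows "marginal1 \<Theta> A B \<Psi> = (\<Sum>b\<leftarrow>bs. (\<I> A \<otimes> b) \<odot> \<Psi>)"
proof -
  have "(\<I> A \<otimes> sum_list bs) \<odot> \<Psi> = (\<Sum>b\<leftarrow>bs. (\<I> A \<otimes> b) \<odot> \<Psi>)"
    by (induction bs) (simp_all add: par_add seq_add)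
  then show ?thesis by (simp add: marginal1_def observation_sum[OF assms(2)])
qed

text \<open>The state \<open>\<sigma>\<close> belongs to an ensemble with the same marginal as \<open>\<Psi>\<close>, whose purification is
  obtained from \<open>\<Psi>\<close> by a channel on \<open>B\<close>.\<close>

lemma agree_on_dominated:
  assumes \<Psi>: "pure_state \<Theta> (A \<star> B) \<Psi>" and f: "f \<in> Tr A C" and g: "g \<in> Tr A C"
    and fg: "(f \<otimes> \<I> B) \<odot> \<Psi> = (g \<otimes> \<I> B) \<odot> \<Psi>"
    and \<sigma>: "normal (A \<star> R) \<sigma>" and l: "l > 0" and \<tau>: "\<tau> \<in> St A"
    and m: "marginal1 \<Theta> A B \<Psi> = l *\<^sub>R marginal1 \<Theta> A R \<sigma> + \<tau>"
  shows "(f \<otimes> \<I> R) \<odot> \<sigma> = (g \<otimes> \<I> R) \<odot> \<sigma>"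
proof -
  note st = pure_state_St[OF \<Psi>]
  obtain r where r: "normal R r" using ex_normalised by blast
  have nl: "l + ev (u A) \<tau> = 1"
    using normalised_marginal(1)[OF pure_state_normalised[OF \<Psi>]] normalised_marginal(1)[OF \<sigma>]
    by (simp add: m normalised_iff ev_add)
  then have "l \<le> 1" using ev_bounds(1)[OF discard_effect \<tau>] by simp
  have norm: "ev (u (A \<star> R)) (\<tau> \<otimes> r) = ev (u A) \<tau>"
    using ev_product[OF \<tau> normalised_St[OF r] discard_effect discard_effect] r by (simp add: discard_par normalised_iff)
  have "[l *\<^sub>R \<sigma>, \<tau> \<otimes> r] \<in> Tests \<one> (A \<star> R)"
    using \<sigma> l \<open>l \<le> 1\<close> state_par[OF \<tau> normalised_St[OF r]] norm nl
    by (intro ensemble_test) (auto simp: normalised_iff intro!: scaled_state)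
  then obtain Y \<Omega> bs where \<Omega>: "pure_state \<Theta> ((A \<star> R) \<star> Y) \<Omega>" "bs \<in> Tests Y \<one>"
      "[l *\<^sub>R \<sigma>, \<tau> \<otimes> r] = map (\<lambda>b. (\<I> (A \<star> R) \<otimes> b) \<odot> \<Omega>) bs"
    by (rule ensemble_purification)
  obtain b1 b2 where bs: "bs = [b1, b2]" using \<Omega>(3) by (cases bs; cases "tl bs") auto
  have st\<Omega>: "\<Omega> \<in> St ((A \<star> R) \<star> Y)" "\<Omega> \<in> St (A \<star> (R \<star> Y))" "pure_state \<Theta> (A \<star> (R \<star> Y)) \<Omega>"
    using pure_state_St[OF \<Omega>(1)] \<Omega>(1) by (simp_all add: composite_assoc)
  have uR: "\<I> A \<otimes> u R \<in> Tr (A \<star> R) A" using transf_par[OF ident_transf discard_transf, of A R] by (simp add: composite_unit)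
  have "marginal1 \<Theta> A (R \<star> Y) \<Omega> = ((\<I> A \<otimes> u R) \<otimes> u Y) \<odot> \<Omega>"
    using par_assoc[OF ident_transf discard_transf discard_transf, of A R Y] by (simp add: marginal1_def discard_par)
  also have "\<dots> = (\<I> A \<otimes> u R) \<odot> marginal1 \<Theta> (A \<star> R) Y \<Omega>"
    using act_left_right[OF st\<Omega>(1) uR discard_transf] by (simp add: marginal1_def par_unit[OF uR])
  also have "marginal1 \<Theta> (A \<star> R) Y \<Omega> = l *\<^sub>R \<sigma> + \<tau> \<otimes> r"
    using ensemble_marginal[OF st\<Omega>(1) \<Omega>(2)] \<Omega>(3) by (simp add: bs)
  also have "(\<I> A \<otimes> u R) \<odot> (l *\<^sub>R \<sigma> + \<tau> \<otimes> r) = marginal1 \<Theta> A B \<Psi>"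
    using reduce_product_right[OF \<tau> normalised_St[OF r] discard_effect] r
    using m by (simp add: seq_add marginal1_def normalised_iff)
  finally obtain F where F: "channel \<Theta> B (R \<star> Y) F" "(\<I> A \<otimes> F) \<odot> \<Psi> = \<Omega>"
    using purification_connect[OF \<Psi> st\<Omega>(3)] by metis
  have tF: "F \<in> Tr B (R \<star> Y)" using channel_transf[OF F(1)] .
  have b1: "b1 \<in> Tr Y \<one>" using \<Omega>(2) by (rule transfI) (simp add: bs)
  have *: "(h \<otimes> \<I> R) \<odot> (l *\<^sub>R \<sigma>) = (\<I> (C \<star> R) \<otimes> b1) \<odot> ((\<I> C \<otimes> F) \<odot> ((h \<otimes> \<I> B) \<odot> \<Psi>))" if h: "h \<in> Tr A C" for h
  proof -
    have hR: "h \<otimes> \<I> R \<in> Tr (A \<star> R) (C \<star> R)" using transf_par[OF h ident_transf] .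
    have "(h \<otimes> \<I> R) \<odot> (l *\<^sub>R \<sigma>) = (h \<otimes> \<I> R) \<odot> ((\<I> (A \<star> R) \<otimes> b1) \<odot> \<Omega>)" using \<Omega>(3) by (simp add: bs)
    also have "\<dots> = (\<I> (C \<star> R) \<otimes> b1) \<odot> (((h \<otimes> \<I> R) \<otimes> \<I> Y) \<odot> \<Omega>)"
      using act_left_right[OF st\<Omega>(1) hR b1] act_right_left[OF st\<Omega>(1) hR b1] by (simp add: par_unit[OF hR])
    also have "((h \<otimes> \<I> R) \<otimes> \<I> Y) \<odot> \<Omega> = (h \<otimes> \<I> (R \<star> Y)) \<odot> ((\<I> A \<otimes> F) \<odot> \<Psi>)"
      using par_assoc[OF h ident_transf ident_transf, of R Y] F(2) by (simp add: par_ident)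
    also have "\<dots> = (\<I> C \<otimes> F) \<odot> ((h \<otimes> \<I> B) \<odot> \<Psi>)"
      using act_left_right[OF st h tF] act_right_left[OF st h tF] by simp
    finally show ?thesis .
  qed
  have "l *\<^sub>R ((f \<otimes> \<I> R) \<odot> \<sigma>) = l *\<^sub>R ((g \<otimes> \<I> R) \<odot> \<sigma>)"
    using *[OF f] *[OF g] fg by simp
  then show ?thesis using l by simp
qed

text \<open>A purification of a state that contains every normalised state of \<open>A\<close> with
  positive weight. A transformation on \<open>A\<close> is determined by what it does to such a
  state.\<close>

definition faithful :: "'a \<Rightarrow> 'a \<Rightarrow> 'b \<Rightarrow> bool" where
  "faithful A B \<Phi> \<longleftrightarrow> pure_state \<Theta> (A \<star> B) \<Phi> \<and>
     (\<forall>\<sigma>. normal A \<sigma> \<longrightarrow> (\<exists>l>0. \<exists>\<tau>\<in>St A. marginal1 \<Theta> A B \<Phi> = l *\<^sub>R \<sigma> + \<tau>))"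

lemma ex_faithful: "\<exists>B \<Phi>. faithful A B \<Phi>"
proof -
  obtain \<omega> where \<omega>: "normal A \<omega>" "\<And>\<sigma>. \<sigma> \<in> {\<sigma>. normal A \<sigma>} \<Longrightarrow> \<exists>l>0. \<exists>\<tau>\<in>St A. \<omega> = l *\<^sub>R \<sigma> + \<tau>"
    using internal_mixture[of "{\<sigma>. normal A \<sigma>}" A] ex_normalised by (metis (no_types, lifting) Collect_empty_eq mem_Collect_eq)
  then show ?thesis using purification_exists[OF \<omega>(1)] unfolding faithful_def by auto
qed

lemma faithful_eq:
  assumes "faithful A B \<Phi>" "f \<in> Tr A C" "g \<in> Tr A C" "(f \<otimes> \<I> B) \<odot> \<Phi> = (g \<otimes> \<I> B) \<odot> \<Phi>"
  shows "f = g"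
proof (rule transf_eqI[OF assms(2,3)])
  fix R \<rho> assume \<rho>: "\<rho> \<in> St (A \<star> R)"
  show "(f \<otimes> \<I> R) \<odot> \<rho> = (g \<otimes> \<I> R) \<odot> \<rho>"
  proof (cases "\<rho> = 0")
    case False
    then obtain \<sigma> c where \<sigma>: "normal (A \<star> R) \<sigma>" "\<rho> = c *\<^sub>R \<sigma>" using state_normalise[OF \<rho>] by metis
    obtain l \<tau> where "l > 0" "\<tau> \<in> St A" "marginal1 \<Theta> A B \<Phi> = l *\<^sub>R marginal1 \<Theta> A R \<sigma> + \<tau>"
      using assms(1) normalised_marginal(1)[OF \<sigma>(1)] unfolding faithful_def by blast
    then show ?thesis
      using agree_on_dominated[OF _ assms(2,3,4) \<sigma>(1)] assms(1) \<sigma>(2) by (simp add: faithful_def)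
  qed simp
qed

subsection \<open>Pure instruments\<close>

text \<open>Measuring \<open>e\<close> on a faithful \<Phi> leaves \<open>R\<close> in an ensemble
  of two states. The one for \<open>e\<close> is replaced by a purification \<Psi> on
  \<open>B \<star> R\<close>, the other one by a product with an arbitrary \<beta>. The purification
  of this new ensemble has the marginal of \<Phi> on \<open>R\<close>, so a channel on
  \<open>A\<close> produces it, and reading its outcome gives the instrument. The branch
  \<open>C1\<close> sends \<Phi> to a multiple of the pure state \<Psi> and is therefore pure. The
  state \<rho> guarantees that this multiple is not zero.\<close>

lemma pure_instrument:
  assumes e: "e \<in> Eff A" and \<rho>: "normal A \<rho>" "ev e \<rho> > 0"
  obtains B C0 C1 where "[C0, C1] \<in> Tests A B" "pure \<Theta> A B C1" "u B \<odot> C1 = e" "u B \<odot> C0 = u A - e"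
proof -
  obtain R \<Phi> where \<Phi>: "faithful A R \<Phi>" using ex_faithful by blast
  then have p\<Phi>: "pure_state \<Theta> (A \<star> R) \<Phi>" by (simp add: faithful_def)
  have st: "\<Phi> \<in> St (A \<star> R)" and n\<Phi>: "normal (A \<star> R) \<Phi>" using pure_state_St[OF p\<Phi>] pure_state_normalised[OF p\<Phi>] by auto
  define x1 where "x1 = (e \<otimes> \<I> R) \<odot> \<Phi>"
  define x0 where "x0 = ((u A - e) \<otimes> \<I> R) \<odot> \<Phi>"
  have x: "x0 \<in> St R" "x1 \<in> St R"
    unfolding x0_def x1_def using reduce_left[OF st] e effect_complement(2)[OF e] by auto
  have sum: "x0 + x1 = marginal2 \<Theta> A R \<Phi>" by (simp add: x0_def x1_def marginal2_def par_diff seq_diff)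
  define p where "p = ev (u R) x1"
  have p': "p = ev e (marginal1 \<Theta> A R \<Phi>)" unfolding p_def x1_def using ev_discard_reduce(1)[OF st e] .
  obtain l \<tau> where l: "l > 0" "\<tau> \<in> St A" "marginal1 \<Theta> A R \<Phi> = l *\<^sub>R \<rho> + \<tau>"
    using \<Phi> \<rho>(1) unfolding faithful_def by blast
  have "p = l * ev e \<rho> + ev e \<tau>" unfolding p' l(3) by (simp add: ev_add)
  moreover have "l * ev e \<rho> > 0" using l(1) \<rho>(2) by simp
  ultimately have p: "p > 0" using ev_bounds(1)[OF e l(2)] by linarith
  then have "x1 \<noteq> 0" by (auto simp: p_def)
  then obtain r where r: "normal R r" "x1 = p *\<^sub>R r" unfolding p_def using state_normalise[OF x(2)] by metis
  obtain B \<Psi>' where \<Psi>': "pure_state \<Theta> (R \<star> B) \<Psi>'" "marginal1 \<Theta> R B \<Psi>' = r" using purification_exists[OF r(1)] by blast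
  define \<Psi> where "\<Psi> = swp \<Theta> R B \<odot> \<Psi>'"
  have \<Psi>: "pure_state \<Theta> (B \<star> R) \<Psi>" unfolding \<Psi>_def using pure_state_reversible[OF \<Psi>'(1) reversible_swap] .
  have m\<Psi>: "marginal2 \<Theta> B R \<Psi> = r" unfolding \<Psi>_def using marginal_swap(2)[OF pure_state_St[OF \<Psi>'(1)]] \<Psi>'(2) by simp
  obtain \<beta> where \<beta>: "normal B \<beta>" using ex_normalised by blast
  have norm: "ev (u R) x0 + p = 1"
    using normalised_marginal(2)[OF n\<Phi>] by (simp add: p_def normalised_iff flip: sum ev_add(1))
  have "p \<le> 1" using norm ev_bounds(1)[OF discard_effect x(1)] by simp
  have "ev (u (B \<star> R)) (\<beta> \<otimes> x0) = ev (u R) x0"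
    using ev_product[OF normalised_St[OF \<beta>] x(1) discard_effect discard_effect] \<beta> by (simp add: discard_par normalised_iff)
  then have "[\<beta> \<otimes> x0, p *\<^sub>R \<Psi>] \<in> Tests \<one> (B \<star> R)"
    using \<Psi> p \<open>p \<le> 1\<close> norm state_par[OF normalised_St[OF \<beta>] x(1)]
    by (intro ensemble_test) (auto simp: pure_state_def normalised_iff intro!: scaled_state)
  then obtain Y \<Omega> bs where \<Omega>: "pure_state \<Theta> (Y \<star> (B \<star> R)) \<Omega>" "bs \<in> Tests Y \<one>"
      "[\<beta> \<otimes> x0, p *\<^sub>R \<Psi>] = map (\<lambda>b. (b \<otimes> \<I> (B \<star> R)) \<odot> \<Omega>) bs"
    by (rule ensemble_purification_left)
  obtain b0 b1 where bs: "bs = [b0, b1]" using \<Omega>(3) by (cases bs; cases "tl bs") auto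
  have b: "b0 \<in> Tr Y \<one>" "b1 \<in> Tr Y \<one>" using transfI[OF \<Omega>(2)] by (simp_all add: bs)
  have p\<Omega>: "pure_state \<Theta> ((Y \<star> B) \<star> R) \<Omega>" using \<Omega>(1) by (simp add: composite_assoc)
  have st\<Omega>: "\<Omega> \<in> St (Y \<star> (B \<star> R))" "\<Omega> \<in> St ((Y \<star> B) \<star> R)" using pure_state_St[OF \<Omega>(1)] pure_state_St[OF p\<Omega>] .
  have uB: "u B \<otimes> \<I> R \<in> Tr (B \<star> R) R" using transf_par[OF discard_transf ident_transf, of B R] by (simp add: composite_unit)
  have "marginal2 \<Theta> (Y \<star> B) R \<Omega> = (u Y \<otimes> (u B \<otimes> \<I> R)) \<odot> \<Omega>"
    using par_assoc[OF discard_transf discard_transf ident_transf, of Y B R] by (simp add: marginal2_def discard_par)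
  also have "\<dots> = (u B \<otimes> \<I> R) \<odot> ((u Y \<otimes> \<I> (B \<star> R)) \<odot> \<Omega>)"
    using act_right_left[OF st\<Omega>(1) discard_transf uB] by (simp add: par_unit[OF uB])
  also have "u Y = b0 + b1" using observation_sum[OF \<Omega>(2)] by (simp add: bs)
  also have "((b0 + b1) \<otimes> \<I> (B \<star> R)) \<odot> \<Omega> = \<beta> \<otimes> x0 + p *\<^sub>R \<Psi>" using \<Omega>(3) by (simp add: bs par_add seq_add)
  also have "(u B \<otimes> \<I> R) \<odot> (\<beta> \<otimes> x0 + p *\<^sub>R \<Psi>) = x0 + x1"
    using reduce_product_left[OF normalised_St[OF \<beta>] x(1) discard_effect] \<beta> m\<Psi> r(2)
    by (simp add: seq_add normalised_iff marginal2_def)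
  finally have "marginal2 \<Theta> A R \<Phi> = marginal2 \<Theta> (Y \<star> B) R \<Omega>" using sum by simp
  then obtain F where F: "channel \<Theta> A (Y \<star> B) F" "(F \<otimes> \<I> R) \<odot> \<Phi> = \<Omega>"
    using purification_connect_left[OF p\<Phi> p\<Omega>] by blast
  have tF: "F \<in> Tr A (Y \<star> B)" using channel_transf[OF F(1)] .
  define C0 where "C0 = (b0 \<otimes> \<I> B) \<odot> F"
  define C1 where "C1 = (b1 \<otimes> \<I> B) \<odot> F"
  have test: "[C0, C1] \<in> Tests A B"
    using tests_pre[of F A "Y \<star> B" "map (\<lambda>b. b \<otimes> \<I> B) bs" B] F(1) tests_par_right[OF \<Omega>(2), of B]
    by (simp add: channel_def bs C0_def C1_def composite_unit)
  have C: "C0 \<in> Tr A B" "C1 \<in> Tr A B" using transfI[OF test] by auto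
  have bB: "b1 \<otimes> \<I> B \<in> Tr (Y \<star> B) B" using transf_par[OF b(2) ident_transf, of B] by (simp add: composite_unit)
  have C1\<Phi>: "(C1 \<otimes> \<I> R) \<odot> \<Phi> = p *\<^sub>R \<Psi>"
    using act_left_left[OF st tF bB] F(2) \<Omega>(3) par_assoc[OF b(2) ident_transf ident_transf, of B R]
    by (simp add: C1_def bs par_ident)
  have uC1: "u B \<odot> C1 = e"
  proof (rule faithful_eq[OF \<Phi> transf_seq[OF C(2) discard_transf] Eff_transf[OF e]])
    show "((u B \<odot> C1) \<otimes> \<I> R) \<odot> \<Phi> = (e \<otimes> \<I> R) \<odot> \<Phi>"
      using act_left_left[OF st C(2) discard_transf] C1\<Phi> m\<Psi> r(2) by (simp add: marginal2_def x1_def)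
  qed
  have "[u B \<odot> C0, u B \<odot> C1] \<in> Tests A \<one>" using tests_post[OF test] discard_channel by (simp add: channel_def)
  from observation_sum[OF this] have uC0: "u B \<odot> C0 = u A - e" by (simp add: uC1 eq_diff_eq)
  have "pure \<Theta> A B C1"
    unfolding pure_iff
  proof (intro conjI allI impI)
    fix D E G assume t: "[D, E, G] \<in> Tests A B" and DE: "C1 = D + E"
    have D: "D \<in> Tr A B" "E \<in> Tr A B" using transfI[OF t] by auto
    note stD = state_act_left[OF st D(1)] state_act_left[OF st D(2)]
    have sumD: "(D \<otimes> \<I> R) \<odot> \<Phi> + (E \<otimes> \<I> R) \<odot> \<Phi> = p *\<^sub>R \<Psi>" using C1\<Phi> by (simp add: DE par_add seq_add)
    define d where "d = ev (u (B \<star> R)) ((D \<otimes> \<I> R) \<odot> \<Phi>)"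
    have D\<Psi>: "(D \<otimes> \<I> R) \<odot> \<Phi> = d *\<^sub>R \<Psi>"
      unfolding d_def by (rule pure_state_decompose[OF \<Psi> stD sumD])
    have "d + ev (u (B \<star> R)) ((E \<otimes> \<I> R) \<odot> \<Phi>) = p"
      unfolding d_def using \<Psi> by (simp add: sumD pure_state_def normalised_iff flip: ev_add(1))
    then have "0 \<le> d / p" "d / p \<le> 1"
      using ev_bounds(1)[OF discard_effect stD(1)] ev_bounds(1)[OF discard_effect stD(2)] p by (auto simp: d_def)
    then have "(d / p) *\<^sub>R C1 \<in> Tr A B" by (rule transf_scale[OF C(2)])
    moreover have "(D \<otimes> \<I> R) \<odot> \<Phi> = (((d / p) *\<^sub>R C1) \<otimes> \<I> R) \<odot> \<Phi>" using D\<Psi> C1\<Phi> p by simp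
    ultimately have "D = (d / p) *\<^sub>R C1" using faithful_eq[OF \<Phi> D(1)] by blast
    then show "\<exists>c. D = c *\<^sub>R C1" by blast
  qed (rule C(2))
  then show thesis using that test uC1 uC0 by blast
qed

text \<open>\<open>T\<close> is a pure instrument for \<open>e\<close>, followed by a pure transformation that undoes it on a purification
  of a mixture of all states on which \<open>e\<close> is certain.\<close>

lemma nondisturbing:
  assumes e: "e \<in> Eff A" and \<rho>: "normal A \<rho>" "ev e \<rho> = 1"
  shows "\<exists>T. pure \<Theta> A A T \<and> (\<forall>\<sigma>. normal A \<sigma> \<longrightarrow> ev e \<sigma> = 1 \<longrightarrow> T \<odot> \<sigma> = \<sigma>) \<and>
    (\<forall>x\<in>St A. ev (u A) (T \<odot> x) \<le> ev e x) \<and>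
    (\<forall>cs\<in>Tests A \<one>. \<exists>r. (u A - e) # map (\<lambda>c. c \<odot> T) cs @ [r] \<in> Tests A \<one>)"
proof -
  obtain B C0 C1 where C: "[C0, C1] \<in> Tests A B" "pure \<Theta> A B C1" "u B \<odot> C1 = e" "u B \<odot> C0 = u A - e"
    by (rule pure_instrument[OF e \<rho>(1)]) (use \<rho>(2) in \<open>auto intro: that\<close>)
  have tC: "C0 \<in> Tr A B" "C1 \<in> Tr A B" using transfI[OF C(1)] by auto
  define N where "N = {\<sigma>. normal A \<sigma> \<and> ev e \<sigma> = 1}"
  have "N \<noteq> {}" using \<rho> by (auto simp: N_def)
  then obtain \<omega> where \<omega>: "normal A \<omega>" "\<And>\<sigma>. \<sigma> \<in> N \<Longrightarrow> \<exists>l>0. \<exists>\<tau>\<in>St A. \<omega> = l *\<^sub>R \<sigma> + \<tau>"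
    "\<And>f c. linear f \<Longrightarrow> (\<And>\<sigma>. \<sigma> \<in> N \<Longrightarrow> f \<sigma> = (c::real)) \<Longrightarrow> f \<omega> = c"
    by (rule internal_mixture[of N A]) (auto simp: N_def)
  have e\<omega>: "ev e \<omega> = 1" by (rule \<omega>(3)[OF ev_linear_right]) (simp add: N_def)
  obtain Z \<Psi> where \<Psi>: "pure_state \<Theta> (A \<star> Z) \<Psi>" "marginal1 \<Theta> A Z \<Psi> = \<omega>" using purification_exists[OF \<omega>(1)] by blast
  note st = pure_state_St[OF \<Psi>(1)]
  define \<Xi> where "\<Xi> = (C1 \<otimes> \<I> Z) \<odot> \<Psi>"
  have st\<Xi>: "\<Xi> \<in> St (B \<star> Z)" unfolding \<Xi>_def by (rule state_act_left[OF st tC(2)])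
  have m\<Xi>: "marginal2 \<Theta> B Z \<Xi> = (e \<otimes> \<I> Z) \<odot> \<Psi>"
    unfolding \<Xi>_def marginal2_def using act_left_left[OF st tC(2) discard_transf] C(3) by simp
  \<comment> \<open>The complement of \<open>e\<close> never occurs on \<omega>, so the branch
    \<open>C1\<close> leaves the marginal on \<open>Z\<close> as it was; \<Xi> and \<Psi> are then
    pure states with a common marginal, and a pure \<open>P\<close> leads back.\<close>
  let ?x = "((u A - e) \<otimes> \<I> Z) \<odot> \<Psi>"
  have "ev (u Z) ?x = 0"
    using ev_discard_reduce(1)[OF st effect_complement(2)[OF e]] \<Psi>(2) e\<omega> \<omega>(1) by (simp add: ev_diff normalised_iff)
  then have "?x = 0" using state_zero_norm reduce_left[OF st effect_complement(2)[OF e]] by blast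
  then have m: "marginal2 \<Theta> B Z \<Xi> = marginal2 \<Theta> A Z \<Psi>" by (simp add: m\<Xi> marginal2_def[of \<Theta> A] par_diff seq_diff)
  have "ev (u (B \<star> Z)) \<Xi> = 1"
    using ev_discard_marginal(2)[OF st\<Xi>] m ev_discard_marginal(2)[OF st] \<Psi>(1) by (simp add: pure_state_def normalised_iff)
  then have "pure_state \<Theta> (B \<star> Z) \<Xi>"
    using pure_reduce_left[OF C(2) \<Psi>(1)] st\<Xi> by (simp add: pure_state_def normalised_iff \<Xi>_def)
  then obtain P where P: "pure \<Theta> B A P" "(P \<otimes> \<I> Z) \<odot> \<Xi> = \<Psi>"
    using purification_connect_left[of B Z \<Xi> A \<Psi>] \<Psi>(1) m by blast
  have tP: "P \<in> Tr B A" using pure_transf[OF P(1)] .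
  define T where "T = P \<odot> C1"
  have T: "pure \<Theta> A A T" unfolding T_def by (rule purity_preservation_seq[OF C(2) P(1)])
  have tT: "T \<in> Tr A A" using pure_transf[OF T] .
  have "(T \<otimes> \<I> Z) \<odot> \<Psi> = (\<I> A \<otimes> \<I> Z) \<odot> \<Psi>"
    using act_left_left[OF st tC(2) tP] P(2) by (simp add: T_def \<Xi>_def act_ident[OF st])
  note agree = agree_on_dominated[OF \<Psi>(1) tT ident_transf this, of \<one>]
  have undisturbed: "T \<odot> \<sigma> = \<sigma>" if \<sigma>: "normal A \<sigma>" "ev e \<sigma> = 1" for \<sigma>
  proof -
    obtain l \<tau> where "l > 0" "\<tau> \<in> St A" "\<omega> = l *\<^sub>R \<sigma> + \<tau>" using \<omega>(2)[of \<sigma>] \<sigma> by (auto simp: N_def)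
    moreover have "marginal1 \<Theta> A \<one> \<sigma> = \<sigma>"
      by (simp add: marginal1_def par_unit[OF ident_transf] seq_ident(2)[OF St_transf[OF normalised_St[OF \<sigma>(1)]]])
    ultimately have "(T \<otimes> \<I> \<one>) \<odot> \<sigma> = (\<I> A \<otimes> \<I> \<one>) \<odot> \<sigma>"
      using agree[of \<sigma> l \<tau>] \<sigma>(1) \<Psi>(2) by (simp add: composite_unit)
    then show ?thesis
      by (simp add: par_unit[OF ident_transf] par_unit[OF tT] seq_ident(2)[OF St_transf[OF normalised_St[OF \<sigma>(1)]]])
  qed
  have le: "ev (u A) (T \<odot> x) \<le> ev e x" if x: "x \<in> St A" for x
  proof -
    have "ev (u A) (T \<odot> x) = ev (u A) (P \<odot> (C1 \<odot> x))" by (simp add: T_def seq_act[OF x tC(2) tP])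
    also have "\<dots> \<le> ev (u B) (C1 \<odot> x)" by (rule ev_discard_seq_le[OF tP state_seq[OF x tC(2)]])
    also have "\<dots> = ev e x" using ev_seq[OF tC(2) discard_effect x] C(3) by simp
    finally show ?thesis .
  qed
  have test: "\<exists>r. (u A - e) # map (\<lambda>c. c \<odot> T) cs @ [r] \<in> Tests A \<one>" if cs: "cs \<in> Tests A \<one>" for cs
  proof -
    obtain P' where P': "[P, P'] \<in> Tests B A" using transf_test2[OF tP] .
    \<comment> \<open>After \<open>P\<close> the test \<open>cs\<close> is performed, after its
      complementary outcome \<open>P'\<close> the system is discarded; the latter branch becomes the
      additional outcome \<open>r\<close>.\<close>
    have "concat (map2 (\<lambda>C Ds. map (\<lambda>D. D \<odot> C) Ds) [P, P'] [cs, [u A]]) \<in> Tests B \<one>"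
      using cs discard_channel by (intro conditional[OF P']) (auto simp: channel_def)
    then have "map (\<lambda>c. c \<odot> P) cs @ [u A \<odot> P'] \<in> Tests B \<one>" by simp
    then have "concat (map2 (\<lambda>C Ds. map (\<lambda>D. D \<odot> C) Ds) [C0, C1] [[u B], map (\<lambda>c. c \<odot> P) cs @ [u A \<odot> P']]) \<in> Tests A \<one>"
      using discard_channel by (intro conditional[OF C(1)]) (auto simp: channel_def)
    moreover have "(c \<odot> P) \<odot> C1 = c \<odot> T" if "c \<in> set cs" for c
      unfolding T_def by (rule seq_assoc[OF tC(2) tP transfI[OF cs that]])
    ultimately have "(u A - e) # map (\<lambda>c. c \<odot> T) cs @ [(u A \<odot> P') \<odot> C1] \<in> Tests A \<one>"
      using C(4) by (simp add: o_def cong: map_cong)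
    then show ?thesis by blast
  qed
  show ?thesis using T undisturbed le test by blast
qed

subsection \<open>State-effect duality\<close>

lemma pure_normalise:
  assumes x: "pure \<Theta> \<one> B x" "ev (u B) x > 0"
  shows "\<exists>\<sigma>. pure_state \<Theta> B \<sigma> \<and> x = ev (u B) x *\<^sub>R \<sigma>"
proof -
  define q where "q = ev (u B) x"
  have st: "x \<in> St B" using pure_transf[OF x(1)] by (simp add: states_def)
  obtain \<sigma> where \<sigma>: "normal B \<sigma>" "x = q *\<^sub>R \<sigma>" "q > 0" "q \<le> 1"
    unfolding q_def using state_normalise[OF st] x(2) by (metis ev_zero(1) less_irrefl)
  have "pure \<Theta> \<one> B \<sigma>"
    unfolding pure_iff
  proof (intro conjI allI impI)
    show "\<sigma> \<in> Tr \<one> B" using St_transf[OF normalised_St[OF \<sigma>(1)]] .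
    fix D E G assume t: "[D, E, G] \<in> Tests \<one> B" and DE: "\<sigma> = D + E"
    have DS: "D \<in> St B" "E \<in> St B" using transfI[OF t] by (auto simp: states_def)
    have n: "ev (u B) D + ev (u B) E = 1" using \<sigma>(1) by (simp add: DE normalised_iff ev_add)
    have "q * ev (u B) D \<le> 1" "q * ev (u B) E \<le> 1"
      using \<sigma>(3,4) ev_bounds[OF discard_effect DS(1)] ev_bounds[OF discard_effect DS(2)] by (auto simp: mult_le_one)
    moreover have "q * (ev (u B) D + ev (u B) E) = q" using n by simp
    then have "q * ev (u B) D + (q * ev (u B) E + (1 - q)) = 1" by (simp add: distrib_left)
    ultimately have "[q *\<^sub>R D, q *\<^sub>R E, (1 - q) *\<^sub>R \<sigma>] \<in> Tests \<one> B"
      using DS \<sigma>(1,3,4) by (intro ensemble_test) (auto simp: normalised_iff intro!: scaled_state)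
    moreover have "x = q *\<^sub>R D + q *\<^sub>R E" by (simp add: \<sigma>(2) DE scaleR_add_right)
    ultimately obtain c where "q *\<^sub>R D = c *\<^sub>R x" using x(1) unfolding pure_iff by blast
    then have "q *\<^sub>R D = q *\<^sub>R (c *\<^sub>R \<sigma>)" by (simp add: \<sigma>(2) mult.commute)
    then have "D = c *\<^sub>R \<sigma> \<or> q = 0" unfolding real_vector.scale_cancel_left .
    then show "\<exists>c. D = c *\<^sub>R \<sigma>" using \<sigma>(3) by blast
  qed
  then have "pure_state \<Theta> B \<sigma>" using \<sigma>(1) by (simp add: pure_state_def)
  then show ?thesis using \<sigma>(2) unfolding q_def by blast
qed

text \<open>Purity preservation makes the conditional state pure, so a pure effect of probability
  \<open>q\<close> on one side yields a pure state of weight \<open>q\<close> on the other. The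
  remainder \<open>y\<close> is the state for the complementary effect.\<close>

lemma pure_steer_left:
  assumes \<Psi>: "pure_state \<Theta> (A \<star> B) \<Psi>" and e: "pure \<Theta> A \<one> e" and q: "q = ev e (marginal1 \<Theta> A B \<Psi>)" "q > 0"
  obtains \<beta> y where "pure_state \<Theta> B \<beta>" "(e \<otimes> \<I> B) \<odot> \<Psi> = q *\<^sub>R \<beta>" "y \<in> St B" "marginal2 \<Theta> A B \<Psi> = q *\<^sub>R \<beta> + y"
proof -
  note st = pure_state_St[OF \<Psi>]
  have ee: "e \<in> Eff A" using pure_transf[OF e] by (simp add: effects_def)
  have n: "ev (u B) ((e \<otimes> \<I> B) \<odot> \<Psi>) = q" using ev_discard_reduce(1)[OF st ee] q(1) by simp
  have "pure \<Theta> \<one> B ((e \<otimes> \<I> B) \<odot> \<Psi>)" using pure_reduce_left[OF e \<Psi>] by (simp add: composite_unit)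
  then obtain \<beta> where \<beta>: "pure_state \<Theta> B \<beta>" "(e \<otimes> \<I> B) \<odot> \<Psi> = q *\<^sub>R \<beta>"
    using pure_normalise[of B "(e \<otimes> \<I> B) \<odot> \<Psi>"] q(2) unfolding n by blast
  have "marginal2 \<Theta> A B \<Psi> = q *\<^sub>R \<beta> + ((u A - e) \<otimes> \<I> B) \<odot> \<Psi>"
    unfolding \<beta>(2)[symmetric] by (simp add: marginal2_def par_diff seq_diff)
  then show thesis by (rule that[OF \<beta> reduce_left[OF st effect_complement(2)[OF ee]]])
qed

lemma pure_steer_right:
  assumes \<Psi>: "pure_state \<Theta> (A \<star> B) \<Psi>" and e: "pure \<Theta> B \<one> e" and q: "q = ev e (marginal2 \<Theta> A B \<Psi>)" "q > 0"
  obtains \<alpha> y where "pure_state \<Theta> A \<alpha>" "(\<I> A \<otimes> e) \<odot> \<Psi> = q *\<^sub>R \<alpha>" "y \<in> St A" "marginal1 \<Theta> A B \<Psi> = q *\<^sub>R \<alpha> + y"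
proof -
  note st = pure_state_St[OF \<Psi>]
  have ee: "e \<in> Eff B" using pure_transf[OF e] by (simp add: effects_def)
  have q': "q = ev e (marginal1 \<Theta> B A (swp \<Theta> A B \<odot> \<Psi>))" using q(1) marginal_swap(1)[OF st] by simp
  obtain \<alpha> y where "pure_state \<Theta> A \<alpha>" "(e \<otimes> \<I> A) \<odot> (swp \<Theta> A B \<odot> \<Psi>) = q *\<^sub>R \<alpha>" "y \<in> St A"
      "marginal2 \<Theta> B A (swp \<Theta> A B \<odot> \<Psi>) = q *\<^sub>R \<alpha> + y"
    by (rule pure_steer_left[OF pure_state_reversible[OF \<Psi> reversible_swap] e q' q(2)])
  then show thesis using that[of \<alpha> y] swap_reduce(2)[OF st ee] marginal_swap(2)[OF st] by simp
qed

text \<open>A stock of sharp effects for all pure states at once, by transitivity. It stands in for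
  the set of all \<open>\<alpha>\<^sup>\<dagger>\<close> until their uniqueness is available, and
  maxima over it exist by compactness.\<close>

definition orbit :: "'a \<Rightarrow> 'b \<Rightarrow> 'b set" where
  "orbit A a = {a \<odot> V |V. reversible \<Theta> A A V}"

lemma sharp_transport:
  assumes "sharp A a \<alpha>" "V \<in> Tr A B" "W \<in> Tr B A" "W \<odot> V = \<I> A" "V \<odot> W = \<I> B"
  shows "sharp B (a \<odot> W) (V \<odot> \<alpha>)"
proof -
  have V: "reversible \<Theta> A B V" "reversible \<Theta> B A W" using assms by (auto simp: reversible_iff)
  have a: "pure \<Theta> A \<one> a" "pure_state \<Theta> A \<alpha>" "ev a \<alpha> = 1" using assms(1) by (auto simp: sharp_def)
  have st: "\<alpha> \<in> St A" using a(2) by (rule pure_state_St)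
  have "ev (a \<odot> W) (V \<odot> \<alpha>) = ev a (W \<odot> (V \<odot> \<alpha>))"
    using ev_seq[OF assms(3) sharp_effect[OF assms(1)] state_seq[OF st assms(2)]] by simp
  also have "W \<odot> (V \<odot> \<alpha>) = \<alpha>" using seq_act[OF st assms(2,3)] assms(4) seq_ident(2)[OF St_transf[OF st]] by simp
  finally show ?thesis
    using purity_preservation_seq[OF pure_reversible[OF V(2)] a(1)] pure_state_reversible[OF a(2) V(1)] a(3)
    by (simp add: sharp_def)
qed

lemma orbit_sharp:
  assumes "sharp A a\<^sub>0 \<alpha>\<^sub>0" "a \<in> orbit A a\<^sub>0"
  shows "\<exists>\<alpha>. sharp A a \<alpha>"
proof -
  obtain V where V: "a = a\<^sub>0 \<odot> V" "reversible \<Theta> A A V" using assms(2) by (auto simp: orbit_def)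
  then obtain W where "W \<in> Tr A A" "V \<in> Tr A A" "W \<odot> V = \<I> A" "V \<odot> W = \<I> A" by (auto simp: reversible_iff)
  then show ?thesis using sharp_transport[OF assms(1), of W A V] V(1) by blast
qed

lemma orbit_hits:
  assumes "sharp A a\<^sub>0 \<alpha>\<^sub>0" "pure_state \<Theta> A \<alpha>"
  shows "\<exists>a\<in>orbit A a\<^sub>0. sharp A a \<alpha>"
proof -
  obtain V where V: "reversible \<Theta> A A V" "\<alpha> = V \<odot> \<alpha>\<^sub>0"
    using pure_transitive[OF _ assms(2), of \<alpha>\<^sub>0] assms(1) by (auto simp: sharp_def)
  then obtain W where W: "V \<in> Tr A A" "W \<in> Tr A A" "W \<odot> V = \<I> A" "V \<odot> W = \<I> A" by (auto simp: reversible_iff)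
  then have "reversible \<Theta> A A W" by (auto simp: reversible_iff)
  then have "a\<^sub>0 \<odot> W \<in> orbit A a\<^sub>0" by (auto simp: orbit_def)
  then show ?thesis using sharp_transport[OF assms(1) W] V(2) by blast
qed

lemma orbit_effect: "sharp A a\<^sub>0 \<alpha>\<^sub>0 \<Longrightarrow> a \<in> orbit A a\<^sub>0 \<Longrightarrow> a \<in> Eff A"
  using orbit_sharp sharp_effect by blast

lemma orbit_max:
  assumes a: "sharp A a\<^sub>0 \<alpha>\<^sub>0" and \<rho>: "normal A \<rho>"
  shows "\<exists>a\<in>orbit A a\<^sub>0. \<forall>a'\<in>orbit A a\<^sub>0. ev a' \<rho> \<le> ev a \<rho>"
proof -
  have "linear (\<lambda>V. ev a\<^sub>0 (V \<odot> \<rho>))" by (intro linearI) (simp_all add: seq_add ev_add)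
  then have "continuous_on (Tr A A) (\<lambda>V. ev a\<^sub>0 (V \<odot> \<rho>))" by (rule linear_continuous_transf)
  then have "continuous_on (mutual_inverses A) (\<lambda>z. ev a\<^sub>0 (fst z \<odot> \<rho>))"
    by (rule continuous_on_compose2[of _ _ _ fst]) (auto simp: mutual_inverses_def intro: continuous_on_fst continuous_on_id)
  moreover have "(\<I> A, \<I> A) \<in> mutual_inverses A" by (simp add: mutual_inverses_def seq_ident[OF ident_transf])
  ultimately have "\<exists>z\<in>mutual_inverses A. \<forall>z'\<in>mutual_inverses A. ev a\<^sub>0 (fst z' \<odot> \<rho>) \<le> ev a\<^sub>0 (fst z \<odot> \<rho>)"
    using continuous_attains_sup[OF compact_mutual_inverses] by blast
  then obtain z where z: "z \<in> mutual_inverses A"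
      "\<And>z'. z' \<in> mutual_inverses A \<Longrightarrow> ev a\<^sub>0 (fst z' \<odot> \<rho>) \<le> ev a\<^sub>0 (fst z \<odot> \<rho>)" by blast
  have V: "ev a\<^sub>0 (V \<odot> \<rho>) = ev (a\<^sub>0 \<odot> V) \<rho>" if "reversible \<Theta> A A V" for V
    using ev_seq[OF reversible_transf[OF that] sharp_effect[OF a] normalised_St[OF \<rho>]] .
  have rz: "reversible \<Theta> A A (fst z)" using z(1) by (metis mutual_inverses_reversible prod.collapse)
  show ?thesis
  proof (rule bexI[of _ "a\<^sub>0 \<odot> fst z"], rule ballI)
    show "a\<^sub>0 \<odot> fst z \<in> orbit A a\<^sub>0" using rz by (auto simp: orbit_def)
    fix a' assume "a' \<in> orbit A a\<^sub>0"
    then obtain V where V': "a' = a\<^sub>0 \<odot> V" "reversible \<Theta> A A V" by (auto simp: orbit_def)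
    then obtain W where "(V, W) \<in> mutual_inverses A" using mutual_inverses_reversible by blast
    from z(2)[OF this] show "ev a' \<rho> \<le> ev (a\<^sub>0 \<odot> fst z) \<rho>" using V[OF V'(2)] V[OF rz] V'(1) by simp
  qed
qed

text \<open>If all effects of the orbit vanished on \<rho>, they would vanish on some pure state of
  the same face, but one of them is certain on that state.\<close>

lemma orbit_pos:
  assumes a: "sharp A a\<^sub>0 \<alpha>\<^sub>0" and \<rho>: "normal A \<rho>"
  shows "\<exists>a\<in>orbit A a\<^sub>0. ev a \<rho> > 0"
proof (rule ccontr)
  assume neg: "\<not> ?thesis"
  have nn: "0 \<le> ev b \<sigma>" if "b \<in> orbit A a\<^sub>0" "normal A \<sigma>" for b \<sigma>
    using ev_bounds(1)[OF orbit_effect[OF a that(1)] normalised_St[OF that(2)]] .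
  define \<Phi> where "\<Phi> = (\<lambda>b x. - ev b x) ` orbit A a\<^sub>0"
  have "linear f" if "f \<in> \<Phi>" for f
    using that by (auto simp: \<Phi>_def ev_add intro!: linearI)
  moreover have "f \<sigma> \<le> 0" if "f \<in> \<Phi>" "normal A \<sigma>" for f \<sigma> using that nn by (auto simp: \<Phi>_def)
  moreover have "f \<rho> = 0" if "f \<in> \<Phi>" for f using that nn[OF _ \<rho>] neg by (fastforce simp: \<Phi>_def)
  ultimately obtain \<alpha> where \<alpha>: "pure_state \<Theta> A \<alpha>" "\<And>f. f \<in> \<Phi> \<Longrightarrow> f \<alpha> = 0"
    using pure_state_in_face[of \<Phi> A \<rho>] \<rho> by metis
  obtain b where "b \<in> orbit A a\<^sub>0" "sharp A b \<alpha>" using orbit_hits[OF a \<alpha>(1)] by blast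
  then show False using \<alpha>(2) by (fastforce simp: \<Phi>_def sharp_def)
qed

text \<open>The largest value of the effects in an orbit bounds the weights of pure states on either side of a
  purification; passing to the other side and back shows that it is itself such a weight.\<close>

lemma maximal_effect_steering:
  assumes \<Psi>: "pure_state \<Theta> (A \<star> B) \<Psi>" and a0: "sharp A a\<^sub>0 \<alpha>\<^sub>0"
    and max: "\<forall>a'\<in>orbit A a\<^sub>0. ev a' (marginal1 \<Theta> A B \<Psi>) \<le> q" and q: "q > 0"
    and e: "pure \<Theta> A \<one> e" "q \<le> ev e (marginal1 \<Theta> A B \<Psi>)"
  obtains \<beta> b \<alpha> y where "(e \<otimes> \<I> B) \<odot> \<Psi> = q *\<^sub>R \<beta>" "sharp B b \<beta>" "(\<I> A \<otimes> b) \<odot> \<Psi> = q *\<^sub>R \<alpha>"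
    "pure_state \<Theta> A \<alpha>" "ev e \<alpha> = 1" "y \<in> St A" "marginal1 \<Theta> A B \<Psi> = q *\<^sub>R \<alpha> + y"
proof -
  note st = pure_state_St[OF \<Psi>]
  have ee: "e \<in> Eff A" using pure_transf[OF e(1)] by (simp add: effects_def)
  define q1 where "q1 = ev e (marginal1 \<Theta> A B \<Psi>)"
  have q1: "q \<le> q1" "q1 > 0" using e(2) q by (auto simp: q1_def)
  obtain \<beta> z where \<beta>: "pure_state \<Theta> B \<beta>" "(e \<otimes> \<I> B) \<odot> \<Psi> = q1 *\<^sub>R \<beta>" "z \<in> St B" "marginal2 \<Theta> A B \<Psi> = q1 *\<^sub>R \<beta> + z"
    by (rule pure_steer_left[OF \<Psi> e(1) q1_def q1(2)])
  obtain b0 \<beta>0 where "sharp B b0 \<beta>0" using ex_sharp by blast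
  then obtain b where b: "sharp B b \<beta>" using orbit_hits \<beta>(1) by blast
  note eb = sharp_effect[OF b]
  define q2 where "q2 = ev b (marginal2 \<Theta> A B \<Psi>)"
  have "q2 = q1 + ev b z" using b by (simp add: q2_def \<beta>(4) ev_add sharp_def)
  then have q2: "q1 \<le> q2" "q2 > 0" using ev_bounds(1)[OF eb \<beta>(3)] q1(2) by auto
  obtain \<alpha> y where \<alpha>: "pure_state \<Theta> A \<alpha>" "(\<I> A \<otimes> b) \<odot> \<Psi> = q2 *\<^sub>R \<alpha>" "y \<in> St A" "marginal1 \<Theta> A B \<Psi> = q2 *\<^sub>R \<alpha> + y"
    using b by (auto simp: sharp_def intro: pure_steer_right[OF \<Psi> _ q2_def q2(2)])
  obtain a' where a': "a' \<in> orbit A a\<^sub>0" "sharp A a' \<alpha>" using orbit_hits[OF a0 \<alpha>(1)] by blast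
  \<comment> \<open>An effect of the orbit that is certain on \<alpha> bounds the weight
    \<open>q2\<close> by the maximum \<open>q\<close>; with \<open>q \<le> q1\<close> and
    \<open>q1 \<le> q2\<close> all three agree.\<close>
  have "q2 + ev a' y \<le> q" using bspec[OF max a'(1)] a'(2) by (simp add: \<alpha>(4) ev_add sharp_def)
  then have "q2 \<le> q" using ev_bounds(1)[OF sharp_effect[OF a'(2)] \<alpha>(3)] by simp
  then have eq: "q1 = q" "q2 = q" using q1(1) q2(1) by auto
  \<comment> \<open>Both sides are the joint probability of \<open>e\<close> and \<open>b\<close> on
    \<Psi>, computed by conditioning on either system first.\<close>
  have "q * ev b \<beta> = q * ev e \<alpha>"
    using ev_reduce_left[OF st ee eb] ev_reduce_right[OF st ee eb] by (simp add: \<beta>(2) \<alpha>(2) eq)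
  then have "ev e \<alpha> = 1" using b q by (simp add: sharp_def)
  then show thesis using that[of \<beta> b \<alpha> y] \<beta> \<alpha> b by (simp add: eq)
qed

text \<open>Let \<open>a\<close> be the best effect of the orbit on the marginal of a faithful
  \<Phi>, paired with \<beta> and \<open>b\<close> on the other side. Any \<open>f\<close> that is
  certain on \<alpha>1 also reaches the maximum and steers to some \<beta>' of the same weight; the
  joint probability of \<open>f\<close> and \<open>b\<close> shows that \<open>b\<close> is certain
  on \<beta>', so \<beta>' equals \<beta>. Then \<open>f\<close> and \<open>a\<close> agree on
  \<Phi>. Transitivity moves the result from \<alpha>1 to \<alpha>.\<close>

lemma sharp_effect_unique:
  assumes "sharp A e \<alpha>" "sharp A e' \<alpha>"
  shows "e = e'"
proof -
  obtain B \<Phi> where \<Phi>: "faithful A B \<Phi>" using ex_faithful by blast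
  then have p\<Phi>: "pure_state \<Theta> (A \<star> B) \<Phi>" by (simp add: faithful_def)
  note st = pure_state_St[OF p\<Phi>]
  define \<rho> where "\<rho> = marginal1 \<Theta> A B \<Phi>"
  have \<rho>: "normal A \<rho>" unfolding \<rho>_def using normalised_marginal(1) pure_state_normalised[OF p\<Phi>] .
  obtain a where a: "a \<in> orbit A e" "\<And>a'. a' \<in> orbit A e \<Longrightarrow> ev a' \<rho> \<le> ev a \<rho>" using orbit_max[OF assms(1) \<rho>] by blast
  define q where "q = ev a \<rho>"
  have q: "q > 0" using orbit_pos[OF assms(1) \<rho>] a(2) unfolding q_def by fastforce
  have max: "\<forall>a'\<in>orbit A e. ev a' (marginal1 \<Theta> A B \<Phi>) \<le> q" using a(2) by (simp add: q_def \<rho>_def)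
  have pa: "pure \<Theta> A \<one> a" using orbit_sharp[OF assms(1) a(1)] by (auto simp: sharp_def)
  have "q \<le> ev a (marginal1 \<Theta> A B \<Phi>)" by (simp add: q_def \<rho>_def)
  then obtain \<beta> b \<alpha>1 y where 1: "(a \<otimes> \<I> B) \<odot> \<Phi> = q *\<^sub>R \<beta>" "sharp B b \<beta>" "(\<I> A \<otimes> b) \<odot> \<Phi> = q *\<^sub>R \<alpha>1"
    "pure_state \<Theta> A \<alpha>1" "ev a \<alpha>1 = 1" "y \<in> St A" "marginal1 \<Theta> A B \<Phi> = q *\<^sub>R \<alpha>1 + y"
    by (rule maximal_effect_steering[OF p\<Phi> assms(1) max q pa])
  have unique: "f = a" if f: "sharp A f \<alpha>1" for f
  proof -
    note ef = sharp_effect[OF f]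
    have "q \<le> ev f (marginal1 \<Theta> A B \<Phi>)"
      using f ev_bounds(1)[OF ef 1(6)] by (simp add: 1(7) ev_add sharp_def)
    moreover have pf: "pure \<Theta> A \<one> f" using f by (simp add: sharp_def)
    ultimately obtain \<beta>' b' \<alpha>' y' where 2: "(f \<otimes> \<I> B) \<odot> \<Phi> = q *\<^sub>R \<beta>'" "sharp B b' \<beta>'" "(\<I> A \<otimes> b') \<odot> \<Phi> = q *\<^sub>R \<alpha>'"
      "pure_state \<Theta> A \<alpha>'" "ev f \<alpha>' = 1" "y' \<in> St A" "marginal1 \<Theta> A B \<Phi> = q *\<^sub>R \<alpha>' + y'"
      by - (rule maximal_effect_steering[OF p\<Phi> assms(1) max q])
    have "q * ev b \<beta>' = q * ev f \<alpha>1"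
      using ev_reduce_left[OF st ef sharp_effect[OF 1(2)]] ev_reduce_right[OF st ef sharp_effect[OF 1(2)]]
      by (simp add: 1(3) 2(1))
    then have "ev b \<beta>' = 1" using f q by (simp add: sharp_def)
    then have "\<beta>' = \<beta>"
      using pure_effect_state_unique[of B b \<beta>' \<beta>] 1(2) 2(2) by (simp add: sharp_def pure_state_def)
    then have "(f \<otimes> \<I> B) \<odot> \<Phi> = (a \<otimes> \<I> B) \<odot> \<Phi>" using 1(1) 2(1) by simp
    then show "f = a" by (rule faithful_eq[OF \<Phi> pure_transf[OF pf] pure_transf[OF pa]])
  qed
  have "pure_state \<Theta> A \<alpha>" using assms(1) by (simp add: sharp_def)
  then obtain V where V: "reversible \<Theta> A A V" "\<alpha>1 = V \<odot> \<alpha>" using pure_transitive[OF _ 1(4)] by blast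
  then obtain W where W: "V \<in> Tr A A" "W \<in> Tr A A" "W \<odot> V = \<I> A" "V \<odot> W = \<I> A" by (auto simp: reversible_iff)
  have "e \<odot> W = e' \<odot> W" using unique sharp_transport[OF assms(1) W] sharp_transport[OF assms(2) W] V(2) by metis
  moreover have "(f \<odot> W) \<odot> V = f" if "f \<in> Eff A" for f
    using seq_assoc[OF W(1,2) Eff_transf[OF that]] W(3) seq_ident(1)[OF Eff_transf[OF that]] by simp
  ultimately show ?thesis using sharp_effect[OF assms(1)] sharp_effect[OF assms(2)] by metis
qed

abbreviation "dag \<equiv> dagger \<Theta>"

lemma sharp_normalised_effect:
  assumes "sharp A a \<alpha>"
  shows "normalised_effect \<Theta> A a"
proof -
  note ea = sharp_effect[OF assms]
  have \<alpha>: "\<alpha> \<in> St A" "ev a \<alpha> = 1" using assms pure_state_St by (auto simp: sharp_def)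
  have "(SUP \<rho>\<in>St A. pairing \<Theta> a \<rho>) = 1"
  proof (rule cSup_eq_maximum)
    show "1 \<in> (\<lambda>\<rho>. pairing \<Theta> a \<rho>) ` St A" using \<alpha> pairing_effect[OF ea \<alpha>(1)] by (intro image_eqI[of _ _ \<alpha>]) auto
    show "x \<le> 1" if "x \<in> (\<lambda>\<rho>. pairing \<Theta> a \<rho>) ` St A" for x
      using that ev_bounds(2)[OF ea] pairing_effect[OF ea] by auto
  qed
  then show ?thesis using ea by (simp add: normalised_effect_def)
qed

lemma dagger_eq:
  assumes "sharp A a \<alpha>"
  shows "dag A \<alpha> = a"
  unfolding dagger_def
proof (rule the_equality)
  have \<alpha>: "pure_state \<Theta> A \<alpha>" using assms by (simp add: sharp_def)
  note st = pure_state_St[OF \<alpha>]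
  show "pure \<Theta> A \<one> a \<and> normalised_effect \<Theta> A a \<and> pairing \<Theta> a \<alpha> = 1"
    using assms sharp_normalised_effect[OF assms] pairing_effect[OF sharp_effect[OF assms] st] by (simp add: sharp_def)
  fix b assume b: "pure \<Theta> A \<one> b \<and> normalised_effect \<Theta> A b \<and> pairing \<Theta> b \<alpha> = 1"
  then have "b \<in> Eff A" using pure_transf by (simp add: effects_def)
  then have "sharp A b \<alpha>" using b \<alpha> pairing_effect[OF _ st] by (simp add: sharp_def)
  then show "b = a" using sharp_effect_unique assms by blast
qed

lemma sharp_dagger:
  assumes "pure_state \<Theta> A \<alpha>"
  shows "sharp A (dag A \<alpha>) \<alpha>"
  using ex_sharp[of A] orbit_hits[OF _ assms] dagger_eq by metis

lemma dagger_effect: "pure_state \<Theta> A \<alpha> \<Longrightarrow> dag A \<alpha> \<in> Eff A"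
  using sharp_dagger sharp_effect by blast

lemma dagger_pure: "pure_state \<Theta> A \<alpha> \<Longrightarrow> pure \<Theta> A \<one> (dag A \<alpha>)"
  using sharp_dagger by (simp add: sharp_def)

lemma dagger_self: "pure_state \<Theta> A \<alpha> \<Longrightarrow> ev (dag A \<alpha>) \<alpha> = 1"
  using sharp_dagger by (simp add: sharp_def)

lemma dagger_state_unique: "pure_state \<Theta> A \<alpha> \<Longrightarrow> normal A \<rho> \<Longrightarrow> ev (dag A \<alpha>) \<rho> = 1 \<Longrightarrow> \<rho> = \<alpha>"
  using pure_effect_state_unique[OF dagger_pure _ pure_state_normalised _ dagger_self] by blast

lemma dagger_nonneg: "pure_state \<Theta> A \<alpha> \<Longrightarrow> x \<in> St A \<Longrightarrow> 0 \<le> ev (dag A \<alpha>) x"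
  by (rule ev_bounds(1)[OF dagger_effect])

lemma dagger_reversible:
  assumes "pure_state \<Theta> A \<alpha>" "V \<in> Tr A B" "W \<in> Tr B A" "W \<odot> V = \<I> A" "V \<odot> W = \<I> B"
  shows "dag B (V \<odot> \<alpha>) = dag A \<alpha> \<odot> W"
  by (rule dagger_eq[OF sharp_transport[OF sharp_dagger[OF assms(1)] assms(2-5)]])

lemma dagger_pos: "normal A \<rho> \<Longrightarrow> \<exists>\<alpha>. pure_state \<Theta> A \<alpha> \<and> ev (dag A \<alpha>) \<rho> > 0"
  using ex_sharp[of A] orbit_pos orbit_sharp dagger_eq sharp_def by metis

text \<open>The weight of \<alpha> exhausts the value of \<open>\<alpha>\<^sup>\<dagger>\<close> on
  \<rho>, so the remainder is annihilated; states split off from it later are orthogonal to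
  \<alpha>.\<close>

lemma eigenstate:
  assumes \<rho>: "normal A \<rho>"
  obtains \<alpha> q y where "pure_state \<Theta> A \<alpha>" "q > 0" "y \<in> St A" "\<rho> = q *\<^sub>R \<alpha> + y" "ev (dag A \<alpha>) y = 0"
proof -
  obtain a0 \<alpha>0 where a0: "sharp A a0 \<alpha>0" using ex_sharp by blast
  obtain B \<Psi> where \<Psi>: "pure_state \<Theta> (A \<star> B) \<Psi>" "marginal1 \<Theta> A B \<Psi> = \<rho>" using purification_exists[OF \<rho>] by blast
  obtain a where a: "a \<in> orbit A a0" "\<And>a'. a' \<in> orbit A a0 \<Longrightarrow> ev a' \<rho> \<le> ev a \<rho>" using orbit_max[OF a0 \<rho>] by blast
  define q where "q = ev a \<rho>"
  have q: "q > 0" using orbit_pos[OF a0 \<rho>] a(2) unfolding q_def by fastforce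
  have max: "\<forall>a'\<in>orbit A a0. ev a' (marginal1 \<Theta> A B \<Psi>) \<le> q" using a(2) by (simp add: q_def \<Psi>(2))
  have pa: "pure \<Theta> A \<one> a" using orbit_sharp[OF a0 a(1)] by (auto simp: sharp_def)
  have "q \<le> ev a (marginal1 \<Theta> A B \<Psi>)" by (simp add: q_def \<Psi>(2))
  then obtain \<beta> b \<alpha> y where 1: "(a \<otimes> \<I> B) \<odot> \<Psi> = q *\<^sub>R \<beta>" "sharp B b \<beta>" "(\<I> A \<otimes> b) \<odot> \<Psi> = q *\<^sub>R \<alpha>"
    "pure_state \<Theta> A \<alpha>" "ev a \<alpha> = 1" "y \<in> St A" "marginal1 \<Theta> A B \<Psi> = q *\<^sub>R \<alpha> + y"
    by (rule maximal_effect_steering[OF \<Psi>(1) a0 max q pa])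
  have "dag A \<alpha> = a" by (rule dagger_eq) (simp add: sharp_def pa 1)
  moreover have "ev a (marginal1 \<Theta> A B \<Psi>) = q + ev a y" unfolding 1(7) by (simp add: ev_add 1(5))
  ultimately have "ev (dag A \<alpha>) y = 0" by (simp add: q_def \<Psi>(2))
  then show thesis using that 1 q \<Psi>(2) by blast
qed

subsection \<open>Orthonormal families\<close>

text \<open>Measure \<open>e\<close> first by a pure \<open>T\<close> that leaves the \<alpha>
  undisturbed. Then \<open>\<alpha>\<^sup>\<dagger>\<close> after \<open>T\<close> is pure and
  certain on \<alpha>, so it is \<open>\<alpha>\<^sup>\<dagger>\<close> again, and the sum on
  \<open>x\<close> equals the sum on \<open>T \<odot> x\<close>, whose norm is at most
  \<open>ev e x\<close>.\<close>

lemma dagger_sum_le: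
  assumes e: "e \<in> Eff A" and \<alpha>s: "\<And>\<alpha>. \<alpha> \<in> set \<alpha>s \<Longrightarrow> pure_state \<Theta> A \<alpha>" "\<And>\<alpha>. \<alpha> \<in> set \<alpha>s \<Longrightarrow> ev e \<alpha> = 1"
    and le: "\<And>x. x \<in> St A \<Longrightarrow> (\<Sum>\<alpha>\<leftarrow>\<alpha>s. ev (dag A \<alpha>) x) \<le> ev (u A) x" and x: "x \<in> St A"
  shows "(\<Sum>\<alpha>\<leftarrow>\<alpha>s. ev (dag A \<alpha>) x) \<le> ev e x"
proof (cases \<alpha>s)
  case Nil
  then show ?thesis using ev_bounds(1)[OF e x] by simp
next
  case (Cons \<alpha>\<^sub>0 bs)
  then have \<alpha>\<^sub>0: "normal A \<alpha>\<^sub>0" "ev e \<alpha>\<^sub>0 = 1" using \<alpha>s by (auto simp: pure_state_def)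
  obtain T where T: "pure \<Theta> A A T" "\<And>\<sigma>. normal A \<sigma> \<Longrightarrow> ev e \<sigma> = 1 \<Longrightarrow> T \<odot> \<sigma> = \<sigma>"
    "\<And>x. x \<in> St A \<Longrightarrow> ev (u A) (T \<odot> x) \<le> ev e x"
    using nondisturbing[OF e \<alpha>\<^sub>0] by metis
  have tT: "T \<in> Tr A A" using pure_transf[OF T(1)] .
  have "ev (dag A \<alpha>) x = ev (dag A \<alpha>) (T \<odot> x)" if "\<alpha> \<in> set \<alpha>s" for \<alpha>
  proof -
    note \<alpha> = \<alpha>s(1)[OF that]
    have "ev (dag A \<alpha> \<odot> T) \<alpha> = 1"
      using ev_seq[OF tT dagger_effect[OF \<alpha>] pure_state_St[OF \<alpha>]] T(2)[OF pure_state_normalised[OF \<alpha>] \<alpha>s(2)[OF that]]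
        dagger_self[OF \<alpha>] by simp
    then have "dag A \<alpha> = dag A \<alpha> \<odot> T"
      using purity_preservation_seq[OF T(1) dagger_pure[OF \<alpha>]] \<alpha> by (intro dagger_eq) (simp add: sharp_def)
    then show ?thesis using ev_seq[OF tT dagger_effect[OF \<alpha>] x] by simp
  qed
  then have "(\<Sum>\<alpha>\<leftarrow>\<alpha>s. ev (dag A \<alpha>) x) = (\<Sum>\<alpha>\<leftarrow>\<alpha>s. ev (dag A \<alpha>) (T \<odot> x))"
    by (intro arg_cong[where f = sum_list] map_cong) auto
  also have "\<dots> \<le> ev (u A) (T \<odot> x)" by (rule le[OF state_seq[OF x tT]])
  also have "\<dots> \<le> ev e x" by (rule T(3)[OF x])
  finally show ?thesis .
qed

lemma dagger_le: "e \<in> Eff A \<Longrightarrow> pure_state \<Theta> A \<alpha> \<Longrightarrow> ev e \<alpha> = 1 \<Longrightarrow> x \<in> St A \<Longrightarrow> ev (dag A \<alpha>) x \<le> ev e x"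
  using dagger_sum_le[of e A "[\<alpha>]" x] effect_le_discard[OF dagger_effect] by simp

text \<open>Encoded by joint measurability of the \<open>\<alpha>\<^sup>\<dagger>\<close>, with one
  outcome \<open>r\<close> for the rest; the orthogonality relations are a consequence.\<close>

definition orthonormal :: "'a \<Rightarrow> 'b list \<Rightarrow> bool" where
  "orthonormal A \<alpha>s \<longleftrightarrow> (\<forall>\<alpha>\<in>set \<alpha>s. pure_state \<Theta> A \<alpha>) \<and> (\<exists>r. map (dag A) \<alpha>s @ [r] \<in> Tests A \<one>)"

lemma orthonormal_pure: "orthonormal A \<alpha>s \<Longrightarrow> \<alpha> \<in> set \<alpha>s \<Longrightarrow> pure_state \<Theta> A \<alpha>"
  by (simp add: orthonormal_def)

lemma ev_sum_list: "ev (sum_list as) x = (\<Sum>a\<leftarrow>as. ev a x)" "ev a (sum_list xs) = (\<Sum>x\<leftarrow>xs. ev a x)"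
  by (induction as; simp add: ev_add) (induction xs; simp add: ev_add)

lemma orthonormal_remainder:
  assumes "orthonormal A \<alpha>s"
  obtains r where "map (dag A) \<alpha>s @ [r] \<in> Tests A \<one>" "r \<in> Eff A" "(\<Sum>\<alpha>\<leftarrow>\<alpha>s. dag A \<alpha>) + r = u A"
    "\<And>x. (\<Sum>\<alpha>\<leftarrow>\<alpha>s. ev (dag A \<alpha>) x) + ev r x = ev (u A) x"
proof -
  obtain r where t: "map (dag A) \<alpha>s @ [r] \<in> Tests A \<one>" using assms by (auto simp: orthonormal_def)
  have s: "(\<Sum>\<alpha>\<leftarrow>\<alpha>s. dag A \<alpha>) + r = u A" using observation_sum[OF t] by simp
  have "(\<Sum>\<alpha>\<leftarrow>\<alpha>s. ev (dag A \<alpha>) x) + ev r x = ev (u A) x" for x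
    by (simp add: ev_sum_list o_def ev_add flip: s)
  then show thesis using that[OF t _ s] transfI[OF t, of r] by (simp add: effects_def)
qed

lemma orthonormal_sum_le: "orthonormal A \<alpha>s \<Longrightarrow> x \<in> St A \<Longrightarrow> (\<Sum>\<alpha>\<leftarrow>\<alpha>s. ev (dag A \<alpha>) x) \<le> ev (u A) x"
  by (metis orthonormal_remainder ev_bounds(1) le_add_same_cancel1)

text \<open>Perform the tests \<open>{\<alpha>\<^sub>i\<^sup>\<dagger>, u - \<alpha>\<^sub>i\<^sup>\<dagger>}\<close> one after the other, each without disturbing the later states.\<close>

lemma orthonormalI:
  assumes "\<And>\<alpha>. \<alpha> \<in> set \<alpha>s \<Longrightarrow> pure_state \<Theta> A \<alpha>" "sorted_wrt (\<lambda>\<alpha> \<beta>. ev (dag A \<alpha>) \<beta> = 0) \<alpha>s"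
  shows "orthonormal A \<alpha>s"
  using assms
proof (induction \<alpha>s)
  case Nil
  then show ?case using discard_channel[of A] by (auto simp: orthonormal_def channel_def)
next
  case (Cons \<alpha> \<alpha>s)
  have \<alpha>: "pure_state \<Theta> A \<alpha>" using Cons.prems(1) by simp
  note da = dagger_effect[OF \<alpha>]
  show ?case
  proof (cases \<alpha>s)
    case Nil
    then show ?thesis using effect_complement(1)[OF da] \<alpha> by (auto simp: orthonormal_def)
  next
    case (Cons \<beta> bs)
    have ih: "orthonormal A \<alpha>s" using Cons.IH Cons.prems by simp
    then obtain r where r: "map (dag A) \<alpha>s @ [r] \<in> Tests A \<one>" by (auto simp: orthonormal_def)
    have one: "ev (u A - dag A \<alpha>) \<gamma> = 1" if "\<gamma> \<in> set \<alpha>s" for \<gamma>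
      using that Cons.prems pure_state_normalised[of A \<gamma>] by (auto simp: ev_diff normalised_iff)
    have \<beta>: "normal A \<beta>" "ev (u A - dag A \<alpha>) \<beta> = 1"
      using one Cons orthonormal_pure[OF ih] by (auto simp: pure_state_def)
    obtain T where T: "pure \<Theta> A A T" "\<And>\<sigma>. normal A \<sigma> \<Longrightarrow> ev (u A - dag A \<alpha>) \<sigma> = 1 \<Longrightarrow> T \<odot> \<sigma> = \<sigma>"
      "\<And>cs. cs \<in> Tests A \<one> \<Longrightarrow> \<exists>r. (u A - (u A - dag A \<alpha>)) # map (\<lambda>c. c \<odot> T) cs @ [r] \<in> Tests A \<one>"
      using nondisturbing[OF effect_complement(2)[OF da] \<beta>] by metis
    have tT: "T \<in> Tr A A" using pure_transf[OF T(1)] .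
    have dT: "dag A \<gamma> \<odot> T = dag A \<gamma>" if "\<gamma> \<in> set \<alpha>s" for \<gamma>
    proof -
      note \<gamma> = orthonormal_pure[OF ih that]
      have "ev (dag A \<gamma> \<odot> T) \<gamma> = 1"
        using ev_seq[OF tT dagger_effect[OF \<gamma>] pure_state_St[OF \<gamma>]] T(2)[OF pure_state_normalised[OF \<gamma>] one[OF that]]
          dagger_self[OF \<gamma>] by simp
      then show ?thesis
        using purity_preservation_seq[OF T(1) dagger_pure[OF \<gamma>]] \<gamma> by (intro dagger_eq[symmetric]) (simp add: sharp_def)
    qed
    obtain r' where "(u A - (u A - dag A \<alpha>)) # map (\<lambda>c. c \<odot> T) (map (dag A) \<alpha>s @ [r]) @ [r'] \<in> Tests A \<one>"
      using T(3)[OF r] by blast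
    then have "map (dag A) (\<alpha> # \<alpha>s) @ [r \<odot> T, r'] \<in> Tests A \<one>" using dT by (simp add: o_def cong: map_cong)
    from coarse_grain_last[OF this] show ?thesis using Cons.prems(1) by (auto simp: orthonormal_def)
  qed
qed

text \<open>The values on a member are probabilities with sum at most one, and its own effect
  already takes the value one.\<close>

lemma orthonormal_delta:
  assumes on: "orthonormal A \<alpha>s" and ij: "i < length \<alpha>s" "j < length \<alpha>s"
  shows "ev (dag A (\<alpha>s ! i)) (\<alpha>s ! j) = (if i = j then 1 else 0)"
proof -
  have p: "pure_state \<Theta> A (\<alpha>s ! k)" if "k < length \<alpha>s" for k using orthonormal_pure[OF on] that by simp
  let ?d = "\<lambda>k. ev (dag A (\<alpha>s ! k)) (\<alpha>s ! j)"
  have nn: "0 \<le> ?d k" if "k < length \<alpha>s" for k using dagger_nonneg[OF p[OF that] pure_state_St[OF p[OF ij(2)]]] .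
  have "(\<Sum>k<length \<alpha>s. ?d k) \<le> 1"
    using orthonormal_sum_le[OF on pure_state_St[OF p[OF ij(2)]]] pure_state_normalised[OF p[OF ij(2)]]
    by (simp add: sum_list_sum_nth atLeast0LessThan normalised_iff)
  moreover have "?d j = 1" using dagger_self[OF p[OF ij(2)]] .
  ultimately have "(\<Sum>k\<in>{..<length \<alpha>s} - {j}. ?d k) \<le> 0" using ij(2) by (simp add: sum.remove[of _ j])
  moreover have "?d i \<le> (\<Sum>k\<in>{..<length \<alpha>s} - {j}. ?d k)" if "i \<noteq> j"
    using that ij nn by (intro member_le_sum) auto
  ultimately show ?thesis using nn[OF ij(1)] \<open>?d j = 1\<close> by (cases "i = j") auto
qed

text \<open>Only the effects of the old states have to vanish on the new one; the converse relation
  comes with the joint test.\<close>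

lemma orthonormal_append:
  assumes "orthonormal A \<alpha>s" "pure_state \<Theta> A \<alpha>" "\<And>\<beta>. \<beta> \<in> set \<alpha>s \<Longrightarrow> ev (dag A \<beta>) \<alpha> = 0"
  shows "orthonormal A (\<alpha>s @ [\<alpha>])"
proof (rule orthonormalI)
  have "sorted_wrt (\<lambda>\<alpha> \<beta>. ev (dag A \<alpha>) \<beta> = 0) \<alpha>s"
    using orthonormal_delta[OF assms(1)] by (simp add: sorted_wrt_iff_nth_less)
  then show "sorted_wrt (\<lambda>\<alpha> \<beta>. ev (dag A \<alpha>) \<beta> = 0) (\<alpha>s @ [\<alpha>])"
    using assms(3) by (simp add: sorted_wrt_append)
qed (use assms orthonormal_pure in auto)

subsection \<open>The invariant state\<close>

text \<open>The invariant state minimises the largest value that a strictly convex function attains on an orbit.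
  It replaces the average over the compact group of reversible channels.\<close>

lemma ex_invariant_state: "\<exists>\<omega>. normal A \<omega> \<and> (\<forall>V. reversible \<Theta> A A V \<longrightarrow> V \<odot> \<omega> = \<omega>)"
proof -
  obtain g :: "'b \<Rightarrow> real" and K where
    G: "\<forall>B C f. linear f \<longrightarrow> continuous_on (Tr B C) (\<lambda>x. g (f x))"
      "\<forall>x y d. g (d *\<^sub>R x + (1 - d) *\<^sub>R y) = d * g x + (1 - d) * g y - d * (1 - d) * g (x - y)"
      "\<forall>x\<in>span (St A). g x \<le> 0 \<longrightarrow> x = 0" "\<forall>x\<in>St A. 0 \<le> g x \<and> g x \<le> K"
    using strictly_convex_function[of A] by (elim exE conjE) (rule that)
  note g = G(1)[rule_format] G(2)[rule_format] G(3)[rule_format]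
  have K: "\<And>x. x \<in> St A \<Longrightarrow> 0 \<le> g x" "\<And>x. x \<in> St A \<Longrightarrow> g x \<le> K" using G(4) by blast+
  let ?R = "{V. reversible \<Theta> A A V}"
  let ?D = "{\<rho>. normal A \<rho>} \<times> {0..K}"
  have image: "V \<odot> \<rho> \<in> St A" if "V \<in> ?R" "normal A \<rho>" for V \<rho>
    using normalised_St normalised_seq reversible_channel that by blast
  \<comment> \<open>Pairs of a state and an upper bound of \<open>g\<close> on its orbit. Minimising
    the bound over this compact set avoids discussing continuity of the supremum in the
    state.\<close>
  define P where "P = ?D \<inter> (\<Inter>V\<in>?R. {z \<in> ?D. g (V \<odot> fst z) - snd z \<in> {..0}})"
  have cD: "compact ?D" by (intro compact_Times compact_normalised compact_Icc)
  have cont: "continuous_on ?D (\<lambda>z. g (V \<odot> fst z) - snd z)" for V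
  proof -
    have "continuous_on {\<rho>. normal A \<rho>} (\<lambda>\<rho>. g (V \<odot> \<rho>))"
      by (rule continuous_on_subset[OF g(1)[OF seq_linear_right]]) (auto dest: St_transf[OF normalised_St])
    then have "continuous_on ?D (\<lambda>z. g (V \<odot> fst z))"
      by (rule continuous_on_compose2[of _ _ _ fst]) (auto intro: continuous_on_fst continuous_on_id)
    then show ?thesis by (intro continuous_intros)
  qed
  have "closed {z \<in> ?D. g (V \<odot> fst z) - snd z \<in> {..0}}" for V
  proof -
    have "{z \<in> ?D. g (V \<odot> fst z) - snd z \<in> {..0}} = ?D \<inter> (\<lambda>z. g (V \<odot> fst z) - snd z) -` {..0}" by blast
    then show ?thesis using continuous_closed_preimage[OF cont compact_imp_closed[OF cD] closed_atMost] by metis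
  qed
  then have "compact P" unfolding P_def by (intro compact_Int_closed[OF cD] closed_INT ballI) auto
  have inP: "(\<rho>, t) \<in> P \<longleftrightarrow> normal A \<rho> \<and> 0 \<le> t \<and> t \<le> K \<and> (\<forall>V\<in>?R. g (V \<odot> \<rho>) \<le> t)" for \<rho> t
    by (auto simp: P_def)
  obtain \<rho>\<^sub>0 where \<rho>\<^sub>0: "normal A \<rho>\<^sub>0" using ex_normalised by blast
  have "K \<ge> 0" using K[OF normalised_St[OF \<rho>\<^sub>0]] by linarith
  then have "(\<rho>\<^sub>0, K) \<in> P" using \<rho>\<^sub>0 K(2) image by (auto simp: inP)
  then have "P \<noteq> {}" by blast
  have "\<exists>z\<in>P. \<forall>z'\<in>P. snd z \<le> snd z'"
    using continuous_attains_inf[OF \<open>compact P\<close> \<open>P \<noteq> {}\<close> continuous_on_snd[OF continuous_on_id]] .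
  then obtain \<rho> t where \<rho>t: "(\<rho>, t) \<in> P" and min: "\<forall>z'\<in>P. t \<le> snd z'" by auto
  have \<rho>: "normal A \<rho>" "0 \<le> t" "t \<le> K" "\<And>V. V \<in> ?R \<Longrightarrow> g (V \<odot> \<rho>) \<le> t" using \<rho>t by (auto simp: inP)
  have "W \<odot> \<rho> = \<rho>" if W: "reversible \<Theta> A A W" for W
  proof -
    define y where "y = W \<odot> \<rho>"
    have y: "normal A y" unfolding y_def using normalised_seq[OF \<rho>(1) reversible_channel[OF W]] .
    \<comment> \<open>If \<open>W\<close> moved \<rho>, strict convexity would make the maximum of
      \<open>g\<close> on the orbit of the midpoint of \<rho> and \<open>y\<close> smaller than the
      minimum \<open>t\<close>.\<close>
    define z where "z = (1/2) *\<^sub>R \<rho> + (1 - 1/2) *\<^sub>R y"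
    have z: "normal A z" unfolding z_def by (intro normalised_convex \<rho>(1) y) auto
    have "linear (\<lambda>V. V \<odot> z)" by (rule seq_linear_left)
    from g(1)[OF this, of A A] have "continuous_on (mutual_inverses A) (\<lambda>x. g (fst x \<odot> z))"
      by (rule continuous_on_compose2[of _ _ _ fst]) (auto simp: mutual_inverses_def intro: continuous_on_fst continuous_on_id)
    moreover have "(\<I> A, \<I> A) \<in> mutual_inverses A" by (simp add: mutual_inverses_def seq_ident[OF ident_transf])
    ultimately have "\<exists>x\<in>mutual_inverses A. \<forall>x'\<in>mutual_inverses A. g (fst x' \<odot> z) \<le> g (fst x \<odot> z)"
      using continuous_attains_sup[OF compact_mutual_inverses] by blast
    then obtain x where x: "x \<in> mutual_inverses A" "\<forall>x'\<in>mutual_inverses A. g (fst x' \<odot> z) \<le> g (fst x \<odot> z)" by blast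
    define V where "V = fst x"
    have V: "V \<in> ?R" using x(1) mutual_inverses_reversible V_def by (metis mem_Collect_eq prod.collapse)
    have maxV: "g (V' \<odot> z) \<le> g (V \<odot> z)" if "V' \<in> ?R" for V'
    proof -
      obtain W' where "(V', W') \<in> mutual_inverses A" using \<open>V' \<in> ?R\<close> mutual_inverses_reversible by blast
      from bspec[OF x(2) this] show ?thesis by (simp add: V_def)
    qed
    have "(z, g (V \<odot> z)) \<in> P" unfolding inP using z K image[OF V z] maxV by blast
    then have "t \<le> g (V \<odot> z)" using min by auto
    also have "V \<odot> z = (1/2) *\<^sub>R (V \<odot> \<rho>) + (1 - 1/2) *\<^sub>R (V \<odot> y)" unfolding z_def by (simp add: seq_add)
    also have "g \<dots> = (1/2) * g (V \<odot> \<rho>) + (1 - 1/2) * g (V \<odot> y) - (1/2) * (1 - 1/2) * g (V \<odot> \<rho> - V \<odot> y)" by (rule g(2))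
    finally have t: "t \<le> (1/2) * g (V \<odot> \<rho>) + (1 - 1/2) * g (V \<odot> y) - (1/2) * (1 - 1/2) * g (V \<odot> \<rho> - V \<odot> y)" .
    obtain V' where V': "V' \<in> Tr A A" "V \<in> Tr A A" "V' \<odot> V = \<I> A" "V \<odot> V' = \<I> A" using V by (auto simp: reversible_iff)
    obtain W' where W': "W' \<in> Tr A A" "W \<in> Tr A A" "W' \<odot> W = \<I> A" "W \<odot> W' = \<I> A" using W by (auto simp: reversible_iff)
    have stp: "\<rho> \<in> St A" "y \<in> St A" using \<rho>(1) y by (auto simp: normalised_iff)
    have "(W' \<odot> V') \<odot> (V \<odot> W) = W' \<odot> ((V' \<odot> V) \<odot> W)"
      using seq_assoc[OF transf_seq[OF W'(2) V'(2)] V'(1) W'(1)] seq_assoc[OF W'(2) V'(2,1)] by simp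
    then have i1: "(W' \<odot> V') \<odot> (V \<odot> W) = \<I> A" by (simp add: V'(3) seq_ident[OF W'(2)] W'(3))
    have "(V \<odot> W) \<odot> (W' \<odot> V') = V \<odot> ((W \<odot> W') \<odot> V')"
      using seq_assoc[OF transf_seq[OF V'(1) W'(1)] W'(2) V'(2)] seq_assoc[OF V'(1) W'(1,2)] by simp
    then have i2: "(V \<odot> W) \<odot> (W' \<odot> V') = \<I> A" by (simp add: W'(4) seq_ident[OF V'(1)] V'(4))
    \<comment> \<open>The orbit of \<open>y\<close> is contained in that of \<rho>, so
      \<open>t\<close> bounds \<open>g\<close> on it as well.\<close>
    have "reversible \<Theta> A A (V \<odot> W)"
      unfolding reversible_iff using i1 i2 transf_seq W' V' by blast
    then have "g ((V \<odot> W) \<odot> \<rho>) \<le> t" using \<rho>(4) by blast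
    then have "g (V \<odot> y) \<le> t" by (simp add: y_def seq_act[OF stp(1) W'(2) V'(2)])
    moreover have "g (V \<odot> \<rho>) \<le> t" using \<rho>(4) V by blast
    ultimately have "g (V \<odot> \<rho> - V \<odot> y) \<le> 0" using t by simp
    moreover have "V \<odot> \<rho> - V \<odot> y \<in> span (St A)" using image[OF V] \<rho>(1) y by (intro span_diff span_base) auto
    ultimately have eq: "V \<odot> \<rho> = V \<odot> y" using g(3) by fastforce
    have "V' \<odot> (V \<odot> w) = w" if "w \<in> St A" for w
      using seq_act[OF that V'(2,1)] V'(3) seq_ident(2)[OF St_transf[OF that]] by simp
    then have "\<rho> = y" using eq stp by metis
    then show ?thesis by (simp add: y_def)
  qed
  then show ?thesis using \<rho>(1) by blast
qed

text \<open>The maximally mixed state; \<open>c\<close> turns out to be the reciprocal of the size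
  of the pure maximal sets.\<close>

definition uniform :: "'a \<Rightarrow> 'b \<Rightarrow> real \<Rightarrow> bool" where
  "uniform A \<omega> c \<longleftrightarrow> normal A \<omega> \<and> c > 0 \<and> (\<forall>\<alpha>. pure_state \<Theta> A \<alpha> \<longrightarrow> ev (dag A \<alpha>) \<omega> = c)"

lemma uniformD:
  assumes "uniform A \<omega> c"
  shows "normal A \<omega>" "c > 0" "\<And>\<alpha>. pure_state \<Theta> A \<alpha> \<Longrightarrow> ev (dag A \<alpha>) \<omega> = c"
  using assms by (simp_all add: uniform_def)

text \<open>Reversible channels permute the pure states transitively and carry their effects along,
  so an invariant state gives all of these effects the same value.\<close>

lemma ex_uniform_state: "\<exists>\<omega> c. uniform A \<omega> c"
proof -
  obtain \<omega> where \<omega>: "normal A \<omega>" "\<And>V. reversible \<Theta> A A V \<Longrightarrow> V \<odot> \<omega> = \<omega>" using ex_invariant_state by blast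
  obtain \<alpha> where \<alpha>: "pure_state \<Theta> A \<alpha>" "ev (dag A \<alpha>) \<omega> > 0" using dagger_pos[OF \<omega>(1)] by blast
  have "ev (dag A \<beta>) \<omega> = ev (dag A \<alpha>) \<omega>" if \<beta>: "pure_state \<Theta> A \<beta>" for \<beta>
  proof -
    obtain V where V: "reversible \<Theta> A A V" "\<beta> = V \<odot> \<alpha>" using pure_transitive[OF \<alpha>(1) \<beta>] .
    then obtain W where W: "V \<in> Tr A A" "W \<in> Tr A A" "W \<odot> V = \<I> A" "V \<odot> W = \<I> A" by (auto simp: reversible_iff)
    have "reversible \<Theta> A A W" using W by (auto simp: reversible_iff)
    then have "ev (dag A \<alpha>) (W \<odot> \<omega>) = ev (dag A \<alpha>) \<omega>" using \<omega>(2) by simp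
    then show ?thesis
      using ev_seq[OF W(2) dagger_effect[OF \<alpha>(1)] normalised_St[OF \<omega>(1)]] dagger_reversible[OF \<alpha>(1) W] V(2) by simp
  qed
  then show ?thesis using \<omega>(1) \<alpha>(2) unfolding uniform_def by blast
qed

text \<open>An orthonormal family is steered to a family on the purifying system, which is orthonormal as well,
  so that its test steers back to an ensemble of the uniform state.\<close>

lemma uniform_decomposition:
  assumes unif: "uniform A \<omega> c"
    and on: "orthonormal A \<alpha>s"
  shows "\<exists>x\<in>St A. \<omega> = c *\<^sub>R sum_list \<alpha>s + x"
proof -
  note \<omega> = uniformD[OF unif]
  obtain B \<Phi> where \<Phi>: "pure_state \<Theta> (A \<star> B) \<Phi>" "marginal1 \<Theta> A B \<Phi> = \<omega>" using purification_exists[OF \<omega>(1)] by blast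
  note st = pure_state_St[OF \<Phi>(1)]
  have "\<exists>\<beta>. pure_state \<Theta> B \<beta> \<and> (dag A \<alpha> \<otimes> \<I> B) \<odot> \<Phi> = c *\<^sub>R \<beta> \<and> (\<I> A \<otimes> dag B \<beta>) \<odot> \<Phi> = c *\<^sub>R \<alpha>"
    if \<alpha>: "pure_state \<Theta> A \<alpha>" for \<alpha>
  proof -
    have "c = ev (dag A \<alpha>) (marginal1 \<Theta> A B \<Phi>)" using \<omega>(3)[OF \<alpha>] \<Phi>(2) by simp
    then obtain \<beta> z where \<beta>: "pure_state \<Theta> B \<beta>" "(dag A \<alpha> \<otimes> \<I> B) \<odot> \<Phi> = c *\<^sub>R \<beta>" "z \<in> St B"
        "marginal2 \<Theta> A B \<Phi> = c *\<^sub>R \<beta> + z"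
      using \<omega>(2) by (rule pure_steer_left[OF \<Phi>(1) dagger_pure[OF \<alpha>]])
    define q where "q = ev (dag B \<beta>) (marginal2 \<Theta> A B \<Phi>)"
    have "q = c + ev (dag B \<beta>) z" by (simp add: q_def \<beta>(4) ev_add dagger_self[OF \<beta>(1)])
    then have q: "c \<le> q" "q > 0" using dagger_nonneg[OF \<beta>(1,3)] \<omega>(2) by auto
    obtain \<alpha>' y where \<alpha>': "pure_state \<Theta> A \<alpha>'" "(\<I> A \<otimes> dag B \<beta>) \<odot> \<Phi> = q *\<^sub>R \<alpha>'" "y \<in> St A"
        "marginal1 \<Theta> A B \<Phi> = q *\<^sub>R \<alpha>' + y"
      by (rule pure_steer_right[OF \<Phi>(1) dagger_pure[OF \<beta>(1)] q_def q(2)])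
    \<comment> \<open>Every \<open>\<alpha>\<^sup>\<dagger>\<close> has the value \<open>c\<close>
      on \<omega>, so the weight \<open>q\<close> of the returned state cannot exceed
      \<open>c\<close>.\<close>
    have "c = ev (dag A \<alpha>') (q *\<^sub>R \<alpha>' + y)" using \<omega>(3)[OF \<alpha>'(1)] \<alpha>'(4) \<Phi>(2) by simp
    then have "c = q + ev (dag A \<alpha>') y" by (simp add: ev_add dagger_self[OF \<alpha>'(1)])
    then have "q = c" using q(1) dagger_nonneg[OF \<alpha>'(1,3)] by simp
    have "c * ev (dag B \<beta>) \<beta> = c * ev (dag A \<alpha>) \<alpha>'"
      using ev_reduce_left[OF st dagger_effect[OF \<alpha>] dagger_effect[OF \<beta>(1)]]
        ev_reduce_right[OF st dagger_effect[OF \<alpha>] dagger_effect[OF \<beta>(1)]]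
      by (simp add: \<beta>(2) \<alpha>'(2) \<open>q = c\<close>)
    then have "ev (dag A \<alpha>) \<alpha>' = 1" using \<omega>(2) dagger_self[OF \<beta>(1)] by simp
    then have "\<alpha>' = \<alpha>" using dagger_state_unique[OF \<alpha> pure_state_normalised[OF \<alpha>'(1)]] by simp
    then show ?thesis using \<beta> \<alpha>'(2) \<open>q = c\<close> by blast
  qed
  then obtain s where s: "\<And>\<alpha>. pure_state \<Theta> A \<alpha> \<Longrightarrow> pure_state \<Theta> B (s \<alpha>)"
      "\<And>\<alpha>. pure_state \<Theta> A \<alpha> \<Longrightarrow> (dag A \<alpha> \<otimes> \<I> B) \<odot> \<Phi> = c *\<^sub>R s \<alpha>"
      "\<And>\<alpha>. pure_state \<Theta> A \<alpha> \<Longrightarrow> (\<I> A \<otimes> dag B (s \<alpha>)) \<odot> \<Phi> = c *\<^sub>R \<alpha>" by metis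
  \<comment> \<open>Again a joint probability on \<Phi> computed from both sides; \<open>s\<close>
    exchanges the roles of state and effect.\<close>
  have s_ev: "ev (dag B (s \<alpha>)) (s \<beta>) = ev (dag A \<beta>) \<alpha>" if "pure_state \<Theta> A \<alpha>" "pure_state \<Theta> A \<beta>" for \<alpha> \<beta>
  proof -
    have "c * ev (dag B (s \<alpha>)) (s \<beta>) = c * ev (dag A \<beta>) \<alpha>"
      using ev_reduce_left[OF st dagger_effect[OF that(2)] dagger_effect[OF s(1)[OF that(1)]]]
        ev_reduce_right[OF st dagger_effect[OF that(2)] dagger_effect[OF s(1)[OF that(1)]]]
      by (simp add: s(2)[OF that(2)] s(3)[OF that(1)])
    then show ?thesis using \<omega>(2) by simp
  qed
  have "orthonormal B (map s \<alpha>s)"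
  proof (rule orthonormalI)
    show "sorted_wrt (\<lambda>\<alpha> \<beta>. ev (dag B \<alpha>) \<beta> = 0) (map s \<alpha>s)"
      unfolding sorted_wrt_iff_nth_less
    proof (intro allI impI)
      fix i j assume ij: "i < j" "j < length (map s \<alpha>s)"
      then have "pure_state \<Theta> A (\<alpha>s ! i)" "pure_state \<Theta> A (\<alpha>s ! j)" using orthonormal_pure[OF on] by auto
      then show "ev (dag B (map s \<alpha>s ! i)) (map s \<alpha>s ! j) = 0"
        using s_ev orthonormal_delta[OF on, of j i] ij by simp
    qed
  qed (use orthonormal_pure[OF on] s(1) in auto)
  then obtain r where r: "map (dag B) (map s \<alpha>s) @ [r] \<in> Tests B \<one>" "r \<in> Eff B" by (rule orthonormal_remainder)
  have "\<omega> = (\<Sum>b\<leftarrow>map (dag B) (map s \<alpha>s). (\<I> A \<otimes> b) \<odot> \<Phi>) + (\<I> A \<otimes> r) \<odot> \<Phi>"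
    using ensemble_marginal[OF st r(1)] \<Phi>(2) by simp
  also have "(\<Sum>b\<leftarrow>map (dag B) (map s \<alpha>s). (\<I> A \<otimes> b) \<odot> \<Phi>) = (\<Sum>\<alpha>\<leftarrow>\<alpha>s. c *\<^sub>R \<alpha>)"
    unfolding map_map o_def using s(3) orthonormal_pure[OF on] by (intro arg_cong[where f = sum_list] map_cong) auto
  also have "\<dots> = c *\<^sub>R sum_list \<alpha>s" by (induction \<alpha>s) (simp_all add: scaleR_add_right)
  finally show ?thesis using reduce_right[OF st r(2)] by blast
qed

text \<open>Maximality as an equation, with no effect left over; the equivalence with
  \<open>pure_maximal\<close> follows below.\<close>

definition complete :: "'a \<Rightarrow> 'b list \<Rightarrow> bool" where
  "complete A \<alpha>s \<longleftrightarrow> orthonormal A \<alpha>s \<and> (\<Sum>\<alpha>\<leftarrow>\<alpha>s. dag A \<alpha>) = u A"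

lemma complete_sum: "complete A \<alpha>s \<Longrightarrow> (\<Sum>\<alpha>\<leftarrow>\<alpha>s. ev (dag A \<alpha>) x) = ev (u A) x"
  using ev_sum_list(1)[of "map (dag A) \<alpha>s" x] by (simp add: complete_def o_def)

lemma orthonormal_sum_ev:
  assumes "orthonormal A \<alpha>s" "\<alpha> \<in> set \<alpha>s"
  shows "ev (dag A \<alpha>) (sum_list \<alpha>s) = 1"
proof -
  obtain i where i: "i < length \<alpha>s" "\<alpha> = \<alpha>s ! i" using assms(2) by (auto simp: in_set_conv_nth)
  have "ev (dag A \<alpha>) (sum_list \<alpha>s) = (\<Sum>j<length \<alpha>s. ev (dag A (\<alpha>s ! i)) (\<alpha>s ! j))"
    by (simp add: ev_sum sum_list_sum_nth atLeast0LessThan i(2))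
  also have "\<dots> = (\<Sum>j<length \<alpha>s. if i = j then 1 else 0)"
    using orthonormal_delta[OF assms(1) i(1)] by (intro sum.cong) auto
  also have "\<dots> = 1" using i(1) by simp
  finally show ?thesis .
qed

text \<open>The norm of the remainder is nonnegative, so an orthonormal family has at most
  \<open>1 / c\<close> members. This is what bounds the process of extending such a family.\<close>

lemma uniform_remainder:
  assumes unif: "uniform A \<omega> c"
    and on: "orthonormal A \<alpha>s"
  obtains x where "x \<in> St A" "\<omega> = c *\<^sub>R sum_list \<alpha>s + x" "\<forall>\<alpha>\<in>set \<alpha>s. ev (dag A \<alpha>) x = 0"
    "ev (u A) x = 1 - c * length \<alpha>s"
proof -
  note \<omega> = uniformD[OF unif]
  obtain x where x: "x \<in> St A" "\<omega> = c *\<^sub>R sum_list \<alpha>s + x" using uniform_decomposition[OF assms] by blast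
  have z: "ev (dag A \<alpha>) x = 0" if "\<alpha> \<in> set \<alpha>s" for \<alpha>
  proof -
    have "c = ev (dag A \<alpha>) (c *\<^sub>R sum_list \<alpha>s + x)" using \<omega>(3)[OF orthonormal_pure[OF on that]] x(2) by simp
    then show ?thesis using orthonormal_sum_ev[OF on that] by (simp add: ev_add)
  qed
  have "(\<Sum>\<alpha>\<leftarrow>\<alpha>s. ev (u A) \<alpha>) = (\<Sum>\<alpha>\<leftarrow>\<alpha>s. 1)"
    using orthonormal_pure[OF on] pure_state_normalised
    by (intro arg_cong[where f = sum_list] map_cong) (auto simp: normalised_iff)
  also have "\<dots> = real (length \<alpha>s)" by (simp add: sum_list_triv)
  finally have "ev (u A) (sum_list \<alpha>s) = length \<alpha>s" by (simp add: ev_sum_list(2))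
  moreover have "1 = ev (u A) (c *\<^sub>R sum_list \<alpha>s + x)" using \<omega>(1) x(2) by (simp add: normalised_iff)
  ultimately have "ev (u A) x = 1 - c * length \<alpha>s" by (simp add: ev_add)
  then show thesis using that[of x] x z by blast
qed

text \<open>The remainder of the uniform state is annihilated by the whole family, hence zero by
  hypothesis. So the leftover effect \<open>r\<close> vanishes on \<omega>, and therefore on every
  pure state, since each has weight \<open>c\<close> in \<omega>. A linear functional is largest at
  a pure state, so \<open>r\<close> is zero.\<close>

lemma orthonormal_completeI:
  assumes on: "orthonormal A \<alpha>s"
    and no: "\<And>\<sigma>. normal A \<sigma> \<Longrightarrow> \<exists>\<alpha>\<in>set \<alpha>s. ev (dag A \<alpha>) \<sigma> \<noteq> 0"
  shows "complete A \<alpha>s"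
proof -
  obtain \<omega> c where unif: "uniform A \<omega> c" using ex_uniform_state by blast
  note \<omega> = uniformD[OF unif]
  obtain x where x: "x \<in> St A" "\<omega> = c *\<^sub>R sum_list \<alpha>s + x" "\<forall>\<alpha>\<in>set \<alpha>s. ev (dag A \<alpha>) x = 0"
    "ev (u A) x = 1 - c * length \<alpha>s" by (rule uniform_remainder[OF unif on])
  have "x = 0"
  proof (rule ccontr)
    assume "x \<noteq> 0"
    then obtain \<sigma> where \<sigma>: "normal A \<sigma>" "x = ev (u A) x *\<^sub>R \<sigma>" "ev (u A) x > 0" using state_normalise[OF x(1)] by metis
    have "ev (dag A \<alpha>) \<sigma> = 0" if "\<alpha> \<in> set \<alpha>s" for \<alpha>
    proof -
      have "ev (dag A \<alpha>) (ev (u A) x *\<^sub>R \<sigma>) = 0" using bspec[OF x(3) that] \<sigma>(2) by simp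
      then show ?thesis using \<sigma>(3) by simp
    qed
    then show False using no[OF \<sigma>(1)] by blast
  qed
  obtain r where r: "map (dag A) \<alpha>s @ [r] \<in> Tests A \<one>" "r \<in> Eff A" "(\<Sum>\<alpha>\<leftarrow>\<alpha>s. dag A \<alpha>) + r = u A"
    using orthonormal_remainder[OF on] by blast
  have r4: "(\<Sum>\<alpha>\<leftarrow>\<alpha>s. ev (dag A \<alpha>) x) + ev r x = ev (u A) x" for x
    using ev_add(2)[of "\<Sum>\<alpha>\<leftarrow>\<alpha>s. dag A \<alpha>" r x] by (simp add: r(3) ev_sum_list(1) o_def)
  have "(\<Sum>\<alpha>\<leftarrow>\<alpha>s. ev (dag A \<alpha>) \<omega>) = (\<Sum>\<alpha>\<leftarrow>\<alpha>s. c)"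
    using \<omega>(3) orthonormal_pure[OF on] by (intro arg_cong[where f = sum_list] map_cong) auto
  then have "ev r \<omega> = 0" using r4[of \<omega>] x(4) \<omega>(1) \<open>x = 0\<close> by (simp add: normalised_iff sum_list_triv mult.commute)
  have "ev r \<alpha> = 0" if \<alpha>: "pure_state \<Theta> A \<alpha>" for \<alpha>
  proof -
    have "orthonormal A [\<alpha>]" by (rule orthonormalI) (use \<alpha> in auto)
    then obtain y where y: "y \<in> St A" "\<omega> = c *\<^sub>R \<alpha> + y" using uniform_decomposition[OF unif, of "[\<alpha>]"] by auto
    have "c * ev r \<alpha> + ev r y = 0" using \<open>ev r \<omega> = 0\<close> by (simp add: y(2) ev_add)
    moreover have "0 \<le> ev r y" "0 \<le> ev r \<alpha>" using ev_bounds(1)[OF r(2)] y(1) pure_state_St[OF \<alpha>] by auto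
    ultimately have "c * ev r \<alpha> \<le> 0" by linarith
    then show ?thesis using \<omega>(2) \<open>0 \<le> ev r \<alpha>\<close> by (simp add: mult_le_0_iff)
  qed
  moreover obtain \<alpha> where "pure_state \<Theta> A \<alpha>" "\<And>\<rho>. normal A \<rho> \<Longrightarrow> ev r \<rho> \<le> ev r \<alpha>"
    by (rule pure_state_maximising[OF ev_linear_right \<omega>(1)]) blast
  ultimately have n0: "ev r \<rho> = 0" if "normal A \<rho>" for \<rho>
    using that ev_bounds(1)[OF r(2) normalised_St[OF that]] by (metis order_antisym)
  have "r = 0"
  proof (rule effect_eqI[OF r(2)])
    show z: "0 \<in> Eff A" using transf_scale[OF Eff_transf[OF r(2)], of 0] by (simp add: effects_def)
    fix \<rho> assume \<rho>: "\<rho> \<in> St A"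
    have "ev r \<rho> = 0"
    proof (cases "\<rho> = 0")
      case False
      then obtain \<sigma> l where "normal A \<sigma>" "\<rho> = l *\<^sub>R \<sigma>" using state_normalise[OF \<rho>] by metis
      then show ?thesis using n0 by simp
    qed simp
    then show "pairing \<Theta> r \<rho> = pairing \<Theta> 0 \<rho>"
      using pairing_effect[OF r(2) \<rho>] pairing_effect[OF z \<rho>] by simp
  qed
  then show ?thesis using on r(3) by (simp add: complete_def)
qed

lemma complete_nonempty: "complete A \<alpha>s \<Longrightarrow> \<alpha>s \<noteq> []"
  using ex_normalised[of A] by (auto simp: complete_def normalised_iff)

lemma complete_uniform:
  assumes unif: "uniform A \<omega> c" and cs: "complete A \<alpha>s"
  shows "\<omega> = c *\<^sub>R sum_list \<alpha>s" "c * length \<alpha>s = 1"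
proof -
  note \<omega> = uniformD[OF unif]
  have on: "orthonormal A \<alpha>s" using cs by (simp add: complete_def)
  obtain x where x: "x \<in> St A" "\<omega> = c *\<^sub>R sum_list \<alpha>s + x" "\<forall>\<alpha>\<in>set \<alpha>s. ev (dag A \<alpha>) x = 0"
    "ev (u A) x = 1 - c * length \<alpha>s" by (rule uniform_remainder[OF unif on])
  have "(\<Sum>\<alpha>\<leftarrow>\<alpha>s. ev (dag A \<alpha>) x) = (\<Sum>\<alpha>\<leftarrow>\<alpha>s. 0)" using x(3) by (intro arg_cong[where f = sum_list] map_cong) auto
  then have "ev (u A) x = 0" using complete_sum[OF cs, of x] by simp
  then show "\<omega> = c *\<^sub>R sum_list \<alpha>s" "c * length \<alpha>s = 1" using x(2,4) state_zero_norm[OF x(1)] by auto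
qed

section \<open>Pure maximal sets as complete orthonormal families\<close>

lemma perfectly_distinguishable_ev:
  "perfectly_distinguishable \<Theta> A \<rho>s \<longleftrightarrow> (\<forall>\<rho>\<in>set \<rho>s. normal A \<rho>) \<and>
     (\<exists>as\<in>Tests A \<one>. length as = length \<rho>s \<and>
        (\<forall>i<length \<rho>s. \<forall>j<length \<rho>s. ev (as ! i) (\<rho>s ! j) = (if i = j then 1 else 0)))"
proof -
  have "pairing \<Theta> (as ! i) (\<rho>s ! j) = ev (as ! i) (\<rho>s ! j)"
    if "as \<in> Tests A \<one>" "length as = length \<rho>s" "i < length \<rho>s" "j < length \<rho>s" "\<forall>\<rho>\<in>set \<rho>s. normal A \<rho>" for as i j
    using that transfI[OF that(1), of "as ! i"] by (intro pairing_effect) (auto simp: effects_def normalised_iff)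
  then show ?thesis unfolding perfectly_distinguishable_def by (intro conj_cong refl bex_cong) auto
qed

text \<open>The effects of a distinguishing test dominate the corresponding
  \<open>\<alpha>\<^sup>\<dagger>\<close>, which turns distinguishability into orthogonality. A
  state annihilated by all \<open>\<alpha>\<^sup>\<dagger>\<close> is one on which the leftover
  effect is certain, so it is exactly a state that could be added.\<close>

lemma pure_maximal_iff: "pure_maximal \<Theta> A \<alpha>s \<longleftrightarrow> complete A \<alpha>s"
proof
  assume pm: "pure_maximal \<Theta> A \<alpha>s"
  then have p: "\<And>\<alpha>. \<alpha> \<in> set \<alpha>s \<Longrightarrow> pure_state \<Theta> A \<alpha>" by (simp add: pure_maximal_def)
  have "\<exists>as\<in>Tests A \<one>. length as = length \<alpha>s \<and>
      (\<forall>i<length \<alpha>s. \<forall>j<length \<alpha>s. ev (as ! i) (\<alpha>s ! j) = (if i = j then 1 else 0))"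
    using pm unfolding pure_maximal_def perfectly_distinguishable_ev by (elim conjE)
  then obtain as where as: "as \<in> Tests A \<one>" "length as = length \<alpha>s"
      "\<forall>i<length \<alpha>s. \<forall>j<length \<alpha>s. ev (as ! i) (\<alpha>s ! j) = (if i = j then 1 else 0)"
    by (elim bexE conjE) (rule that)
  have on: "orthonormal A \<alpha>s"
  proof (rule orthonormalI[OF p])
    show "sorted_wrt (\<lambda>\<alpha> \<beta>. ev (dag A \<alpha>) \<beta> = 0) \<alpha>s"
      unfolding sorted_wrt_iff_nth_less
    proof (intro allI impI)
      fix i j assume ij: "i < j" "j < length \<alpha>s"
      have a: "as ! i \<in> Eff A" using transfI[OF as(1)] ij as(2) by (simp add: effects_def)
      have pij: "pure_state \<Theta> A (\<alpha>s ! i)" "\<alpha>s ! j \<in> St A" using p pure_state_St ij by auto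
      have "ev (as ! i) (\<alpha>s ! i) = 1" "ev (as ! i) (\<alpha>s ! j) = 0" using as(3) ij by auto
      then show "ev (dag A (\<alpha>s ! i)) (\<alpha>s ! j) = 0"
        using dagger_le[OF a pij(1) _ pij(2)] dagger_nonneg[OF pij] by simp
    qed
  qed
  then show "complete A \<alpha>s"
  proof (rule orthonormal_completeI)
    fix \<sigma> assume \<sigma>: "normal A \<sigma>"
    show "\<exists>\<alpha>\<in>set \<alpha>s. ev (dag A \<alpha>) \<sigma> \<noteq> 0"
    proof (rule ccontr)
      assume "\<not> ?thesis"
      then have z: "ev (dag A (\<alpha>s ! i)) \<sigma> = 0" if "i < length \<alpha>s" for i using that by simp
      obtain r where r: "map (dag A) \<alpha>s @ [r] \<in> Tests A \<one>" "r \<in> Eff A" "(\<Sum>\<alpha>\<leftarrow>\<alpha>s. dag A \<alpha>) + r = u A"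
        using orthonormal_remainder[OF on] by blast
      have r4: "(\<Sum>\<alpha>\<leftarrow>\<alpha>s. ev (dag A \<alpha>) x) + ev r x = ev (u A) x" for x
        using ev_add(2)[of "\<Sum>\<alpha>\<leftarrow>\<alpha>s. dag A \<alpha>" r x] by (simp add: r(3) ev_sum_list(1) o_def)
      have "ev r \<sigma> = 1"
        using r4[of \<sigma>] z \<sigma> by (simp add: sum_list_sum_nth normalised_iff)
      moreover have "ev r (\<alpha>s ! j) = 0" if j: "j < length \<alpha>s" for j
      proof -
        have "(\<Sum>\<alpha>\<leftarrow>\<alpha>s. ev (dag A \<alpha>) (\<alpha>s ! j)) = (\<Sum>i<length \<alpha>s. if i = j then 1 else 0)"
          using orthonormal_delta[OF on _ j] by (simp add: sum_list_sum_nth atLeast0LessThan)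
        then show ?thesis using r4[of "\<alpha>s ! j"] j pure_state_normalised[OF p] by (simp add: normalised_iff)
      qed
      ultimately have "perfectly_distinguishable \<Theta> A (\<alpha>s @ [\<sigma>])"
        unfolding perfectly_distinguishable_ev
        using r(1) z \<sigma> orthonormal_delta[OF on] p pure_state_normalised
        by (intro conjI bexI[of _ "map (dag A) \<alpha>s @ [r]"]) (auto simp: nth_append less_Suc_eq)
      then show False using pm by (auto simp: pure_maximal_def)
    qed
  qed
next
  assume cs: "complete A \<alpha>s"
  then have on: "orthonormal A \<alpha>s" by (simp add: complete_def)
  note p = orthonormal_pure[OF on]
  obtain r where r: "map (dag A) \<alpha>s @ [r] \<in> Tests A \<one>" "r \<in> Eff A" "(\<Sum>\<alpha>\<leftarrow>\<alpha>s. dag A \<alpha>) + r = u A"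
    using orthonormal_remainder[OF on] by blast
  have r4: "(\<Sum>\<alpha>\<leftarrow>\<alpha>s. ev (dag A \<alpha>) x) + ev r x = ev (u A) x" for x
    using ev_add(2)[of "\<Sum>\<alpha>\<leftarrow>\<alpha>s. dag A \<alpha>" r x] by (simp add: r(3) ev_sum_list(1) o_def)
  have "r = 0" using r(3) cs by (simp add: complete_def)
  obtain bs \<beta> where \<beta>: "\<alpha>s = bs @ [\<beta>]" using complete_nonempty[OF cs] by (metis rev_exhaust)
  \<comment> \<open>The leftover effect is zero and is merged into the last outcome, so that the
    test has as many outcomes as there are states.\<close>
  have "map (dag A) \<alpha>s \<in> Tests A \<one>"
    using coarse_grain_last[of "map (dag A) bs" "dag A \<beta>" r] r(1) by (simp add: \<beta> \<open>r = 0\<close>)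
  then have "perfectly_distinguishable \<Theta> A \<alpha>s"
    unfolding perfectly_distinguishable_ev
    using p pure_state_normalised orthonormal_delta[OF on] by (intro conjI bexI[of _ "map (dag A) \<alpha>s"]) auto
  moreover have "\<not> perfectly_distinguishable \<Theta> A (\<alpha>s @ [\<rho>])" for \<rho>
  proof
    assume pd: "perfectly_distinguishable \<Theta> A (\<alpha>s @ [\<rho>])"
    then have \<rho>: "normal A \<rho>" by (simp add: perfectly_distinguishable_def)
    let ?n = "length \<alpha>s"
    obtain as where as: "as \<in> Tests A \<one>" "length as = Suc ?n"
      "\<forall>i<Suc ?n. \<forall>j<Suc ?n. ev (as ! i) ((\<alpha>s @ [\<rho>]) ! j) = (if i = j then 1 else 0)"
      using pd unfolding perfectly_distinguishable_ev by (elim bexE conjE) (rule that, simp_all)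
    have "ev (dag A (\<alpha>s ! i)) \<rho> = 0" if i: "i < ?n" for i
    proof -
      have "as ! i \<in> Eff A" using transfI[OF as(1)] i as(2) by (simp add: effects_def)
      moreover have "ev (as ! i) (\<alpha>s ! i) = 1" using as(3)[rule_format, of i i] i by (simp add: nth_append)
      moreover have "ev (as ! i) \<rho> = 0" using as(3)[rule_format, of i ?n] i by (simp add: nth_append)
      ultimately show ?thesis
        using dagger_le[of "as ! i" A "\<alpha>s ! i" \<rho>] dagger_nonneg[of A "\<alpha>s ! i" \<rho>] p i normalised_St[OF \<rho>] by simp
    qed
    then show False using complete_sum[OF cs, of \<rho>] \<rho> by (simp add: sum_list_sum_nth normalised_iff)
  qed
  ultimately show "pure_maximal \<Theta> A \<alpha>s" using p by (simp add: pure_maximal_def)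
qed

subsection \<open>Diagonalisation\<close>

text \<open>The states already split off are carried along as \<open>bs\<close>, and what remains to
  be diagonalised is annihilated by them. The induction ends because orthonormal families are
  bounded in length by \<open>1 / c\<close>.\<close>

lemma diagonalise_orthogonal:
  assumes "orthonormal A bs" "\<sigma> \<in> St A" "\<And>\<beta>. \<beta> \<in> set bs \<Longrightarrow> ev (dag A \<beta>) \<sigma> = 0"
  shows "\<exists>ps \<alpha>s. complete A (bs @ \<alpha>s) \<and> length ps = length \<alpha>s \<and> (\<forall>p\<in>set ps. 0 \<le> p) \<and>
    \<sigma> = sum_list (map2 (\<lambda>p \<alpha>. p *\<^sub>R \<alpha>) ps \<alpha>s)"
proof -
  obtain \<omega> c where unif: "uniform A \<omega> c" using ex_uniform_state by blast
  note \<omega> = uniformD[OF unif]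
  obtain N :: nat where N: "1 / c < real N" using reals_Archimedean2 by blast
  have bound: "length bs \<le> N" if onb: "orthonormal A bs" for bs
  proof -
    obtain x where x: "x \<in> St A" "\<omega> = c *\<^sub>R sum_list bs + x" "\<forall>\<alpha>\<in>set bs. ev (dag A \<alpha>) x = 0"
      "ev (u A) x = 1 - c * length bs" by (rule uniform_remainder[OF unif onb])
    have "c * length bs \<le> 1" using ev_bounds(1)[OF discard_effect x(1)] x(4) by simp
    then have "real (length bs) \<le> 1 / c" using \<omega>(2) by (simp add: field_simps)
    then show ?thesis using N by linarith
  qed
  show ?thesis
    using assms
  proof (induction "N - length bs" arbitrary: bs \<sigma> rule: less_induct)
    case less
    note p = orthonormal_pure[OF less.prems(1)]
    show ?case
    proof (cases "complete A bs")
      case True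
      have "(\<Sum>\<alpha>\<leftarrow>bs. ev (dag A \<alpha>) \<sigma>) = (\<Sum>\<alpha>\<leftarrow>bs. 0)"
        using less.prems(3) by (intro arg_cong[where f = sum_list] map_cong) auto
      then have "ev (u A) \<sigma> = 0" using complete_sum[OF True, of \<sigma>] by simp
      then have "\<sigma> = 0" using state_zero_norm[OF less.prems(2)] by simp
      then show ?thesis using True by (intro exI[of _ "[]"]) simp
    next
      case False
      then obtain \<tau>\<^sub>0 where \<tau>\<^sub>0: "normal A \<tau>\<^sub>0" "\<And>\<beta>. \<beta> \<in> set bs \<Longrightarrow> ev (dag A \<beta>) \<tau>\<^sub>0 = 0"
        using orthonormal_completeI[OF less.prems(1)] by blast
      \<comment> \<open>When \<sigma> is already zero, another state annihilated by
        \<open>bs\<close> takes its place with weight zero, so that the family is still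
        completed.\<close>
      have "\<exists>\<tau> s. normal A \<tau> \<and> (\<forall>\<beta>\<in>set bs. ev (dag A \<beta>) \<tau> = 0) \<and> 0 \<le> s \<and> s \<le> 1 \<and> \<sigma> = s *\<^sub>R \<tau>"
      proof (cases "\<sigma> = 0")
        case True
        then show ?thesis using \<tau>\<^sub>0 by (intro exI[of _ \<tau>\<^sub>0] exI[of _ 0]) simp
      next
        case False
        then obtain \<tau> where \<tau>: "normal A \<tau>" "\<sigma> = ev (u A) \<sigma> *\<^sub>R \<tau>" "ev (u A) \<sigma> > 0" "ev (u A) \<sigma> \<le> 1"
          using state_normalise[OF less.prems(2)] by blast
        have "ev (dag A \<beta>) \<tau> = 0" if "\<beta> \<in> set bs" for \<beta>
        proof -
          have "ev (dag A \<beta>) (ev (u A) \<sigma> *\<^sub>R \<tau>) = 0" using less.prems(3)[OF that] \<tau>(2) by simp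
          then show ?thesis using \<tau>(3) by simp
        qed
        then show ?thesis using \<tau> by (intro exI[of _ \<tau>] exI[of _ "ev (u A) \<sigma>"]) auto
      qed
      then obtain \<tau> s where \<tau>: "normal A \<tau>" "\<And>\<beta>. \<beta> \<in> set bs \<Longrightarrow> ev (dag A \<beta>) \<tau> = 0" "0 \<le> s" "s \<le> 1" "\<sigma> = s *\<^sub>R \<tau>" by blast
      obtain \<alpha> q y where \<alpha>: "pure_state \<Theta> A \<alpha>" "q > 0" "y \<in> St A" "\<tau> = q *\<^sub>R \<alpha> + y" "ev (dag A \<alpha>) y = 0"
        by (rule eigenstate[OF \<tau>(1)])
      have z: "ev (dag A \<beta>) \<alpha> = 0 \<and> ev (dag A \<beta>) y = 0" if "\<beta> \<in> set bs" for \<beta>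
      proof -
        have "q * ev (dag A \<beta>) \<alpha> + ev (dag A \<beta>) y = 0" using \<tau>(2)[OF that] by (simp add: \<alpha>(4) ev_add)
        moreover have "0 \<le> q * ev (dag A \<beta>) \<alpha>" "0 \<le> ev (dag A \<beta>) y"
          using dagger_nonneg[OF p[OF that]] \<alpha> pure_state_St[OF \<alpha>(1)] by auto
        ultimately have "q * ev (dag A \<beta>) \<alpha> = 0" "ev (dag A \<beta>) y = 0" by linarith+
        then show ?thesis using \<alpha>(2) by simp
      qed
      have on: "orthonormal A (bs @ [\<alpha>])" using orthonormal_append[OF less.prems(1) \<alpha>(1)] z by blast
      have sy: "s *\<^sub>R y \<in> St A" using transf_scale[OF St_transf[OF \<alpha>(3)] \<tau>(3,4)] by (simp add: states_def)
      have "N - length (bs @ [\<alpha>]) < N - length bs" using bound[OF on] by simp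
      moreover have "ev (dag A \<beta>) (s *\<^sub>R y) = 0" if "\<beta> \<in> set (bs @ [\<alpha>])" for \<beta>
        using that z \<alpha>(5) by auto
      ultimately obtain ps \<alpha>s where ps: "complete A ((bs @ [\<alpha>]) @ \<alpha>s)" "length ps = length \<alpha>s" "\<forall>p\<in>set ps. 0 \<le> p"
          "s *\<^sub>R y = sum_list (map2 (\<lambda>p \<alpha>. p *\<^sub>R \<alpha>) ps \<alpha>s)"
        using less.hyps[of "bs @ [\<alpha>]" "s *\<^sub>R y"] on sy by blast
      have "\<sigma> = sum_list (map2 (\<lambda>p \<alpha>. p *\<^sub>R \<alpha>) ((s * q) # ps) (\<alpha> # \<alpha>s))"
        by (simp add: \<tau>(5) \<alpha>(4) scaleR_add_right ps(4)[symmetric])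
      moreover have "\<forall>p\<in>set ((s * q) # ps). 0 \<le> p" using ps(3) \<tau>(3) \<alpha>(2) by auto
      ultimately show ?thesis using ps(1,2) by (intro exI[of _ "(s * q) # ps"] exI[of _ "\<alpha> # \<alpha>s"]) auto
    qed
  qed
qed

lemma sum_list_map2:
  assumes "length xs = length ys"
  shows "sum_list (map2 f xs ys) = (\<Sum>i<length ys. f (xs ! i) (ys ! i))"
  using assms by (simp add: sum_list_sum_nth atLeast0LessThan)

lemma diagonalisation_iff:
  "diagonalisation \<Theta> A \<rho> ps \<alpha>s \<longleftrightarrow> complete A \<alpha>s \<and> length ps = length \<alpha>s \<and> (\<forall>p\<in>set ps. 0 \<le> p) \<and>
     sum_list ps = 1 \<and> \<rho> = sum_list (map2 (\<lambda>p \<alpha>. p *\<^sub>R \<alpha>) ps \<alpha>s)"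
  unfolding diagonalisation_def pure_maximal_iff using sum_list_map2[of ps \<alpha>s] by metis

lemma ex_diagonalisation:
  assumes \<rho>: "normal A \<rho>"
  shows "\<exists>ps \<alpha>s. diagonalisation \<Theta> A \<rho> ps \<alpha>s"
proof -
  have "orthonormal A []" by (rule orthonormalI) auto
  then obtain ps \<alpha>s where d: "complete A \<alpha>s" "length ps = length \<alpha>s" "\<forall>p\<in>set ps. 0 \<le> p"
      "\<rho> = sum_list (map2 (\<lambda>p \<alpha>. p *\<^sub>R \<alpha>) ps \<alpha>s)"
    using diagonalise_orthogonal[of A "[]" \<rho>] \<rho> by (auto simp: normalised_iff)
  have p: "ev (u A) (\<alpha>s ! i) = 1" if "i < length \<alpha>s" for i
    using d(1) that orthonormal_pure pure_state_normalised by (auto simp: complete_def normalised_iff)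
  have "1 = ev (u A) (\<Sum>i<length \<alpha>s. ps ! i *\<^sub>R \<alpha>s ! i)" using \<rho> unfolding d(4) sum_list_map2[OF d(2)] by (simp add: normalised_iff)
  also have "\<dots> = (\<Sum>i<length \<alpha>s. ps ! i)" using p by (simp add: ev_sum)
  also have "\<dots> = sum_list ps" using d(2) by (simp add: sum_list_sum_nth atLeast0LessThan)
  finally show ?thesis using d by (auto simp: diagonalisation_iff)
qed

lemma diagonalisationD:
  assumes "diagonalisation \<Theta> A \<rho> ps \<alpha>s"
  shows "complete A \<alpha>s" "orthonormal A \<alpha>s" "length ps = length \<alpha>s" "\<And>p. p \<in> set ps \<Longrightarrow> 0 \<le> p" "sum_list ps = 1"
    "\<rho> = (\<Sum>i<length \<alpha>s. ps ! i *\<^sub>R \<alpha>s ! i)" "\<And>i. i < length \<alpha>s \<Longrightarrow> pure_state \<Theta> A (\<alpha>s ! i)"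
  using assms orthonormal_pure[of A \<alpha>s] by (auto simp: diagonalisation_def pure_maximal_iff complete_def)

lemma complete_length:
  assumes "complete A \<alpha>s" "complete A \<delta>s"
  shows "length \<alpha>s = length \<delta>s"
proof -
  obtain \<omega> c where unif: "uniform A \<omega> c" using ex_uniform_state by blast
  have "c * length \<alpha>s = c * length \<delta>s" using complete_uniform(2)[OF unif] assms by simp
  then show ?thesis using uniformD(2)[OF unif] by simp
qed

text \<open>Here the effect is fixed and the states vary, so no normalisation applies. The sum of
  the states is \<open>\<omega> / c\<close> for the uniform \<omega>, on which every effect takes
  the value one.\<close>

lemma transition_row_sum:
  assumes "complete A \<delta>s" "pure_state \<Theta> A \<alpha>"
  shows "(\<Sum>j<length \<delta>s. ev (dag A \<alpha>) (\<delta>s ! j)) = 1"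
proof -
  obtain \<omega> c where unif: "uniform A \<omega> c" using ex_uniform_state by blast
  have "c = ev (dag A \<alpha>) (c *\<^sub>R sum_list \<delta>s)"
    using uniformD(3)[OF unif assms(2)] complete_uniform(1)[OF unif assms(1)] by simp
  then have "ev (dag A \<alpha>) (sum_list \<delta>s) = 1" using uniformD(2)[OF unif] by simp
  then show ?thesis by (simp add: ev_sum sum_list_sum_nth atLeast0LessThan)
qed

lemma transition_column_sum:
  assumes "complete A \<alpha>s" "normal A \<delta>"
  shows "(\<Sum>i<length \<alpha>s. ev (dag A (\<alpha>s ! i)) \<delta>) = 1"
  using complete_sum[OF assms(1), of \<delta>] assms(2) by (simp add: sum_list_sum_nth atLeast0LessThan normalised_iff)

lemma eigenvalue:
  assumes "diagonalisation \<Theta> A \<rho> ps \<alpha>s" "i < length \<alpha>s"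
  shows "ev (dag A (\<alpha>s ! i)) \<rho> = ps ! i"
proof -
  note d = diagonalisationD[OF assms(1)]
  have "ev (dag A (\<alpha>s ! i)) \<rho> = (\<Sum>j<length \<alpha>s. ps ! j * ev (dag A (\<alpha>s ! i)) (\<alpha>s ! j))" by (simp add: d(6) ev_sum)
  also have "\<dots> = (\<Sum>j<length \<alpha>s. if i = j then ps ! j else 0)"
    using orthonormal_delta[OF d(2) assms(2)] by (intro sum.cong) auto
  finally show ?thesis using assms(2) by simp
qed

lemma transition_eigenvalues:
  assumes d\<alpha>: "diagonalisation \<Theta> A \<rho> ps \<alpha>s" and d\<delta>: "diagonalisation \<Theta> A \<rho> qs \<delta>s"
    and ij: "i < length \<alpha>s" "j < length \<delta>s" "ev (dag A (\<alpha>s ! i)) (\<delta>s ! j) \<noteq> 0"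
  shows "ps ! i = qs ! j"
proof -
  note da = diagonalisationD[OF d\<alpha>] and dd = diagonalisationD[OF d\<delta>]
  define n where "n = length \<alpha>s"
  have n: "length \<alpha>s = n" "length \<delta>s = n" using complete_length[OF da(1) dd(1)] by (simp_all add: n_def)
  define M where "M i j = ev (dag A (\<alpha>s ! i)) (\<delta>s ! j)" for i j
  define M' where "M' j i = ev (dag A (\<delta>s ! j)) (\<alpha>s ! i)" for i j
  have nn: "0 \<le> M i j" "0 \<le> M' j i" if "i < n" "j < n" for i j
    using that dagger_nonneg da(7) dd(7) pure_state_St n by (simp_all add: M_def M'_def)
  have p: "ps ! i = (\<Sum>j<n. M i j * qs ! j)" if "i < n" for i
  proof -
    have "ps ! i = ev (dag A (\<alpha>s ! i)) \<rho>" using eigenvalue[OF d\<alpha>] that n by simp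
    then show ?thesis by (simp add: dd(6) ev_sum M_def n mult.commute)
  qed
  have q: "qs ! j = (\<Sum>i<n. M' j i * ps ! i)" if "j < n" for j
  proof -
    have "qs ! j = ev (dag A (\<delta>s ! j)) \<rho>" using eigenvalue[OF d\<delta>] that n by simp
    then show ?thesis by (simp add: da(6) ev_sum M'_def n mult.commute)
  qed
  have rows: "(\<Sum>j<n. M i j) = 1" "(\<Sum>j<n. M' i j) = 1" if "i < n" for i
    using transition_row_sum[OF dd(1) da(7)] transition_row_sum[OF da(1) dd(7)] that n
    by (simp_all add: M_def M'_def)
  have cols: "(\<Sum>i<n. M i j) = 1" "(\<Sum>i<n. M' i j) = 1" if "j < n" for j
    using transition_column_sum[OF da(1) pure_state_normalised[OF dd(7)]]
      transition_column_sum[OF dd(1) pure_state_normalised[OF da(7)]] that n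
    by (simp_all add: M_def M'_def)
  have v: "(\<Sum>i<n. \<Sum>j<n. M i j * (qs ! j - ps ! i)\<^sup>2) = (\<Sum>j<n. (qs ! j)\<^sup>2) - (\<Sum>i<n. (ps ! i)\<^sup>2)"
    by (rule doubly_stochastic_variance[OF rows(1) cols(1) p])
  have v': "(\<Sum>i<n. \<Sum>j<n. M' i j * (ps ! j - qs ! i)\<^sup>2) = (\<Sum>j<n. (ps ! j)\<^sup>2) - (\<Sum>i<n. (qs ! i)\<^sup>2)"
    by (rule doubly_stochastic_variance[OF rows(2) cols(2) q])
  have "0 \<le> (\<Sum>i<n. \<Sum>j<n. M' i j * (ps ! j - qs ! i)\<^sup>2)" using nn by (intro sum_nonneg) auto
  \<comment> \<open>The two variances are negatives of each other and both nonnegative, so every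
    single term vanishes.\<close>
  then have z: "(\<Sum>i<n. \<Sum>j<n. M i j * (qs ! j - ps ! i)\<^sup>2) \<le> 0" using v v' by simp
  have ij': "i < n" "j < n" using ij n by auto
  have "M i j * (qs ! j - ps ! i)\<^sup>2 \<le> (\<Sum>j<n. M i j * (qs ! j - ps ! i)\<^sup>2)"
    using nn ij' by (intro member_le_sum) auto
  also have "\<dots> \<le> (\<Sum>i<n. \<Sum>j<n. M i j * (qs ! j - ps ! i)\<^sup>2)"
    using nn ij' by (intro member_le_sum[where f = "\<lambda>i. \<Sum>j<n. M i j * (qs ! j - ps ! i)\<^sup>2"] sum_nonneg) auto
  finally have "M i j * (qs ! j - ps ! i)\<^sup>2 \<le> 0" using z by simp
  moreover have "M i j > 0" using nn(1)[OF ij'] ij(3) by (simp add: M_def)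
  ultimately show ?thesis by (simp add: mult_le_0_iff)
qed

text \<open>Comparing sums of an arbitrary \<open>f\<close> replaces equality up to order. The row
  sums insert the transition matrix, \<open>f\<close> is moved from one spectrum to the other under
  it, and the column sums remove it.\<close>

lemma spectrum_unique:
  assumes d\<alpha>: "diagonalisation \<Theta> A \<rho> ps \<alpha>s" and d\<delta>: "diagonalisation \<Theta> A \<rho> qs \<delta>s"
  shows "(\<Sum>p\<leftarrow>ps. f p) = (\<Sum>q\<leftarrow>qs. f q :: real)"
proof -
  note da = diagonalisationD[OF d\<alpha>] and dd = diagonalisationD[OF d\<delta>]
  let ?n = "length \<alpha>s" and ?m = "length \<delta>s"
  let ?M = "\<lambda>i j. ev (dag A (\<alpha>s ! i)) (\<delta>s ! j)"
  have "(\<Sum>p\<leftarrow>ps. f p) = (\<Sum>i<?n. f (ps ! i) * (\<Sum>j<?m. ?M i j))"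
    using transition_row_sum[OF dd(1) da(7)] da(3) by (simp add: sum_list_sum_nth atLeast0LessThan)
  also have "\<dots> = (\<Sum>i<?n. \<Sum>j<?m. f (ps ! i) * ?M i j)" by (simp add: sum_distrib_left)
  also have "\<dots> = (\<Sum>i<?n. \<Sum>j<?m. f (qs ! j) * ?M i j)"
    using transition_eigenvalues[OF d\<alpha> d\<delta>] by (intro sum.cong refl) (metis lessThan_iff mult_zero_right)
  also have "\<dots> = (\<Sum>j<?m. f (qs ! j) * (\<Sum>i<?n. ?M i j))" by (subst sum.swap) (simp add: sum_distrib_left)
  also have "\<dots> = (\<Sum>q\<leftarrow>qs. f q)"
    using transition_column_sum[OF da(1) pure_state_normalised[OF dd(7)]] dd(3)
    by (simp add: sum_list_sum_nth atLeast0LessThan)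
  finally show ?thesis .
qed

lemma partial_sum_effect:
  assumes "orthonormal A \<alpha>s"
  shows "(\<Sum>i | i < length \<alpha>s \<and> P i. dag A (\<alpha>s ! i)) \<in> Eff A"
proof -
  obtain r where r: "map (dag A) \<alpha>s @ [r] \<in> Tests A \<one>" using assms by (auto simp: orthonormal_def)
  let ?Cs = "map (dag A) \<alpha>s @ [r]"
  define q :: "nat \<Rightarrow> nat" where "q i = (if i < length \<alpha>s \<and> P i then 0 else 1)" for i
  have "map (\<lambda>j. \<Sum>i | i < length ?Cs \<and> q i = j. ?Cs ! i) [0..<2] \<in> Tests A \<one>"
    by (rule coarse_grain[OF r]) (auto simp: q_def)
  then have "(\<Sum>i | i < length ?Cs \<and> q i = 0. ?Cs ! i) \<in> Tr A \<one>" by (rule transfI) auto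
  moreover have "(\<Sum>i | i < length ?Cs \<and> q i = 0. ?Cs ! i) = (\<Sum>i | i < length \<alpha>s \<and> P i. dag A (\<alpha>s ! i))"
    by (rule sum.cong) (auto simp: q_def nth_append split: if_splits)
  ultimately show ?thesis by (simp add: effects_def)
qed

text \<open>Transitions connect equal eigenvalues only, so the sum of the effects for
  \<open>v\<close> in one diagonalisation is certain on all eigenstates for \<open>v\<close> in the
  other, and hence dominates the sum of their effects. Exchanging the two diagonalisations gives
  equality.\<close>

lemma spectral_projection_le:
  assumes d\<alpha>: "diagonalisation \<Theta> A \<rho> ps \<alpha>s" and d\<delta>: "diagonalisation \<Theta> A \<rho> qs \<delta>s" and x: "x \<in> St A"
  shows "(\<Sum>j | j < length \<delta>s \<and> qs ! j = v. ev (dag A (\<delta>s ! j)) x) \<le>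
    (\<Sum>i | i < length \<alpha>s \<and> ps ! i = v. ev (dag A (\<alpha>s ! i)) x)"
proof -
  note da = diagonalisationD[OF d\<alpha>] and dd = diagonalisationD[OF d\<delta>]
  define e where "e = (\<Sum>i | i < length \<alpha>s \<and> ps ! i = v. dag A (\<alpha>s ! i))"
  have e: "e \<in> Eff A" unfolding e_def by (rule partial_sum_effect[OF da(2)])
  define \<beta>s where "\<beta>s = map ((!) \<delta>s) (filter (\<lambda>j. qs ! j = v) [0..<length \<delta>s])"
  have sum: "(\<Sum>\<beta>\<leftarrow>\<beta>s. ev (dag A \<beta>) y) = (\<Sum>j | j < length \<delta>s \<and> qs ! j = v. ev (dag A (\<delta>s ! j)) y)" for y
  proof -
    have "(\<Sum>\<beta>\<leftarrow>\<beta>s. ev (dag A \<beta>) y) = (\<Sum>j\<leftarrow>filter (\<lambda>j. qs ! j = v) [0..<length \<delta>s]. ev (dag A (\<delta>s ! j)) y)"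
      by (simp add: \<beta>s_def o_def)
    also have "\<dots> = (\<Sum>j\<in>set (filter (\<lambda>j. qs ! j = v) [0..<length \<delta>s]). ev (dag A (\<delta>s ! j)) y)"
      by (rule sum_list_distinct_conv_sum_set) simp
    also have "set (filter (\<lambda>j. qs ! j = v) [0..<length \<delta>s]) = {j. j < length \<delta>s \<and> qs ! j = v}" by auto
    finally show ?thesis .
  qed
  have "(\<Sum>\<beta>\<leftarrow>\<beta>s. ev (dag A \<beta>) x) \<le> ev e x"
  proof (rule dagger_sum_le[OF e _ _ _ x])
    fix \<beta> assume "\<beta> \<in> set \<beta>s"
    then obtain j where j: "j < length \<delta>s" "qs ! j = v" "\<beta> = \<delta>s ! j" by (auto simp: \<beta>s_def)
    show \<beta>: "pure_state \<Theta> A \<beta>" using dd(7)[OF j(1)] j(3) by simp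
    have "1 = (\<Sum>i<length \<alpha>s. ev (dag A (\<alpha>s ! i)) \<beta>)"
      using transition_column_sum[OF da(1) pure_state_normalised[OF \<beta>]] by simp
    also have "\<dots> = (\<Sum>i | i < length \<alpha>s \<and> ps ! i = v. ev (dag A (\<alpha>s ! i)) \<beta>)"
      using transition_eigenvalues[OF d\<alpha> d\<delta> _ j(1)] j by (intro sum.mono_neutral_right) auto
    finally show "ev e \<beta> = 1" by (simp add: e_def ev_sum)
  next
    fix y assume y: "y \<in> St A"
    have "(\<Sum>j | j < length \<delta>s \<and> qs ! j = v. ev (dag A (\<delta>s ! j)) y) \<le> (\<Sum>j<length \<delta>s. ev (dag A (\<delta>s ! j)) y)"
      using dagger_nonneg[OF dd(7) y] by (intro sum_mono2) auto
    also have "\<dots> = ev (u A) y" using complete_sum[OF dd(1), of y] by (simp add: sum_list_sum_nth atLeast0LessThan)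
    finally show "(\<Sum>\<beta>\<leftarrow>\<beta>s. ev (dag A \<beta>) y) \<le> ev (u A) y" by (simp add: sum)
  qed
  then show ?thesis by (simp add: sum e_def ev_sum)
qed

text \<open>Grouping by eigenvalues reduces the claim to the spectral projections, which do not
  depend on the diagonalisation even when the eigenvalues are degenerate.\<close>

lemma functional_calculus_unique:
  assumes d\<alpha>: "diagonalisation \<Theta> A \<rho> ps \<alpha>s" and d\<delta>: "diagonalisation \<Theta> A \<rho> qs \<delta>s" and x: "x \<in> St A"
  shows "(\<Sum>i<length \<alpha>s. f (ps ! i) * ev (dag A (\<alpha>s ! i)) x) = (\<Sum>j<length \<delta>s. f (qs ! j) * ev (dag A (\<delta>s ! j)) x)"
proof -
  note da = diagonalisationD[OF d\<alpha>] and dd = diagonalisationD[OF d\<delta>]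
  let ?V = "set ps \<union> set qs"
  have group: "(\<Sum>i<length \<beta>s. f (rs ! i) * ev (dag A (\<beta>s ! i)) x) =
      (\<Sum>v\<in>?V. f v * (\<Sum>i | i < length \<beta>s \<and> rs ! i = v. ev (dag A (\<beta>s ! i)) x))"
    if "length rs = length \<beta>s" "set rs \<subseteq> ?V" for rs \<beta>s
  proof -
    have "(\<Sum>i<length \<beta>s. f (rs ! i) * ev (dag A (\<beta>s ! i)) x) =
        (\<Sum>v\<in>?V. \<Sum>i | i \<in> {..<length \<beta>s} \<and> rs ! i = v. f (rs ! i) * ev (dag A (\<beta>s ! i)) x)"
    proof (rule sum.group[symmetric])
      show "(!) rs ` {..<length \<beta>s} \<subseteq> ?V" using that nth_mem[of _ rs] by fastforce
    qed auto
    also have "\<dots> = (\<Sum>v\<in>?V. f v * (\<Sum>i | i < length \<beta>s \<and> rs ! i = v. ev (dag A (\<beta>s ! i)) x))"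
      by (simp add: sum_distrib_left cong: sum.cong_simp)
    finally show ?thesis .
  qed
  have "(\<Sum>i | i < length \<alpha>s \<and> ps ! i = v. ev (dag A (\<alpha>s ! i)) x) =
      (\<Sum>j | j < length \<delta>s \<and> qs ! j = v. ev (dag A (\<delta>s ! j)) x)" for v
    using spectral_projection_le[OF d\<alpha> d\<delta> x] spectral_projection_le[OF d\<delta> d\<alpha> x] by (rule antisym[rotated])
  then show ?thesis using group[of ps \<alpha>s] group[of qs \<delta>s] da(3) dd(3) by simp
qed

subsection \<open>Entropies\<close>

lemma some_diagonalisation:
  assumes "diagonalisation \<Theta> A \<rho> ps \<alpha>s"
  shows "diagonalisation \<Theta> A \<rho> (spectrum \<Theta> A \<rho>) (eigenstates \<Theta> A \<rho>)"
proof -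
  have "\<exists>z. case z of (ps, \<alpha>s) \<Rightarrow> diagonalisation \<Theta> A \<rho> ps \<alpha>s" using assms by auto
  from someI_ex[OF this]
  have "case some_diagonalisation \<Theta> A \<rho> of (ps, \<alpha>s) \<Rightarrow> diagonalisation \<Theta> A \<rho> ps \<alpha>s"
    unfolding some_diagonalisation_def .
  then show ?thesis by (simp add: spectrum_def eigenstates_def case_prod_beta)
qed

lemma entropy_eq:
  assumes "diagonalisation \<Theta> A \<rho> ps \<alpha>s"
  shows "entropy \<Theta> A \<rho> = - (\<Sum>p\<leftarrow>ps. p * ln p)"
  unfolding entropy_def using spectrum_unique[OF some_diagonalisation[OF assms] assms] by simp

lemma ev_fun_dagger:
  assumes "diagonalisation \<Theta> A \<rho> ps \<alpha>s" "x \<in> St A"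
  shows "ev (fun_dagger \<Theta> A f \<rho>) x = (\<Sum>i<length \<alpha>s. f (ps ! i) * ev (dag A (\<alpha>s ! i)) x)"
  unfolding fun_dagger_def using functional_calculus_unique[OF some_diagonalisation[OF assms(1)] assms]
  by (simp add: ev_sum)

lemma fun_dagger_span:
  assumes "diagonalisation \<Theta> A \<rho> ps \<alpha>s"
  shows "fun_dagger \<Theta> A f \<rho> \<in> span (Eff A)"
  unfolding fun_dagger_def using diagonalisationD(7)[OF some_diagonalisation[OF assms]] dagger_effect
  by (intro span_sum span_scale span_base) auto

lemma ev_fun_dagger_self:
  assumes "diagonalisation \<Theta> A \<rho> ps \<alpha>s" "\<rho> \<in> St A"
  shows "ev (fun_dagger \<Theta> A ln \<rho>) \<rho> = - entropy \<Theta> A \<rho>"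
  using ev_fun_dagger[OF assms, of ln] eigenvalue[OF assms(1)] entropy_eq[OF assms(1)] diagonalisationD(3)[OF assms(1)]
  by (simp add: sum_list_sum_nth atLeast0LessThan mult.commute)

lemma relative_entropy_eq:
  assumes "normal A \<rho>" "diagonalisation \<Theta> A \<sigma> qs \<delta>s"
  shows "relative_entropy \<Theta> A \<rho> \<sigma> = - entropy \<Theta> A \<rho> - ev (fun_dagger \<Theta> A ln \<sigma>) \<rho>"
proof -
  obtain ps \<alpha>s where d: "diagonalisation \<Theta> A \<rho> ps \<alpha>s" using ex_diagonalisation[OF assms(1)] by blast
  note st = normalised_St[OF assms(1)]
  have "relative_entropy \<Theta> A \<rho> \<sigma> = ev (fun_dagger \<Theta> A ln \<rho> - fun_dagger \<Theta> A ln \<sigma>) \<rho>"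
    unfolding relative_entropy_def
    by (rule pairing_eq_ev[OF span_diff[OF fun_dagger_span[OF d] fun_dagger_span[OF assms(2)]] st])
  then show ?thesis using ev_fun_dagger_self[OF d st] by (simp add: ev_diff)
qed

text \<open>The effects are transported by the inverse of \<open>V\<close>, which preserves their
  values on the transported states; the spectrum stays the same.\<close>

lemma reversible_diagonalisation:
  assumes d: "diagonalisation \<Theta> A \<rho> ps \<alpha>s" and V: "reversible \<Theta> A B V"
  shows "diagonalisation \<Theta> B (V \<odot> \<rho>) ps (map (\<lambda>\<alpha>. V \<odot> \<alpha>) \<alpha>s)"
proof -
  note da = diagonalisationD[OF d]
  obtain W where W: "V \<in> Tr A B" "W \<in> Tr B A" "W \<odot> V = \<I> A" "V \<odot> W = \<I> B" using V by (auto simp: reversible_iff)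
  have rW: "reversible \<Theta> B A W" using W by (auto simp: reversible_iff)
  have dg: "dag B (V \<odot> \<alpha>) = dag A \<alpha> \<odot> W" if "\<alpha> \<in> set \<alpha>s" for \<alpha>
    using dagger_reversible[OF orthonormal_pure[OF da(2) that] W] .
  have "orthonormal B (map (\<lambda>\<alpha>. V \<odot> \<alpha>) \<alpha>s)"
  proof (rule orthonormalI)
    show "sorted_wrt (\<lambda>\<alpha> \<beta>. ev (dag B \<alpha>) \<beta> = 0) (map (\<lambda>\<alpha>. V \<odot> \<alpha>) \<alpha>s)"
      unfolding sorted_wrt_iff_nth_less
    proof (intro allI impI)
      fix i j assume ij: "i < j" "j < length (map (\<lambda>\<alpha>. V \<odot> \<alpha>) \<alpha>s)"
      then have p: "pure_state \<Theta> A (\<alpha>s ! i)" "pure_state \<Theta> A (\<alpha>s ! j)" using da(7) by auto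
      have "ev (dag A (\<alpha>s ! i) \<odot> W) (V \<odot> (\<alpha>s ! j)) = ev (dag A (\<alpha>s ! i)) (W \<odot> (V \<odot> (\<alpha>s ! j)))"
        using ev_seq[OF W(2) dagger_effect[OF p(1)] state_seq[OF pure_state_St[OF p(2)] W(1)]] by simp
      also have "W \<odot> (V \<odot> (\<alpha>s ! j)) = \<alpha>s ! j"
        using seq_act[OF pure_state_St[OF p(2)] W(1,2)] W(3) seq_ident(2)[OF St_transf[OF pure_state_St[OF p(2)]]] by simp
      finally show "ev (dag B (map (\<lambda>\<alpha>. V \<odot> \<alpha>) \<alpha>s ! i)) (map (\<lambda>\<alpha>. V \<odot> \<alpha>) \<alpha>s ! j) = 0"
        using orthonormal_delta[OF da(2)] ij dg by simp
    qed
  qed (use da(2) orthonormal_pure pure_state_reversible[OF _ V] in auto)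
  moreover have "(\<Sum>\<alpha>\<leftarrow>map (\<lambda>\<alpha>. V \<odot> \<alpha>) \<alpha>s. dag B \<alpha>) = u B"
  proof -
    have "(\<Sum>\<alpha>\<leftarrow>map (\<lambda>\<alpha>. V \<odot> \<alpha>) \<alpha>s. dag B \<alpha>) = (\<Sum>\<alpha>\<leftarrow>\<alpha>s. dag A \<alpha> \<odot> W)"
      unfolding map_map o_def using dg by (intro arg_cong[where f = sum_list] map_cong) auto
    also have "\<dots> = (\<Sum>\<alpha>\<leftarrow>\<alpha>s. dag A \<alpha>) \<odot> W" by (induction \<alpha>s) (simp_all add: seq_add)
    also have "\<dots> = u B" using da(1) discard_seq[OF reversible_channel[OF rW]] by (simp add: complete_def)
    finally show ?thesis .
  qed
  ultimately have "complete B (map (\<lambda>\<alpha>. V \<odot> \<alpha>) \<alpha>s)" by (simp add: complete_def)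
  moreover have "V \<odot> \<rho> = (\<Sum>i<length \<alpha>s. ps ! i *\<^sub>R (V \<odot> \<alpha>s ! i))" by (simp add: da(6) seq_sum)
  ultimately show ?thesis using da by (simp add: diagonalisation_def pure_maximal_iff)
qed

section \<open>Product states and additivity of the entropy\<close>

definition par_list :: "'b list \<Rightarrow> 'b list \<Rightarrow> 'b list" where
  "par_list \<alpha>s \<delta>s = map (\<lambda>(\<alpha>, \<delta>). \<alpha> \<otimes> \<delta>) (List.product \<alpha>s \<delta>s)"

lemma par_list_simps [simp]:
  "par_list [] \<delta>s = []" "par_list (\<alpha> # \<alpha>s) \<delta>s = map (\<lambda>\<delta>. \<alpha> \<otimes> \<delta>) \<delta>s @ par_list \<alpha>s \<delta>s"
  by (simp_all add: par_list_def o_def)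

lemma dagger_par:
  assumes "pure_state \<Theta> A \<alpha>" "pure_state \<Theta> B \<beta>"
  shows "dag (A \<star> B) (\<alpha> \<otimes> \<beta>) = dag A \<alpha> \<otimes> dag B \<beta>"
proof (rule dagger_eq)
  have "ev (dag A \<alpha> \<otimes> dag B \<beta>) (\<alpha> \<otimes> \<beta>) = 1"
    using ev_product[OF pure_state_St pure_state_St dagger_effect dagger_effect] dagger_self assms by simp
  then show "sharp (A \<star> B) (dag A \<alpha> \<otimes> dag B \<beta>) (\<alpha> \<otimes> \<beta>)"
    using purity_preservation_par[OF dagger_pure[OF assms(1)] dagger_pure[OF assms(2)]] pure_state_par[OF assms]
    by (simp add: sharp_def composite_unit)
qed

lemma complete_par:
  assumes "complete A \<alpha>s" "complete B \<delta>s"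
  shows "complete (A \<star> B) (par_list \<alpha>s \<delta>s)"
proof -
  have on: "orthonormal A \<alpha>s" "orthonormal B \<delta>s" using assms by (auto simp: complete_def)
  note p = orthonormal_pure[OF on(1)] orthonormal_pure[OF on(2)]
  let ?n = "length \<alpha>s" and ?m = "length \<delta>s"
  have nth: "par_list \<alpha>s \<delta>s ! k = \<alpha>s ! (k div ?m) \<otimes> \<delta>s ! (k mod ?m)" "k div ?m < ?n" "k mod ?m < ?m"
    if "k < length (par_list \<alpha>s \<delta>s)" for k
  proof -
    have k: "k < ?n * ?m" using that by (simp add: par_list_def)
    then have "?m > 0" by (cases ?m) auto
    then show "k div ?m < ?n" "k mod ?m < ?m" using k by (simp_all add: less_mult_imp_div_less)
    show "par_list \<alpha>s \<delta>s ! k = \<alpha>s ! (k div ?m) \<otimes> \<delta>s ! (k mod ?m)" using k by (simp add: par_list_def product_nth)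
  qed
  have "orthonormal (A \<star> B) (par_list \<alpha>s \<delta>s)"
  proof (rule orthonormalI)
    show "pure_state \<Theta> (A \<star> B) \<gamma>" if "\<gamma> \<in> set (par_list \<alpha>s \<delta>s)" for \<gamma>
      using that p pure_state_par by (auto simp: par_list_def)
    show "sorted_wrt (\<lambda>\<alpha> \<beta>. ev (dag (A \<star> B) \<alpha>) \<beta> = 0) (par_list \<alpha>s \<delta>s)"
      unfolding sorted_wrt_iff_nth_less
    proof (intro allI impI)
      fix k l assume kl: "k < l" "l < length (par_list \<alpha>s \<delta>s)"
      note k = nth[OF less_trans[OF kl]] and l = nth[OF kl(2)]
      have pp: "pure_state \<Theta> A (\<alpha>s ! (k div ?m))" "pure_state \<Theta> B (\<delta>s ! (k mod ?m))"
          "pure_state \<Theta> A (\<alpha>s ! (l div ?m))" "pure_state \<Theta> B (\<delta>s ! (l mod ?m))"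
        using p k l by auto
      have "ev (dag (A \<star> B) (par_list \<alpha>s \<delta>s ! k)) (par_list \<alpha>s \<delta>s ! l) =
          ev (dag A (\<alpha>s ! (k div ?m))) (\<alpha>s ! (l div ?m)) * ev (dag B (\<delta>s ! (k mod ?m))) (\<delta>s ! (l mod ?m))"
        unfolding k(1) l(1) dagger_par[OF pp(1,2)]
        by (rule ev_product[OF pure_state_St[OF pp(3)] pure_state_St[OF pp(4)] dagger_effect[OF pp(1)] dagger_effect[OF pp(2)]])
      moreover have "k div ?m \<noteq> l div ?m \<or> k mod ?m \<noteq> l mod ?m" using kl(1) by (metis div_mult_mod_eq less_irrefl)
      ultimately show "ev (dag (A \<star> B) (par_list \<alpha>s \<delta>s ! k)) (par_list \<alpha>s \<delta>s ! l) = 0"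
        using orthonormal_delta[OF on(1) k(2) l(2)] orthonormal_delta[OF on(2) k(3) l(3)] by auto
    qed
  qed
  moreover have "(\<Sum>\<gamma>\<leftarrow>par_list \<alpha>s \<delta>s. dag (A \<star> B) \<gamma>) = (\<Sum>\<alpha>\<leftarrow>\<alpha>s. dag A \<alpha>) \<otimes> (\<Sum>\<delta>\<leftarrow>\<delta>s. dag B \<delta>)"
    using p
  proof (induction \<alpha>s)
    case (Cons \<alpha> \<alpha>s)
    have "(\<Sum>\<delta>\<leftarrow>\<delta>s. dag (A \<star> B) (\<alpha> \<otimes> \<delta>)) = (\<Sum>\<delta>\<leftarrow>\<delta>s. dag A \<alpha> \<otimes> dag B \<delta>)"
      using dagger_par Cons.prems by (intro arg_cong[where f = sum_list] map_cong) auto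
    also have "\<dots> = dag A \<alpha> \<otimes> (\<Sum>\<delta>\<leftarrow>\<delta>s. dag B \<delta>)" by (induction \<delta>s) (simp_all add: par_add)
    finally show ?case using Cons by (simp add: o_def par_add)
  qed simp
  then have "(\<Sum>\<gamma>\<leftarrow>par_list \<alpha>s \<delta>s. dag (A \<star> B) \<gamma>) = u (A \<star> B)"
    using assms by (simp add: complete_def discard_par)
  ultimately show ?thesis by (simp add: complete_def)
qed

lemma product_diagonalisation:
  assumes "diagonalisation \<Theta> A \<rho> ps \<alpha>s" "diagonalisation \<Theta> B \<sigma> qs \<delta>s"
  shows "diagonalisation \<Theta> (A \<star> B) (\<rho> \<otimes> \<sigma>) (map (\<lambda>(p, q). p * q) (List.product ps qs)) (par_list \<alpha>s \<delta>s)"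
proof -
  note a = assms(1)[unfolded diagonalisation_iff] and d = assms(2)[unfolded diagonalisation_iff]
  have scaled: "sum_list (map2 (\<lambda>p \<alpha>. p *\<^sub>R \<alpha>) (map (\<lambda>q. p * q) qs) (map (\<lambda>\<delta>. \<alpha> \<otimes> \<delta>) \<delta>s)) =
      p *\<^sub>R (\<alpha> \<otimes> sum_list (map2 (\<lambda>p \<alpha>. p *\<^sub>R \<alpha>) qs \<delta>s))" if "length qs = length \<delta>s" for p \<alpha> qs \<delta>s
    using that by (induction qs \<delta>s rule: list_induct2) (simp_all add: par_add scaleR_add_right)
  have len: "length ps = length \<alpha>s" "length qs = length \<delta>s" using a d by auto
  have "sum_list (map2 (\<lambda>p \<alpha>. p *\<^sub>R \<alpha>) (map (\<lambda>(p, q). p * q) (List.product ps qs)) (par_list \<alpha>s \<delta>s)) =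
      sum_list (map2 (\<lambda>p \<alpha>. p *\<^sub>R \<alpha>) ps \<alpha>s) \<otimes> sum_list (map2 (\<lambda>p \<alpha>. p *\<^sub>R \<alpha>) qs \<delta>s)"
    using len(1) by (induction ps \<alpha>s rule: list_induct2) (simp_all add: o_def len(2) scaled par_add)
  then have "\<rho> \<otimes> \<sigma> = sum_list (map2 (\<lambda>p \<alpha>. p *\<^sub>R \<alpha>) (map (\<lambda>(p, q). p * q) (List.product ps qs)) (par_list \<alpha>s \<delta>s))"
    using a d by metis
  moreover have "sum_list (map (\<lambda>(p, q). p * q) (List.product ps qs)) = sum_list ps * sum_list qs"
    by (induction ps) (simp_all add: o_def sum_list_const_mult distrib_right)
  moreover have "\<forall>r\<in>set (map (\<lambda>(p, q). p * q) (List.product ps qs)). 0 \<le> r" using a d by auto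
  moreover have "length (map (\<lambda>(p, q). p * q) (List.product ps qs)) = length (par_list \<alpha>s \<delta>s)"
    using len by (simp add: par_list_def)
  ultimately show ?thesis using a d complete_par unfolding diagonalisation_iff by simp
qed

lemma entropy_product:
  assumes "normal A \<rho>" "normal B \<sigma>"
  shows "entropy \<Theta> (A \<star> B) (\<rho> \<otimes> \<sigma>) = entropy \<Theta> A \<rho> + entropy \<Theta> B \<sigma>"
proof -
  obtain ps \<alpha>s qs \<delta>s where d: "diagonalisation \<Theta> A \<rho> ps \<alpha>s" "diagonalisation \<Theta> B \<sigma> qs \<delta>s"
    using ex_diagonalisation assms by metis
  \<comment> \<open>The logarithm of a product splits for positive factors; if a factor is zero,
    both sides vanish.\<close>
  have ln: "p * q * ln (p * q) = (p * ln p) * q + p * (q * ln q)" if "0 \<le> p" "0 \<le> q" for p q :: real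
    using that by (cases "p = 0 \<or> q = 0") (auto simp: ln_mult algebra_simps)
  have inner: "(\<Sum>q\<leftarrow>qs. p * q * ln (p * q)) = (p * ln p) * sum_list qs + p * (\<Sum>q\<leftarrow>qs. q * ln q)"
    if "0 \<le> p" "\<And>q. q \<in> set qs \<Longrightarrow> 0 \<le> q" for p :: real and qs
    using that(2) by (induction qs) (simp_all add: ln[OF that(1)] distrib_left)
  have "(\<Sum>r\<leftarrow>map (\<lambda>(p, q). p * q) (List.product ps qs). r * ln r) =
      (\<Sum>p\<leftarrow>ps. p * ln p) * sum_list qs + sum_list ps * (\<Sum>q\<leftarrow>qs. q * ln q)"
    using diagonalisationD(4)[OF d(1)]
  proof (induction ps)
    case (Cons p ps)
    then show ?case
      using inner[of p qs] diagonalisationD(4)[OF d(2)] by (simp add: o_def distrib_right)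
  qed simp
  then show ?thesis
    using diagonalisationD(5)[OF d(1)] diagonalisationD(5)[OF d(2)]
    by (simp add: entropy_eq[OF product_diagonalisation[OF d]] entropy_eq[OF d(1)] entropy_eq[OF d(2)])
qed

lemma entropy_reversible:
  assumes "normal A \<rho>" "reversible \<Theta> A B V"
  shows "entropy \<Theta> B (V \<odot> \<rho>) = entropy \<Theta> A \<rho>"
proof -
  obtain ps \<alpha>s where d: "diagonalisation \<Theta> A \<rho> ps \<alpha>s" using ex_diagonalisation[OF assms(1)] by blast
  show ?thesis using entropy_eq[OF d] entropy_eq[OF reversible_diagonalisation[OF d assms(2)]] by simp
qed

text \<open>All eigenvalues are positive, so the logarithm inverts the exponential, and completeness
  turns the constant term into the deterministic effect. The computation may use the eigenstates
  that come with the hypothesis, because \<open>fun_dagger\<close> is independent of the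
  diagonalisation.\<close>

lemma gibbs_state_properties:
  assumes "gibbs_state \<Theta> A H \<beta> \<gamma>"
  obtains ps \<alpha>s Z where "normal A \<gamma>" "diagonalisation \<Theta> A \<gamma> ps \<alpha>s"
    "\<forall>x\<in>St A. ev (fun_dagger \<Theta> A ln \<gamma>) x = - \<beta> * ev H x - ln Z * ev (u A) x"
proof -
  obtain Es \<phi>s where E: "pure_maximal \<Theta> A \<phi>s" "length Es = length \<phi>s"
      "H = (\<Sum>i<length \<phi>s. Es ! i *\<^sub>R dag A (\<phi>s ! i))"
      "\<gamma> = (1 / (\<Sum>i<length \<phi>s. exp (- \<beta> * Es ! i))) *\<^sub>R (\<Sum>i<length \<phi>s. exp (- \<beta> * Es ! i) *\<^sub>R \<phi>s ! i)"
    using assms by (auto simp: gibbs_state_def Let_def)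
  let ?n = "length \<phi>s"
  define Z where "Z = (\<Sum>i<?n. exp (- \<beta> * Es ! i))"
  have cs: "complete A \<phi>s" using E(1) by (simp add: pure_maximal_iff)
  have Z: "Z > 0" unfolding Z_def using complete_nonempty[OF cs] by (intro sum_pos) auto
  define ps where "ps = map (\<lambda>e. exp (- \<beta> * e) / Z) Es"
  have ps: "ps ! i = exp (- \<beta> * Es ! i) / Z" if "i < ?n" for i using that E(2) by (simp add: ps_def)
  have len: "length ps = ?n" using E(2) by (simp add: ps_def)
  have "sum_list ps = (\<Sum>i<?n. exp (- \<beta> * Es ! i) / Z)" using ps len by (simp add: sum_list_sum_nth atLeast0LessThan)
  also have "\<dots> = 1" using Z by (simp add: Z_def flip: sum_divide_distrib)
  finally have s: "sum_list ps = 1" .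
  have \<gamma>: "\<gamma> = (\<Sum>i<?n. ps ! i *\<^sub>R \<phi>s ! i)" unfolding E(4) Z_def[symmetric] using ps by (simp add: scaleR_sum_right)
  have d: "diagonalisation \<Theta> A \<gamma> ps \<phi>s"
    using E(1) len s \<gamma> Z by (auto simp: diagonalisation_def ps_def)
  have pure: "pure_state \<Theta> A (\<phi>s ! i)" if "i < ?n" for i using diagonalisationD(7)[OF d that] .
  have u\<gamma>: "ev (u A) \<gamma> = 1"
  proof -
    have "ev (u A) \<gamma> = (\<Sum>i<?n. ps ! i)" using pure_state_normalised[OF pure] by (simp add: \<gamma> ev_sum normalised_iff)
    then show ?thesis using s len by (simp add: sum_list_sum_nth atLeast0LessThan)
  qed
  have "\<gamma> \<in> St A"
    unfolding \<gamma> using complete_nonempty[OF cs] pure_state_St[OF pure] diagonalisationD(4)[OF d] len u\<gamma>[unfolded \<gamma>]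
    by (intro state_combination) auto
  then have n: "normal A \<gamma>" using u\<gamma> by (simp add: normalised_iff)
  have "ev (fun_dagger \<Theta> A ln \<gamma>) x = - \<beta> * ev H x - ln Z * ev (u A) x" if x: "x \<in> St A" for x
  proof -
    have "ev (fun_dagger \<Theta> A ln \<gamma>) x = (\<Sum>i<?n. (- \<beta> * Es ! i - ln Z) * ev (dag A (\<phi>s ! i)) x)"
      using ev_fun_dagger[OF d x, of ln] ps Z by (simp add: ln_div)
    also have "\<dots> = - \<beta> * (\<Sum>i<?n. Es ! i * ev (dag A (\<phi>s ! i)) x) - ln Z * (\<Sum>i<?n. ev (dag A (\<phi>s ! i)) x)"
      by (simp add: left_diff_distrib sum_subtractf sum_distrib_left mult.assoc sum_negf)
    also have "(\<Sum>i<?n. ev (dag A (\<phi>s ! i)) x) = ev (u A) x"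
      using complete_sum[OF cs, of x] by (simp add: sum_list_sum_nth atLeast0LessThan)
    finally show ?thesis by (simp add: E(3) ev_sum)
  qed
  then show thesis using that[OF n d] by blast
qed

end

theorem theorem5p7p1:
  fixes \<Theta> :: "('s, 't::real_normed_vector) opt" and S E :: 's
    and H\<^sub>E \<rho>\<^sub>S \<gamma> U \<rho>' \<rho>\<^sub>S' \<rho>\<^sub>E' :: 't and k T \<beta> :: real
  assumes "sharp_theory_with_purification \<Theta>"
    and "k > 0" and "T > 0" and "\<beta> = 1 / (k * T)"
    and "H\<^sub>E \<in> observables \<Theta> E"
    and "normalised_state \<Theta> S \<rho>\<^sub>S"
    and "gibbs_state \<Theta> E H\<^sub>E \<beta> \<gamma>"
    and "reversible \<Theta> (S \<star>\<^bsub>\<Theta>\<^esub> E) (S \<star>\<^bsub>\<Theta>\<^esub> E) U"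
    and "\<rho>' = U \<odot>\<^bsub>\<Theta>\<^esub> (\<rho>\<^sub>S \<otimes>\<^bsub>\<Theta>\<^esub> \<gamma>)"
    and "\<rho>\<^sub>S' = marginal1 \<Theta> S E \<rho>'"
    and "\<rho>\<^sub>E' = marginal2 \<Theta> S E \<rho>'"
  shows "pairing \<Theta> H\<^sub>E \<rho>\<^sub>E' - pairing \<Theta> H\<^sub>E \<gamma> =
    k * T * (entropy \<Theta> S \<rho>\<^sub>S - entropy \<Theta> S \<rho>\<^sub>S' + mutual_information \<Theta> S E \<rho>'
      + relative_entropy \<Theta> E \<rho>\<^sub>E' \<gamma>)"
proof -
  interpret sharp_theory_with_purification \<Theta> by (rule assms(1))
  obtain ps \<alpha>s Z where \<gamma>: "normal E \<gamma>" "diagonalisation \<Theta> E \<gamma> ps \<alpha>s"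
    and ln\<gamma>: "\<forall>x\<in>St E. ev (fun_dagger \<Theta> E ln \<gamma>) x = - \<beta> * ev H\<^sub>E x - ln Z * ev (u E) x"
    by (rule gibbs_state_properties[OF assms(7)])
  have SE: "normal (S \<star>\<^bsub>\<Theta>\<^esub> E) (\<rho>\<^sub>S \<otimes>\<^bsub>\<Theta>\<^esub> \<gamma>)" by (rule normalised_par[OF assms(6) \<gamma>(1)])
  have "normal (S \<star>\<^bsub>\<Theta>\<^esub> E) \<rho>'" unfolding assms(9) by (rule normalised_seq[OF SE reversible_channel[OF assms(8)]])
  then have E': "normal E \<rho>\<^sub>E'" unfolding assms(11) by (rule normalised_marginal(2))
  have st: "\<gamma> \<in> St E" "\<rho>\<^sub>E' \<in> St E" using \<gamma>(1) E' by (auto simp: normalised_iff)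
  have H: "pairing \<Theta> H\<^sub>E x = ev H\<^sub>E x" if "x \<in> St E" for x
    using pairing_eq_ev[OF _ that] assms(5) by (simp add: observables_def)
  \<comment> \<open>The joint final entropy equals the sum of the initial ones, so in the mutual
    information the terms of \<open>\<rho>\<^sub>S\<close> and \<open>\<rho>\<^sub>S'\<close> cancel
    against the first two. The entropy of \<open>\<rho>\<^sub>E'\<close> cancels against the
    relative entropy, and that of \<gamma> supplies the initial energy.\<close>
  have "entropy \<Theta> (S \<star>\<^bsub>\<Theta>\<^esub> E) \<rho>' = entropy \<Theta> S \<rho>\<^sub>S + entropy \<Theta> E \<gamma>"
    unfolding assms(9) using entropy_reversible[OF SE assms(8)] entropy_product[OF assms(6) \<gamma>(1)] by simp
  moreover have "entropy \<Theta> E \<gamma> = \<beta> * ev H\<^sub>E \<gamma> + ln Z"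
    using ev_fun_dagger_self[OF \<gamma>(2) st(1)] bspec[OF ln\<gamma> st(1)] \<gamma>(1) by (simp add: normalised_iff)
  moreover have "relative_entropy \<Theta> E \<rho>\<^sub>E' \<gamma> = - entropy \<Theta> E \<rho>\<^sub>E' + \<beta> * ev H\<^sub>E \<rho>\<^sub>E' + ln Z"
    using relative_entropy_eq[OF E' \<gamma>(2)] bspec[OF ln\<gamma> st(2)] E' by (simp add: normalised_iff)
  ultimately have "entropy \<Theta> S \<rho>\<^sub>S - entropy \<Theta> S \<rho>\<^sub>S' + mutual_information \<Theta> S E \<rho>' + relative_entropy \<Theta> E \<rho>\<^sub>E' \<gamma> =
      \<beta> * (ev H\<^sub>E \<rho>\<^sub>E' - ev H\<^sub>E \<gamma>)"
    by (simp add: mutual_information_def assms(10,11) right_diff_distrib)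
  then show ?thesis using assms(2-4) by (simp add: H st)
qed

end
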